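(* Let $f\in C^2([0,1])$ satisfy $f(0)=f(1)=0$ and $0<f(s)\le f'(0)s$ for all $s\in(0,1)$, extended linearly to $\mathbb{R}\setminus[0,1]$. Set $\lambda_*=\sqrt{f'(0)}$ and $c_*=2\lambda_*$. Let $u_0:\mathbb{R}\to[0,1]$ be continuous and not identically zero, and suppose there exist $k\ge -3$ and constants $0<a_1\le a_2$ such that $a_1x^{k+1}e^{-\lambda_*x}\le u_0(x)\le a_2x^{k+1}e^{-\lambda_*x}$ for all sufficiently large $x$. Let $u$ be the solution of $u_t=u_{xx}+f(u)$ for $t>0$, $x\in\mathbb{R}$, with $u(0,\cdot)=u_0$, and for $m\in(0,1)$ let $X_m(t)=\sup\{x\in\mathbb{R}: u(t,x)\ge m\}$. Then for every $m\in(0,1)$: if $k>-3$, $X_m(t)-c_*t-\frac{k}{2\lambda_*}\ln t$ is bounded as $t\to+\infty$; if $k=-3$, $X_m(t)-c_*t+\frac{3}{2\lambda_*}\ln t-\frac{1}{\lambda_*}\ln\ln t$ is bounded as $t\to+\infty$.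
   Context: "Extended linearly" means $f$ is extended to $\mathbb{R}$ by affine functions outside $[0,1]$ (with matching values and slopes at $0$ and $1$). Bounded as $t\to+\infty$ means bounded for all sufficiently large $t$ (i.e. $\mathcal{O}(1)$ as $t\to+\infty$). *)

theory Defs
  imports "HOL-Analysis.Analysis"
begin

definition front :: "(real \<Rightarrow> real \<Rightarrow> real) \<Rightarrow> real \<Rightarrow> real \<Rightarrow> real" where
  "front u m t = Sup {x. u t x \<ge> m}"

definition classical_solution ::
  "(real \<Rightarrow> real) \<Rightarrow> (real \<Rightarrow> real) \<Rightarrow> (real \<Rightarrow> real \<Rightarrow> real) \<Rightarrow> bool" where
  "classical_solution f u0 u \<longleftrightarrow>
     continuous_on ({0..} \<times> UNIV) (\<lambda>(t,x). u t x) \<and>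
     (\<forall>x. u 0 x = u0 x) \<and>
     (\<exists>B. \<forall>t\<ge>0. \<forall>x. \<bar>u t x\<bar> \<le> B) \<and>
     (\<exists>ut ux uxx.
        continuous_on ({0<..} \<times> UNIV) (\<lambda>(t,x). ut t x) \<and>
        continuous_on ({0<..} \<times> UNIV) (\<lambda>(t,x). ux t x) \<and>
        continuous_on ({0<..} \<times> UNIV) (\<lambda>(t,x). uxx t x) \<and>
        (\<forall>t>0. \<forall>x.
           ((\<lambda>s. u s x) has_real_derivative ut t x) (at t) \<and>
           ((\<lambda>y. u t y) has_real_derivative ux t x) (at x) \<and>
           ((\<lambda>y. ux t y) has_real_derivative uxx t x) (at x) \<and>
           ut t x = uxx t x + f (u t x)))"

end

theory Submission
  imports Defs
begin

text \<open>
  Write \<open>r = k / 2\<close> and let \<open>b s = s powr r\<close> if \<open>k > -3\<close>, \<open>b s = s powr (- 3 / 2) * ln s\<close> if \<open>k = -3\<close>.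
  In the frame \<open>x = z + 2 \<lambda> t + ln (b s) / \<lambda> + x0\<close> with \<open>s = t + T\<close>, the substitution
  \<open>u = exp (- \<lambda> z) H / b s\<close> turns the equation linearised at \<open>0\<close> into
  \<open>H_s = H_zz + b' / (\<lambda> b) H_z\<close>. So it suffices to find a supersolution and a subsolution of this
  heat equation on a half-line that are comparable to \<open>b s\<close> for bounded \<open>z\<close> and to
  \<open>z powr (k + 1)\<close> at infinity. Both are explicit: combinations of the profiles
  \<open>z * (z\<^sup>2 + K s) powr r\<close>, which carry the initial tail, and \<open>b s * z * exp (- z\<^sup>2 / (4 s))\<close>, which
  carries the Dirichlet mode, times a factor \<open>2 - s powr (- 1 / 4)\<close> or \<open>1 + s powr (- 1 / 4)\<close> that produces slack against the drift;
  a term \<open>b s * exp (- \<lambda> z / 2)\<close> in the subsolution pays for the quadratic loss \<open>\<lambda>\<^sup>2 u - f u\<close>.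
  Comparison from \<open>t = 0\<close> bounds the front from above and shows that \<open>u\<close> stays bounded away from \<open>0\<close> on a window
  moving with the frame; a cosine bump growing exponentially then lifts any level to \<open>m\<close> in bounded time.
\<close>

section \<open>Parabolic comparison\<close>

text \<open>The choice of \<open>b\<close> comes from the heat equation on the half-line with
  Dirichlet condition. Data decaying like \<open>z powr (k + 1)\<close> have a first moment that,
  cut off at \<open>sqrt s\<close>, is of order \<open>s powr ((k + 3) / 2)\<close> for
  \<open>k > -3\<close> and \<open>ln s\<close> for \<open>k = -3\<close>; multiplied by the dipole
  decay \<open>s powr (- 3 / 2)\<close> this is \<open>b s\<close>.

  A front position up to a bounded error only needs barriers that are right up to a constant factor,
  so inequalities replace exact solutions. The obstacle is the drift term, of order
  \<open>b s / s\<close> wherever \<open>H_z\<close> is of order \<open>b s\<close>. The slowly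
  varying time factor, whose derivative is integrable and which therefore stays between 1 and 2,
  yields slack of relative size \<open>s powr (- 5 / 4)\<close>. This beats the drift only for
  \<open>z\<close> beyond \<open>sqrt s\<close>. Closer in, a source of order
  \<open>z * s powr (r - 1)\<close> does so once \<open>z\<close> is large. For bounded
  \<open>z\<close> the supersolution is simply cut off where it exceeds 1, while the subsolution
  needs its exponential term.

  The shift \<open>T\<close> makes inequalities that hold for large \<open>s\<close> available from
  \<open>t = 0\<close>; it costs a bounded displacement because \<open>ln (b s)\<close> is
  Lipschitz.\<close>

definition has_partials ::
  "real \<Rightarrow> real set \<Rightarrow> (real \<Rightarrow> real \<Rightarrow> real) \<Rightarrow> (real \<Rightarrow> real \<Rightarrow> real) \<Rightarrow> (real \<Rightarrow> real \<Rightarrow> real) \<Rightarrow>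
    (real \<Rightarrow> real \<Rightarrow> real) \<Rightarrow> bool" where
  "has_partials T S d ds dz dzz \<longleftrightarrow> (\<forall>s>T. \<forall>z\<in>S.
     ((\<lambda>s. d s z) has_real_derivative ds s z) (at s) \<and>
     (d s has_real_derivative dz s z) (at z) \<and>
     (dz s has_real_derivative dzz s z) (at z))"

lemma has_partials_diff:
  assumes "has_partials T S d ds dz dzz" "has_partials T S e es ez ezz"
  shows "has_partials T S (\<lambda>s z. d s z - e s z) (\<lambda>s z. ds s z - es s z)
           (\<lambda>s z. dz s z - ez s z) (\<lambda>s z. dzz s z - ezz s z)"
  using assms unfolding has_partials_def by (auto intro!: DERIV_diff)

lemma has_partials_subset:
  "has_partials T S d ds dz dzz \<Longrightarrow> S' \<subseteq> S \<Longrightarrow> has_partials T S' d ds dz dzz"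
  unfolding has_partials_def by blast

text \<open>If \<open>D < 0\<close>, then \<open>g'\<close> is negative just to the right of
  \<open>z\<close>, since \<open>g' z = 0\<close>, and the mean value theorem yields a smaller value
  of \<open>g\<close>. Only the derivative of \<open>g'\<close> at the single point \<open>z\<close>
  enters, so the comparison principle asks for no continuity of second derivatives.\<close>

lemma second_derivative_nonneg_at_min:
  fixes g g' :: "real \<Rightarrow> real"
  assumes e: "e > 0"
    and g: "\<And>y. \<bar>y - z\<bar> < e \<Longrightarrow> (g has_real_derivative g' y) (at y)"
    and g': "(g' has_real_derivative D) (at z)"
    and min: "\<And>y. \<bar>y - z\<bar> < e \<Longrightarrow> g z \<le> g y"
  shows "g' z = 0" "0 \<le> D"
proof -
  show z: "g' z = 0"
    using DERIV_local_min[OF g e] min e by (simp add: abs_minus_commute)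
  show "0 \<le> D"
  proof (rule ccontr)
    assume "\<not> 0 \<le> D"
    then obtain d where d: "d > 0" "\<And>h. 0 < h \<Longrightarrow> h < d \<Longrightarrow> g' (z + h) < g' z"
      using DERIV_neg_dec_right[OF g'] by auto
    define h where "h = min d e / 2"
    have h: "0 < h" "h < d" "h < e" using d e by (auto simp: h_def)
    have "\<exists>c. z < c \<and> c < z + h \<and> g (z + h) - g z = (z + h - z) * g' c"
      by (rule MVT2) (use h in \<open>auto intro!: g\<close>)
    then obtain c where c: "z < c" "c < z + h" "g (z + h) - g z = h * g' c" by auto
    have "g' c < 0" using d(2)[of "c - z"] c h z by auto
    then have "g (z + h) < g z" using c(3) h mult_pos_neg[of h "g' c"] by linarith
    then show False using min[of "z + h"] h by auto
  qed
qed

text \<open>The penalisation \<open>\<epsilon> (1 + z\<^sup>2)\<close> makes a negative infimum attained.\<close>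

lemma parabolic_comparison:
  fixes d :: "real \<Rightarrow> real \<Rightarrow> real"
  assumes S: "closed S"
    and cont: "continuous_on ({T0..T1} \<times> S) (\<lambda>(s, z). d s z)"
    and bdd: "\<And>s z. s \<in> {T0..T1} \<Longrightarrow> z \<in> S \<Longrightarrow> - B \<le> d s z"
    and init: "\<And>z. z \<in> S \<Longrightarrow> 0 \<le> d T0 z"
    and der: "has_partials T0 (interior S) d ds dz dzz"
    and ineq: "\<And>s z. T0 < s \<Longrightarrow> s \<le> T1 \<Longrightarrow> z \<in> S \<Longrightarrow> d s z < 0 \<Longrightarrow>
        z \<in> interior S \<and> dzz s z + \<beta> s * dz s z + C * d s z \<le> ds s z"
    and beta: "\<And>s. T0 < s \<Longrightarrow> s \<le> T1 \<Longrightarrow> \<bar>\<beta> s\<bar> \<le> \<beta>max"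
    and C: "0 \<le> C"
    and s: "T0 \<le> s" "s \<le> T1" and z: "z \<in> S"
  shows "0 \<le> d s z"
proof (rule ccontr)
  assume neg: "\<not> 0 \<le> d s z"
  have "s \<noteq> T0" using neg init z by auto
  then have "T0 < T1" using s by auto
  have b0: "0 \<le> \<beta>max" using beta[of T1] \<open>T0 < T1\<close> by auto
  \<comment> \<open>\<open>C\<close> absorbs the zeroth-order term, \<open>\<beta>max\<close> the
    drift acting on \<open>\<epsilon> * z\<^sup>2\<close>, and 3 exceeds the 2 coming from the
    second derivative of \<open>z\<^sup>2\<close>.\<close>
  define K where "K = C + 3 + \<beta>max"
  have K: "0 < K" using C b0 by (simp add: K_def)
  \<comment> \<open>With this value the penalty at the offending point is half the size of the
    weighted negative value there, so \<open>pen\<close> is still negative.\<close>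
  define \<epsilon> where "\<epsilon> = - d s z * exp (- K * (s - T0)) / (2 * (1 + z\<^sup>2))"
  have z2: "0 < 1 + z\<^sup>2" by (simp add: add_pos_nonneg)
  have eps: "0 < \<epsilon>" using neg z2 by (simp add: \<epsilon>_def field_simps mult_less_0_iff)
  define pen where "pen = (\<lambda>s z. d s z * exp (- K * (s - T0)) + \<epsilon> * (1 + z\<^sup>2))"
  have "\<epsilon> * (1 + z\<^sup>2) = - d s z * exp (- K * (s - T0)) / 2"
  proof -
    have "a / (2 * y) * y = a / 2" if "0 < y" for a y :: real using that by simp
    then show ?thesis using z2 unfolding \<epsilon>_def by blast
  qed
  then have chineg: "pen s z < 0"
    using neg by (simp add: pen_def mult_less_0_iff)
  define R where "R = max \<bar>z\<bar> (sqrt (\<bar>B\<bar> / \<epsilon>))"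
  have far: "0 < pen s' z'" if "s' \<in> {T0..T1}" "z' \<in> S" "R \<le> \<bar>z'\<bar>" for s' z'
  proof -
    have "sqrt (\<bar>B\<bar> / \<epsilon>) \<le> \<bar>z'\<bar>" using that by (simp add: R_def)
    then have "\<bar>B\<bar> / \<epsilon> \<le> z'\<^sup>2"
      using real_sqrt_le_iff[of "\<bar>B\<bar> / \<epsilon>" "z'\<^sup>2"] by (simp add: real_sqrt_abs)
    then have 1: "\<bar>B\<bar> \<le> \<epsilon> * z'\<^sup>2" using eps by (simp add: field_simps)
    have "exp (- K * (s' - T0)) \<le> 1" using that K by simp
    then have "\<bar>B\<bar> * exp (- K * (s' - T0)) \<le> \<bar>B\<bar>" by (simp add: mult_left_le)
    moreover have "- \<bar>B\<bar> * exp (- K * (s' - T0)) \<le> d s' z' * exp (- K * (s' - T0))"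
      using bdd[OF that(1,2)] by (intro mult_right_mono) auto
    ultimately show ?thesis using 1 eps by (simp add: pen_def algebra_simps)
  qed
  let ?D = "{T0..T1} \<times> (S \<inter> {-R..R})"
  have "compact ?D"
    using S by (intro compact_Times compact_Icc) (simp add: closed_Int_compact)
  moreover have "(s, z) \<in> ?D" using s z by (auto simp: R_def)
  moreover have "continuous_on ?D (\<lambda>(s, z). pen s z)"
  proof -
    have "continuous_on ?D (\<lambda>p. d (fst p) (snd p))"
      using continuous_on_subset[OF cont, of ?D] by (auto simp: case_prod_beta)
    then show ?thesis unfolding pen_def case_prod_beta by (intro continuous_intros)
  qed
  ultimately obtain p where p: "p \<in> ?D" "\<And>q. q \<in> ?D \<Longrightarrow> (\<lambda>(s, z). pen s z) p \<le> (\<lambda>(s, z). pen s z) q"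
    using continuous_attains_inf[of ?D "\<lambda>(s, z). pen s z"] by blast
  obtain s1 z1 where [simp]: "p = (s1, z1)" by (cases p)
  have p1: "T0 \<le> s1" "s1 \<le> T1" "z1 \<in> S" using p by auto
  have chi1: "pen s1 z1 < 0" using p(2)[OF \<open>(s, z) \<in> ?D\<close>] chineg by simp
  have "\<bar>z1\<bar> < R"
  proof (rule ccontr)
    assume "\<not> \<bar>z1\<bar> < R"
    then have "0 < pen s1 z1" using p1 by (intro far) auto
    then show False using chi1 by simp
  qed
  have min1: "pen s1 z1 \<le> pen s' z'" if "s' \<in> {T0..T1}" "z' \<in> S" for s' z'
  proof (cases "\<bar>z'\<bar> < R")
    case True
    then show ?thesis using p(2)[of "(s', z')"] that by (auto simp: abs_le_iff abs_less_iff)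
  next
    case False
    then show ?thesis using far[OF that] chi1 by auto
  qed
  define E where "E = exp (- K * (s1 - T0))"
  have E: "0 < E" by (simp add: E_def)
  have dneg: "d s1 z1 * E < - \<epsilon> * (1 + z1\<^sup>2)" using chi1 by (simp add: pen_def E_def)
  moreover have "0 < \<epsilon> * (1 + z1\<^sup>2)" using eps by (simp add: add_pos_nonneg)
  ultimately have "d s1 z1 * E < 0" by linarith
  then have dneg': "d s1 z1 < 0" using E by (simp add: mult_less_0_iff)
  have s1: "T0 < s1" using dneg' init[OF p1(3)] p1 by (cases "s1 = T0") auto
  have in1: "z1 \<in> interior S" and ine1: "dzz s1 z1 + \<beta> s1 * dz s1 z1 + C * d s1 z1 \<le> ds s1 z1"
    using ineq[OF s1 p1(2,3) dneg'] by auto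
  obtain e where e: "e > 0" "\<And>y. \<bar>y - z1\<bar> < e \<Longrightarrow> y \<in> interior S"
    using in1 open_interior[of S] unfolding open_dist by (auto simp: dist_real_def)
  have dS: "(d s1 has_real_derivative dz s1 y) (at y)"
       "(dz s1 has_real_derivative dzz s1 y) (at y)" if "\<bar>y - z1\<bar> < e" for y
    using der s1 e(2)[OF that] unfolding has_partials_def by auto
  have chiz: "(pen s1 has_real_derivative dz s1 y * E + \<epsilon> * (2 * y)) (at y)" if "\<bar>y - z1\<bar> < e" for y
    unfolding pen_def E_def[symmetric] by (auto intro!: derivative_eq_intros dS that)
  have chizz: "((\<lambda>y. dz s1 y * E + \<epsilon> * (2 * y)) has_real_derivative dzz s1 z1 * E + \<epsilon> * 2) (at z1)"
    using e by (auto intro!: derivative_eq_intros dS)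
  have chimin: "pen s1 z1 \<le> pen s1 y" if "\<bar>y - z1\<bar> < e" for y
    using e(2)[OF that] interior_subset p1 by (intro min1) auto
  have Z: "dz s1 z1 * E + \<epsilon> * (2 * z1) = 0" "0 \<le> dzz s1 z1 * E + \<epsilon> * 2"
    using second_derivative_nonneg_at_min[OF e(1) chiz chizz chimin] by auto
  have chis: "((\<lambda>s. pen s z1) has_real_derivative ds s1 z1 * E + d s1 z1 * (- K * E)) (at s1)"
  proof -
    have "((\<lambda>s. d s z1) has_real_derivative ds s1 z1) (at s1)"
      using der s1 in1 unfolding has_partials_def by auto
    then show ?thesis unfolding pen_def E_def
      by (auto intro!: derivative_eq_intros simp: algebra_simps)
  qed
  \<comment> \<open>The minimum may sit at the final time, so only earlier times are compared: the
    time derivative is nonpositive, not necessarily zero.\<close>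
  have "ds s1 z1 * E + d s1 z1 * (- K * E) \<le> 0"
  proof (rule ccontr)
    assume "\<not> ?thesis"
    then obtain h0 where h0: "h0 > 0" "\<And>h. 0 < h \<Longrightarrow> h < h0 \<Longrightarrow> pen (s1 - h) z1 < pen s1 z1"
      using DERIV_pos_inc_left[OF chis] by force
    define h where "h = min h0 (s1 - T0) / 2"
    have "0 < h" "h < h0" "h < s1 - T0" using h0(1) s1 by (auto simp: h_def min_def)
    then show False using h0(2)[of h] min1[of "s1 - h" z1] p1 by auto
  qed
  then have 1: "ds s1 z1 * E \<le> K * (d s1 z1 * E)" by (simp add: algebra_simps)
  have "(dzz s1 z1 + \<beta> s1 * dz s1 z1 + C * d s1 z1) * E \<le> ds s1 z1 * E"
    using ine1 E by (intro mult_right_mono) auto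
  then have 2: "dzz s1 z1 * E + \<beta> s1 * (dz s1 z1 * E) + C * (d s1 z1 * E) \<le> K * (d s1 z1 * E)"
    using 1 by (simp add: algebra_simps)
  have 3: "dz s1 z1 * E = - 2 * \<epsilon> * z1" using Z by simp
  have "\<bar>\<beta> s1\<bar> * \<bar>z1\<bar> \<le> \<beta>max * \<bar>z1\<bar>"
    using beta[OF s1 p1(2)] by (intro mult_right_mono) auto
  then have "\<beta> s1 * z1 \<le> \<beta>max * \<bar>z1\<bar>"
    using abs_ge_self[of "\<beta> s1 * z1"] by (simp add: abs_mult)
  moreover have "\<bar>z1\<bar> * 2 \<le> 1 + z1\<^sup>2" using sum_squares_bound[of "\<bar>z1\<bar>" 1] by simp
  then have "\<beta>max * (\<bar>z1\<bar> * 2) \<le> \<beta>max * (1 + z1\<^sup>2)" using b0 by (intro mult_left_mono)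
  ultimately have "2 * (\<beta> s1 * z1) \<le> \<beta>max * (1 + z1\<^sup>2)" by linarith
  then have 4: "\<epsilon> * (2 * (\<beta> s1 * z1)) \<le> \<epsilon> * (\<beta>max * (1 + z1\<^sup>2))" using eps by simp
  have 5: "(K - C) * (d s1 z1 * E) < (K - C) * (- \<epsilon> * (1 + z1\<^sup>2))"
    using dneg b0 by (intro mult_strict_left_mono) (auto simp: K_def)
  have "- \<epsilon> * 2 - \<epsilon> * (2 * (\<beta> s1 * z1)) \<le> (K - C) * (d s1 z1 * E)"
    using 2[unfolded 3] Z(2) by (simp add: algebra_simps)
  then have "(3 + \<beta>max) * (\<epsilon> * (1 + z1\<^sup>2)) < \<epsilon> * 2 + \<epsilon> * (\<beta>max * (1 + z1\<^sup>2))"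
    using 4 5 by (simp add: K_def algebra_simps)
  then have "\<epsilon> * (3 * (1 + z1\<^sup>2)) < \<epsilon> * 2" by (simp add: algebra_simps)
  then have "3 * (1 + z1\<^sup>2) < 2" using eps mult_less_cancel_left_pos by blast
  moreover have "3 * 1 \<le> 3 * (1 + z1\<^sup>2)" by (intro mult_left_mono) auto
  ultimately show False by linarith
qed

text \<open>The chain rule along the curve requires joint differentiability of \<open>u\<close>. It
  follows from the two partial derivatives as soon as one of them, here \<open>ux\<close>, is
  jointly continuous.\<close>

lemma moving_frame_derivative:
  fixes u ut ux :: "real \<Rightarrow> real \<Rightarrow> real"
  assumes cont: "continuous_on ({0<..} \<times> UNIV) (\<lambda>(t, x). ux t x)"
    and ut: "\<And>t x. 0 < t \<Longrightarrow> ((\<lambda>s. u s x) has_real_derivative ut t x) (at t)"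
    and ux: "\<And>t x. 0 < t \<Longrightarrow> (u t has_real_derivative ux t x) (at x)"
    and zeta: "(\<zeta> has_real_derivative \<zeta>') (at s)"
    and s: "T < s"
  shows "((\<lambda>s. u (s - T) (z + \<zeta> s)) has_real_derivative
           ut (s - T) (z + \<zeta> s) + \<zeta>' * ux (s - T) (z + \<zeta> s)) (at s)"
proof -
  let ?t = "s - T" and ?x = "z + \<zeta> s"
  have t: "0 < ?t" using s by simp
  have "((\<lambda>(x, y). u x y) has_derivative (\<lambda>(tx, ty). ut ?t ?x * tx + blinfun_scaleR_left (ux ?t ?x) ty))
      (at (?t, ?x) within {0<..} \<times> UNIV)"
  proof (rule has_derivative_partialsI)
    show "((\<lambda>t. u t ?x) has_derivative (*) (ut ?t ?x)) (at ?t within {0<..})"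
      using ut[OF t] by (simp add: has_field_derivative_def has_derivative_at_withinI)
    show "(u t has_derivative blinfun_apply (blinfun_scaleR_left (ux t x))) (at x within UNIV)"
      if "t \<in> {0<..}" for t x
    proof -
      have "blinfun_apply (blinfun_scaleR_left (ux t x)) = (*) (ux t x)"
        by (auto simp: fun_eq_iff)
      then show ?thesis using ux[of t x] that by (simp add: has_field_derivative_def)
    qed
    have "continuous (at (?t, ?x) within {0<..} \<times> UNIV) (\<lambda>(t, x). ux t x)"
      using cont t by (simp add: continuous_on_eq_continuous_within)
    then show "continuous (at (?t, ?x) within {0<..} \<times> UNIV) (\<lambda>(t, x). blinfun_scaleR_left (ux t x))"
      unfolding case_prod_beta continuous_within
      by (rule bounded_linear.tendsto[OF bounded_linear_blinfun_scaleR_left])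
  qed (auto)
  then have 1: "((\<lambda>(x, y). u x y) has_derivative (\<lambda>(tx, ty). ut ?t ?x * tx + blinfun_scaleR_left (ux ?t ?x) ty))
      (at (?t, ?x))"
    using t by (subst (asm) at_within_open) (auto intro!: open_Times)
  have 2: "((\<lambda>s. (s - T, z + \<zeta> s)) has_derivative (\<lambda>h. (h, \<zeta>' * h))) (at s)"
    using zeta unfolding has_field_derivative_def
    by (auto intro!: derivative_eq_intros)
  have "((\<lambda>s. u (s - T) (z + \<zeta> s)) has_derivative
      (\<lambda>h. ut ?t ?x * h + \<zeta>' * h * ux ?t ?x)) (at s)"
    using diff_chain_at[OF 2 1] by (simp add: o_def)
  moreover have "(\<lambda>h. ut ?t ?x * h + \<zeta>' * h * ux ?t ?x) = (*) (ut ?t ?x + \<zeta>' * ux ?t ?x)"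
    by (auto simp: fun_eq_iff algebra_simps)
  ultimately show ?thesis unfolding has_field_derivative_def by simp
qed

section \<open>The KPP equation and moving frames\<close>

locale kpp =
  fixes f f1 f2 u0 :: "real \<Rightarrow> real" and u :: "real \<Rightarrow> real \<Rightarrow> real"
  assumes f_deriv: "\<And>x. (f has_real_derivative f1 x) (at x)"
    and f1_deriv: "\<And>x. x \<in> {0..1} \<Longrightarrow> (f1 has_real_derivative f2 x) (at x within {0..1})"
    and f2_cont: "continuous_on {0..1} f2"
    and f_left: "\<And>x. x < 0 \<Longrightarrow> f x = f1 0 * x"
    and f_right: "\<And>x. 1 < x \<Longrightarrow> f x = f1 1 * (x - 1)"
    and f0: "f 0 = 0" and f1z: "f 1 = 0"
    and f_kpp: "\<And>s. s \<in> {0<..<1} \<Longrightarrow> 0 < f s \<and> f s \<le> f1 0 * s"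
    and u0_range: "\<And>x. u0 x \<in> {0..1}"
    and u_sol: "classical_solution f u0 u"
begin

section \<open>Bounds on the reaction term\<close>

definition lam :: real where "lam = sqrt (f1 0)"

lemma f1_0_pos: "0 < f1 0"
  using f_kpp[of "1/2"] by auto

lemma lam_pos: "0 < lam"
  using f1_0_pos by (simp add: lam_def)

lemma lam_sq: "lam\<^sup>2 = f1 0"
  using f1_0_pos by (simp add: lam_def)

lemma f_le: "x \<in> {0..1} \<Longrightarrow> f x \<le> lam\<^sup>2 * x"
  using f_kpp[of x] f0 f1z f1_0_pos by (cases "x = 0 \<or> x = 1") (auto simp: lam_sq)

text \<open>The second derivative of \<open>f\<close> enters only here. Integrated once more, the
  bound makes the loss against the linearisation at 0 quadratic; it also makes \<open>f\<close>
  Lipschitz on \<open>{0..1}\<close>.\<close>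

lemma f1_bound: "\<exists>M\<ge>0. \<forall>x\<in>{0..1}. \<bar>f1 x - f1 0\<bar> \<le> M * x"
proof -
  have "bounded (f2 ` {0..1})"
    using f2_cont by (intro compact_imp_bounded compact_continuous_image) auto
  then obtain M where M: "M > 0" "\<And>x. x \<in> {0..1} \<Longrightarrow> \<bar>f2 x\<bar> \<le> M"
    unfolding bounded_pos by auto
  have "norm (f1 x - f1 0) \<le> M * norm (x - 0)" if "x \<in> {0..1}" for x
  proof (rule field_differentiable_bound[of "{0..1}" f1 f2])
    show "convex {0..1::real}" by simp
  qed (use f1_deriv M(2) that in auto)
  then show ?thesis using M(1) by (intro exI[of _ M]) auto
qed

lemma f_ge: "\<exists>M\<ge>0. \<forall>x\<in>{0..1}. lam\<^sup>2 * x - M * x\<^sup>2 \<le> f x"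
proof -
  obtain M where M: "M \<ge> 0" "\<And>x. x \<in> {0..1} \<Longrightarrow> \<bar>f1 x - f1 0\<bar> \<le> M * x"
    using f1_bound by blast
  have "lam\<^sup>2 * x - M * x\<^sup>2 \<le> f x" if x: "x \<in> {0..1}" for x
  proof (cases "x = 0")
    case False
    then have "\<exists>c. 0 < c \<and> c < x \<and> f x - f 0 = (x - 0) * f1 c"
      using x by (intro MVT2 f_deriv) auto
    then obtain c where c: "0 < c" "c < x" "f x = x * f1 c" using f0 by auto
    have "f1 0 - M * x \<le> f1 c"
      using M(2)[of c] mult_left_mono[OF less_imp_le[OF c(2)] M(1)] c x by auto
    then have "x * (f1 0 - M * x) \<le> x * f1 c" using x by (intro mult_left_mono) auto
    then show ?thesis using c unfolding lam_sq by (simp add: power2_eq_square algebra_simps)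
  qed (simp add: f0)
  then show ?thesis using M(1) by blast
qed

lemma f_lipschitz: "\<exists>L\<ge>0. \<forall>x\<in>{0..1}. \<forall>y\<in>{0..1}. \<bar>f x - f y\<bar> \<le> L * \<bar>x - y\<bar>"
proof -
  obtain M where M: "M \<ge> 0" "\<And>x. x \<in> {0..1} \<Longrightarrow> \<bar>f1 x - f1 0\<bar> \<le> M * x"
    using f1_bound by blast
  have b: "\<bar>f1 x\<bar> \<le> \<bar>f1 0\<bar> + M" if "x \<in> {0..1}" for x
    using M(2)[OF that] mult_left_le[of x M] M(1) that by auto
  have "norm (f x - f y) \<le> (\<bar>f1 0\<bar> + M) * norm (x - y)" if "x \<in> {0..1}" "y \<in> {0..1}" for x y
  proof (rule field_differentiable_bound[of "{0..1}" f f1])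
    show "convex {0..1::real}" by simp
  qed (use f_deriv b that in \<open>auto intro: has_field_derivative_at_within\<close>)
  then show ?thesis using M(1) by (intro exI[of _ "\<bar>f1 0\<bar> + M"]) auto
qed

text \<open>Near 0 the quadratic lower bound leaves the slope \<open>lam\<^sup>2 / 2\<close>. On the
  compact remainder of \<open>{0..m}\<close> the function \<open>f\<close> has a positive minimum
  because \<open>m < 1\<close>. The linear bound drives the growing bump in
  \<open>hair_trigger\<close>.\<close>

lemma f_linear_lower:
  assumes m: "0 < m" "m < 1"
  shows "\<exists>\<rho>>0. \<forall>x\<in>{0..m}. \<rho> * x \<le> f x"
proof -
  obtain M where M: "M \<ge> 0" "\<And>x. x \<in> {0..1} \<Longrightarrow> lam\<^sup>2 * x - M * x\<^sup>2 \<le> f x"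
    using f_ge by blast
  define \<delta> where "\<delta> = lam\<^sup>2 / (2 * (M + 1))"
  have \<delta>: "\<delta> > 0" using lam_pos M(1) by (simp add: \<delta>_def)
  have 1: "lam\<^sup>2 / 2 * x \<le> f x" if "0 \<le> x" "x \<le> \<delta>" "x \<le> m" for x
  proof -
    have "M * x \<le> (M + 1) * \<delta>" using M(1) that by (intro mult_mono) auto
    also have "\<dots> = lam\<^sup>2 / 2" using M(1) by (simp add: \<delta>_def field_simps)
    finally have "x * (M * x) \<le> x * (lam\<^sup>2 / 2)" using that by (intro mult_left_mono) auto
    then show ?thesis using M(2)[of x] that m by (simp add: power2_eq_square algebra_simps)
  qed
  show ?thesis
  proof (cases "\<delta> \<le> m")
    case True
    have "continuous_on {\<delta>..m} f"
      using f_deriv by (intro continuous_at_imp_continuous_on) (auto dest: DERIV_isCont)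
    then obtain x0 where x0: "x0 \<in> {\<delta>..m}" "\<And>x. x \<in> {\<delta>..m} \<Longrightarrow> f x0 \<le> f x"
      using continuous_attains_inf[of "{\<delta>..m}" f] True by auto
    have f0p: "0 < f x0" using x0(1) \<delta> m f_kpp[of x0] by auto
    have "min (lam\<^sup>2 / 2) (f x0) * x \<le> f x" if "x \<in> {0..m}" for x
    proof (cases "x \<le> \<delta>")
      case True
      have "min (lam\<^sup>2 / 2) (f x0) * x \<le> lam\<^sup>2 / 2 * x" using that by (intro mult_right_mono) auto
      then show ?thesis using 1[of x] True that by auto
    next
      case False
      have "min (lam\<^sup>2 / 2) (f x0) * x \<le> f x0 * 1" using that m f0p by (intro mult_mono) auto
      then show ?thesis using x0(2)[of x] False that by auto
    qed
    then show ?thesis using f0p lam_pos by (intro exI[of _ "min (lam\<^sup>2 / 2) (f x0)"]) auto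
  next
    case False
    then show ?thesis using 1 lam_pos by (intro exI[of _ "lam\<^sup>2 / 2"]) auto
  qed
qed

section \<open>Regularity and range of the solution\<close>

lemma u_partials:
  obtains ut ux uxx where
    "has_partials 0 UNIV u ut ux uxx"
    "continuous_on ({0<..} \<times> UNIV) (\<lambda>(t, x). ux t x)"
    "\<And>t x. 0 < t \<Longrightarrow> ut t x = uxx t x + f (u t x)"
proof -
  obtain ut ux uxx where 1: "continuous_on ({0<..} \<times> UNIV) (\<lambda>(t, x). ux t x)"
    and 2: "\<forall>t>0. \<forall>x. ((\<lambda>s. u s x) has_real_derivative ut t x) (at t) \<and>
           ((\<lambda>y. u t y) has_real_derivative ux t x) (at x) \<and>
           ((\<lambda>y. ux t y) has_real_derivative uxx t x) (at x) \<and>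
           ut t x = uxx t x + f (u t x)"
    using u_sol unfolding classical_solution_def by blast
  show thesis
    by (rule that[of ut ux uxx]) (use 1 2 in \<open>unfold has_partials_def, blast+\<close>)
qed

lemma u_cont: "continuous_on ({0..} \<times> UNIV) (\<lambda>(t, x). u t x)"
  using u_sol unfolding classical_solution_def by blast

lemma u_init: "u 0 x = u0 x"
  using u_sol unfolding classical_solution_def by blast

text \<open>Outside \<open>{0..1}\<close> the extension of \<open>f\<close> is affine, so wherever
  \<open>u\<close> is negative or exceeds 1 the deviation satisfies a linear inequality with
  zeroth-order coefficient \<open>\<bar>f1 0\<bar>\<close> or \<open>\<bar>f1 1\<bar>\<close>. The
  boundedness in \<open>classical_solution\<close> supplies the a priori lower bound that comparison
  requires.\<close>

lemma u_range:
  assumes "0 \<le> t"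
  shows "0 \<le> u t x" "u t x \<le> 1"
proof -
  obtain ut ux uxx where p: "has_partials 0 UNIV u ut ux uxx"
    and pde: "\<And>t x. 0 < t \<Longrightarrow> ut t x = uxx t x + f (u t x)"
    using u_partials by metis
  obtain B where B: "\<And>t x. 0 \<le> t \<Longrightarrow> \<bar>u t x\<bar> \<le> B"
    using u_sol unfolding classical_solution_def by blast
  have c: "continuous_on ({0..t} \<times> UNIV) (\<lambda>(t, x). u t x)"
    by (rule continuous_on_subset[OF u_cont]) auto
  show "0 \<le> u t x"
  proof (rule parabolic_comparison[where d = u and S = UNIV and ?T0.0 = 0 and ?T1.0 = t and B = B and
        ds = ut and dz = ux and dzz = uxx and \<beta> = "\<lambda>_. 0" and C = "\<bar>f1 0\<bar>" and \<beta>max = 0])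
    show "- B \<le> u s z" if "s \<in> {0..t}" for s z using B[of s z] that by auto
    show "z \<in> interior UNIV \<and> uxx s z + 0 * ux s z + \<bar>f1 0\<bar> * u s z \<le> ut s z"
      if "0 < s" "u s z < 0" for s z
      using pde[OF that(1)] f_left[OF that(2)] f1_0_pos by simp
  qed (use c u_init u0_range p assms in auto)
  have c1: "continuous_on ({0..t} \<times> UNIV) (\<lambda>(t, x). 1 - u t x)"
    using c unfolding case_prod_beta by (intro continuous_intros)
  have p1: "has_partials 0 (interior UNIV) (\<lambda>t x. 1 - u t x) (\<lambda>t x. - ut t x) (\<lambda>t x. - ux t x) (\<lambda>t x. - uxx t x)"
    using p unfolding has_partials_def by (auto intro!: derivative_eq_intros)
  have "0 \<le> 1 - u t x"
  proof (rule parabolic_comparison[OF _ c1 _ _ p1, where B = "B + 1" and \<beta> = "\<lambda>_. 0" and C = "\<bar>f1 1\<bar>" and \<beta>max = 0])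
    show "- (B + 1) \<le> 1 - u s z" if "s \<in> {0..t}" for s z using B[of s z] that by auto
    show "z \<in> interior UNIV \<and> - uxx s z + 0 * - ux s z + \<bar>f1 1\<bar> * (1 - u s z) \<le> - ut s z"
      if "0 < s" "1 - u s z < 0" for s z
    proof -
      have "f (u s z) = f1 1 * (u s z - 1)" using f_right[of "u s z"] that by simp
      moreover have "f1 1 * (u s z - 1) \<le> \<bar>f1 1\<bar> * (u s z - 1)"
        using that by (intro mult_right_mono) auto
      ultimately show ?thesis using pde[OF that(1)] by (simp add: algebra_simps)
    qed
    show "0 \<le> 1 - u 0 z" for z using u_init[of z] u0_range[of z] by auto
  qed (use assms in auto)
  then show "u t x \<le> 1" by simp
qed

section \<open>Moving frames and comparison with barriers inside them\<close>

lemma moving_frame: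
  assumes zeta: "\<And>s. T < s \<Longrightarrow> (\<zeta> has_real_derivative \<zeta>' s) (at s)"
    and cont: "continuous_on {T..} \<zeta>"
  shows "\<exists>vs vz vzz. has_partials T UNIV (\<lambda>s z. u (s - T) (z + \<zeta> s)) vs vz vzz \<and>
    (\<forall>s z. T < s \<longrightarrow> vs s z = vzz s z + \<zeta>' s * vz s z + f (u (s - T) (z + \<zeta> s))) \<and>
    continuous_on ({T..} \<times> UNIV) (\<lambda>(s, z). u (s - T) (z + \<zeta> s))"
proof -
  obtain ut ux uxx where p: "has_partials 0 UNIV u ut ux uxx"
    and pde: "\<And>t x. 0 < t \<Longrightarrow> ut t x = uxx t x + f (u t x)"
    and c: "continuous_on ({0<..} \<times> UNIV) (\<lambda>(t, x). ux t x)"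
    using u_partials by metis
  have pp: "((\<lambda>s. u s x) has_real_derivative ut t x) (at t)"
      "(u t has_real_derivative ux t x) (at x)"
      "(ux t has_real_derivative uxx t x) (at x)" if "0 < t" for t x
    using p that unfolding has_partials_def by auto
  let ?vs = "\<lambda>s z. ut (s - T) (z + \<zeta> s) + \<zeta>' s * ux (s - T) (z + \<zeta> s)"
  have "has_partials T UNIV (\<lambda>s z. u (s - T) (z + \<zeta> s)) ?vs
     (\<lambda>s z. ux (s - T) (z + \<zeta> s)) (\<lambda>s z. uxx (s - T) (z + \<zeta> s))"
    unfolding has_partials_def
  proof (intro allI impI ballI conjI)
    fix s z assume s: "T < s"
    show "((\<lambda>s. u (s - T) (z + \<zeta> s)) has_real_derivative ?vs s z) (at s)"
      by (rule moving_frame_derivative[OF c pp(1,2) zeta[OF s] s])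
    show "((\<lambda>z. u (s - T) (z + \<zeta> s)) has_real_derivative ux (s - T) (z + \<zeta> s)) (at z)"
      "((\<lambda>z. ux (s - T) (z + \<zeta> s)) has_real_derivative uxx (s - T) (z + \<zeta> s)) (at z)"
      using pp(2,3)[of "s - T" "z + \<zeta> s"] s by (simp_all add: DERIV_shift)
  qed
  moreover have "?vs s z = uxx (s - T) (z + \<zeta> s) + \<zeta>' s * ux (s - T) (z + \<zeta> s) + f (u (s - T) (z + \<zeta> s))"
    if "T < s" for s z using pde[of "s - T"] that by simp
  moreover have "continuous_on ({T..} \<times> UNIV) (\<lambda>(s, z). u (s - T) (z + \<zeta> s))"
  proof -
    have z: "continuous_on ({T..} \<times> UNIV) (\<lambda>p::real \<times> real. \<zeta> (fst p))"
      by (rule continuous_on_compose2[OF cont]) (auto intro: continuous_intros)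
    have "continuous_on ({T..} \<times> UNIV) (\<lambda>p. (\<lambda>(t, x). u t x) (fst p - T, snd p + \<zeta> (fst p)))"
      by (rule continuous_on_compose2[OF u_cont]) (auto intro!: continuous_intros z)
    then show ?thesis by (simp add: case_prod_beta)
  qed
  ultimately show ?thesis by blast
qed

text \<open>Since \<open>f v \<le> lam\<^sup>2 * v\<close>, a supersolution of the linearised
  equation is enough. On the lateral boundary the value 1 suffices because \<open>u \<le> 1\<close>,
  whatever happens to the left of \<open>S\<close>.\<close>

lemma frame_supersolution:
  assumes zeta: "\<And>s. T < s \<Longrightarrow> (\<zeta> has_real_derivative \<zeta>' s) (at s)"
    and zcont: "continuous_on {T..} \<zeta>"
    and zbd: "\<And>s. T < s \<Longrightarrow> \<bar>\<zeta>' s\<bar> \<le> \<beta>max"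
    and S: "closed S"
    and V: "has_partials T (interior S) V Vs Vz Vzz"
    and Vcont: "continuous_on ({T..} \<times> S) (\<lambda>(s, z). V s z)"
    and Vpos: "\<And>s z. T \<le> s \<Longrightarrow> z \<in> S \<Longrightarrow> 0 \<le> V s z"
    and init: "\<And>z. z \<in> S \<Longrightarrow> u0 (z + \<zeta> T) \<le> V T z"
    and bd: "\<And>s z. T < s \<Longrightarrow> z \<in> S - interior S \<Longrightarrow> 1 \<le> V s z"
    and ineq: "\<And>s z. T < s \<Longrightarrow> z \<in> interior S \<Longrightarrow> Vzz s z + \<zeta>' s * Vz s z + lam\<^sup>2 * V s z \<le> Vs s z"
    and s: "T \<le> s" and z: "z \<in> S"
  shows "u (s - T) (z + \<zeta> s) \<le> V s z"
proof -
  define v where "v = (\<lambda>s z. u (s - T) (z + \<zeta> s))"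
  obtain vs vz vzz where v: "has_partials T UNIV v vs vz vzz"
    and vpde: "\<And>s z. T < s \<Longrightarrow> vs s z = vzz s z + \<zeta>' s * vz s z + f (v s z)"
    and vc: "continuous_on ({T..} \<times> UNIV) (\<lambda>(s, z). v s z)"
    using moving_frame[OF zeta zcont] unfolding v_def by blast
  have vr: "0 \<le> v s z" "v s z \<le> 1" if "T \<le> s" for s z
    using u_range[of "s - T"] that by (auto simp: v_def)
  have p: "has_partials T (interior S) (\<lambda>s z. V s z - v s z) (\<lambda>s z. Vs s z - vs s z)
       (\<lambda>s z. Vz s z - vz s z) (\<lambda>s z. Vzz s z - vzz s z)"
    by (rule has_partials_diff[OF V has_partials_subset[OF v]]) auto
  have c: "continuous_on ({T..s} \<times> S) (\<lambda>(s, z). V s z - v s z)"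
  proof -
    have "{T..s} \<times> S \<subseteq> {T..} \<times> S" "{T..s} \<times> S \<subseteq> {T..} \<times> UNIV" by auto
    from continuous_on_subset[OF Vcont this(1)] continuous_on_subset[OF vc this(2)]
    show ?thesis unfolding case_prod_beta by (intro continuous_intros)
  qed
  have "0 \<le> V s z - v s z"
  proof (rule parabolic_comparison[OF S c _ _ p, where B = 1 and \<beta> = \<zeta>' and \<beta>max = \<beta>max and C = "lam\<^sup>2"])
    show "- 1 \<le> V s' z - v s' z" if "s' \<in> {T..s}" "z \<in> S" for s' z
      using Vpos[of s' z] vr[of s' z] that by auto
    show "0 \<le> V T z - v T z" if "z \<in> S" for z
      using init[OF that] by (simp add: v_def u_init)
    show "z \<in> interior S \<and> Vzz s' z - vzz s' z + \<zeta>' s' * (Vz s' z - vz s' z) + lam\<^sup>2 * (V s' z - v s' z)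
        \<le> Vs s' z - vs s' z"
      if *: "T < s'" "z \<in> S" "V s' z - v s' z < 0" for s' z
    proof -
      have i: "z \<in> interior S" using bd[of s' z] vr[of s' z] * by auto
      have "f (v s' z) \<le> lam\<^sup>2 * v s' z" using vr[of s' z] * by (intro f_le) auto
      then show ?thesis using i ineq[OF *(1) i] vpde[OF *(1), of z] by (simp add: algebra_simps)
    qed
  qed (use s z zbd in auto)
  then show ?thesis by (simp add: v_def)
qed

text \<open>Where \<open>V\<close> exceeds the solution, \<open>0 < V \<le> 1\<close>, so the
  Lipschitz bound on \<open>{0..1}\<close> controls the difference, and the differential inequality
  is needed only at such points; \<open>V\<close> may be negative elsewhere. The starting time
  \<open>s0\<close> is kept apart from \<open>T\<close> so that a comparison can begin at any later
  time.\<close>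

lemma frame_subsolution:
  assumes zeta: "\<And>s. T < s \<Longrightarrow> (\<zeta> has_real_derivative \<zeta>' s) (at s)"
    and zcont: "continuous_on {T..} \<zeta>"
    and zbd: "\<And>s. T < s \<Longrightarrow> \<bar>\<zeta>' s\<bar> \<le> \<beta>max"
    and s0: "T \<le> s0"
    and S: "closed S"
    and V: "has_partials s0 (interior S) V Vs Vz Vzz"
    and Vcont: "continuous_on ({s0..s} \<times> S) (\<lambda>(s, z). V s z)"
    and Vle: "\<And>s' z. s0 \<le> s' \<Longrightarrow> s' \<le> s \<Longrightarrow> z \<in> S \<Longrightarrow> V s' z \<le> 1"
    and init: "\<And>z. z \<in> S \<Longrightarrow> V s0 z \<le> u (s0 - T) (z + \<zeta> s0)"
    and bd: "\<And>s' z. s0 < s' \<Longrightarrow> z \<in> S - interior S \<Longrightarrow> V s' z \<le> 0"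
    and ineq: "\<And>s' z. s0 < s' \<Longrightarrow> s' \<le> s \<Longrightarrow> z \<in> interior S \<Longrightarrow> 0 < V s' z \<Longrightarrow> V s' z \<le> 1 \<Longrightarrow>
        Vs s' z \<le> Vzz s' z + \<zeta>' s' * Vz s' z + f (V s' z)"
    and s: "s0 \<le> s" and z: "z \<in> S"
  shows "V s z \<le> u (s - T) (z + \<zeta> s)"
proof -
  define v where "v = (\<lambda>s z. u (s - T) (z + \<zeta> s))"
  obtain vs vz vzz where v: "has_partials T UNIV v vs vz vzz"
    and vpde: "\<And>s z. T < s \<Longrightarrow> vs s z = vzz s z + \<zeta>' s * vz s z + f (v s z)"
    and vc: "continuous_on ({T..} \<times> UNIV) (\<lambda>(s, z). v s z)"
    using moving_frame[OF zeta zcont] unfolding v_def by blast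
  have vr: "0 \<le> v s z" "v s z \<le> 1" if "T \<le> s" for s z
    using u_range[of "s - T"] that by (auto simp: v_def)
  obtain L where L: "0 \<le> L" "\<And>x y. x \<in> {0..1} \<Longrightarrow> y \<in> {0..1} \<Longrightarrow> \<bar>f x - f y\<bar> \<le> L * \<bar>x - y\<bar>"
    using f_lipschitz by blast
  have "has_partials s0 (interior S) v vs vz vzz"
    using v s0 unfolding has_partials_def by auto
  from has_partials_diff[OF this V]
  have p: "has_partials s0 (interior S) (\<lambda>s z. v s z - V s z) (\<lambda>s z. vs s z - Vs s z)
       (\<lambda>s z. vz s z - Vz s z) (\<lambda>s z. vzz s z - Vzz s z)" .
  have c: "continuous_on ({s0..s} \<times> S) (\<lambda>(s, z). v s z - V s z)"
  proof -
    have "{s0..s} \<times> S \<subseteq> {T..} \<times> UNIV" using s0 by auto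
    from continuous_on_subset[OF vc this]
    show ?thesis using Vcont unfolding case_prod_beta by (intro continuous_intros)
  qed
  have "0 \<le> v s z - V s z"
  proof (rule parabolic_comparison[OF S c _ _ p, where B = 1 and \<beta> = \<zeta>' and \<beta>max = \<beta>max and C = L])
    show "- 1 \<le> v s' z - V s' z" if "s' \<in> {s0..s}" "z \<in> S" for s' z
      using Vle[of s' z] vr[of s' z] that s0 by auto
    show "0 \<le> v s0 z - V s0 z" if "z \<in> S" for z
      using init[OF that] by (simp add: v_def)
    show "z \<in> interior S \<and> vzz s' z - Vzz s' z + \<zeta>' s' * (vz s' z - Vz s' z) + L * (v s' z - V s' z)
        \<le> vs s' z - Vs s' z"
      if *: "s0 < s'" "s' \<le> s" "z \<in> S" "v s' z - V s' z < 0" for s' z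
    proof -
      have vs': "0 \<le> v s' z" "v s' z \<le> 1" "V s' z \<le> 1" using vr[of s' z] Vle[of s' z] * s0 by auto
      then have Vp: "0 < V s' z" using * by auto
      have i: "z \<in> interior S" using bd[of s' z] Vp * by force
      have "\<bar>f (v s' z) - f (V s' z)\<bar> \<le> L * \<bar>v s' z - V s' z\<bar>"
        using vs' Vp by (intro L(2)) auto
      then have "L * (v s' z - V s' z) \<le> f (v s' z) - f (V s' z)"
        using *(4) by (simp add: abs_if algebra_simps split: if_splits)
      moreover have "T < s'" using * s0 by simp
      ultimately show ?thesis using i ineq[OF *(1,2) i Vp vs'(3)] vpde[of s' z] by (simp add: algebra_simps)
    qed
  qed (use s z s0 zbd L in auto)
  then show ?thesis by (simp add: v_def)
qed

end

section \<open>Building blocks of the barriers\<close>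

lemma has_partials_add:
  assumes "has_partials T S d ds dz dzz" "has_partials T S e es ez ezz"
  shows "has_partials T S (\<lambda>s z. d s z + e s z) (\<lambda>s z. ds s z + es s z)
           (\<lambda>s z. dz s z + ez s z) (\<lambda>s z. dzz s z + ezz s z)"
  using assms unfolding has_partials_def by (auto intro!: DERIV_add)

lemma has_partials_timescale:
  assumes "has_partials T S F Fs Fz Fzz"
    and "\<And>s. T < s \<Longrightarrow> (\<omega> has_real_derivative \<omega>' s) (at s)"
  shows "has_partials T S (\<lambda>s z. \<omega> s * F s z) (\<lambda>s z. \<omega>' s * F s z + \<omega> s * Fs s z)
           (\<lambda>s z. \<omega> s * Fz s z) (\<lambda>s z. \<omega> s * Fzz s z)"
  using assms unfolding has_partials_def
  by (auto intro!: derivative_eq_intros simp: algebra_simps)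

lemma has_partials_cmult:
  assumes "has_partials T S F Fs Fz Fzz"
  shows "has_partials T S (\<lambda>s z. c * F s z) (\<lambda>s z. c * Fs s z) (\<lambda>s z. c * Fz s z) (\<lambda>s z. c * Fzz s z)"
  using assms unfolding has_partials_def by (auto intro!: derivative_eq_intros)

lemma has_partials_mono:
  "has_partials T S d ds dz dzz \<Longrightarrow> T \<le> T' \<Longrightarrow> S' \<subseteq> S \<Longrightarrow> has_partials T' S' d ds dz dzz"
  unfolding has_partials_def by force

lemma has_partials_exp_decay:
  assumes H: "has_partials T S H Hs Hz Hzz"
    and b: "\<And>s. T < s \<Longrightarrow> (b has_real_derivative b' s) (at s)" "\<And>s. T < s \<Longrightarrow> b s \<noteq> 0"
  shows "has_partials T S (\<lambda>s z. c * exp (- l * z) * H s z / b s)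
    (\<lambda>s z. c * exp (- l * z) * (Hs s z / b s - H s z * b' s / (b s)\<^sup>2))
    (\<lambda>s z. c * exp (- l * z) * (Hz s z - l * H s z) / b s)
    (\<lambda>s z. c * exp (- l * z) * (Hzz s z - 2 * l * Hz s z + l\<^sup>2 * H s z) / b s)"
  unfolding has_partials_def
proof (intro allI impI ballI conjI)
  fix s z assume s: "T < s" and z: "z \<in> S"
  have h: "((\<lambda>s. H s z) has_real_derivative Hs s z) (at s)"
     "(H s has_real_derivative Hz s z) (at z)" "(Hz s has_real_derivative Hzz s z) (at z)"
    using H s z unfolding has_partials_def by auto
  note [simp] = b(2)[OF s]
  show "((\<lambda>s. c * exp (- l * z) * H s z / b s) has_real_derivative
      c * exp (- l * z) * (Hs s z / b s - H s z * b' s / (b s)\<^sup>2)) (at s)"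
    by (rule derivative_eq_intros h b(1)[OF s] | simp add: field_simps power2_eq_square)+
  have e: "((\<lambda>z. c * exp (- l * z)) has_real_derivative - l * (c * exp (- l * z))) (at z)"
    by (auto intro!: derivative_eq_intros)
  show "((\<lambda>z. c * exp (- l * z) * H s z / b s) has_real_derivative
      c * exp (- l * z) * (Hz s z - l * H s z) / b s) (at z)"
    by (rule DERIV_cong[OF DERIV_cdivide[OF DERIV_mult[OF e h(2)]]]) (simp add: field_simps)
  show "((\<lambda>z. c * exp (- l * z) * (Hz s z - l * H s z) / b s) has_real_derivative
      c * exp (- l * z) * (Hzz s z - 2 * l * Hz s z + l\<^sup>2 * H s z) / b s) (at z)"
    by (rule DERIV_cong[OF DERIV_cdivide[OF DERIV_mult[OF e DERIV_diff[OF h(3) DERIV_cmult[OF h(2)]]]]])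
       (simp add: field_simps power2_eq_square)
qed

text \<open>The speed \<open>2 * l\<close> cancels the first-order term produced by the exponential,
  and the zeroth-order contributions \<open>l\<^sup>2 - 2 * l\<^sup>2 + l\<^sup>2\<close> vanish.
  The correction \<open>B' / (l * B)\<close> of the speed, acting on the exponential, reproduces the
  derivative of \<open>1 / B\<close>. What remains is the heat operator with a small drift.\<close>

lemma exp_decay_operator:
  fixes l :: real
  assumes "l \<noteq> 0" "B \<noteq> 0"
  shows "c * E * (Hzz - 2 * l * Hz + l\<^sup>2 * H) / B + (2 * l + B' / (l * B)) * (c * E * (Hz - l * H) / B)
     + l\<^sup>2 * (c * E * H / B)
   = c * E * (Hs / B - H * B' / B\<^sup>2) - c * E / B * (Hs - Hzz - B' / (l * B) * Hz)"
  using assms by (simp add: field_simps power2_eq_square)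

text \<open>This profile interpolates between \<open>z powr (2 * r + 1)\<close> for \<open>z\<close>
  large against \<open>sqrt s\<close>, which is the initial tail, and a multiple of
  \<open>s powr r * z\<close> for \<open>z\<close> small against \<open>sqrt s\<close>, which is the
  linear growth of a Dirichlet solution.\<close>

lemma has_partials_powr:
  assumes K: "0 < K"
  shows "has_partials 0 UNIV (\<lambda>s z. z * (z\<^sup>2 + K * s) powr r)
    (\<lambda>s z. r * K * z * ((z\<^sup>2 + K * s) powr r / (z\<^sup>2 + K * s)))
    (\<lambda>s z. (z\<^sup>2 + K * s) powr r * (1 + 2 * r * z\<^sup>2 / (z\<^sup>2 + K * s)))
    (\<lambda>s z. (z\<^sup>2 + K * s) powr r * (6 * r * z / (z\<^sup>2 + K * s) + 4 * r * (r - 1) * z ^ 3 / (z\<^sup>2 + K * s)\<^sup>2))"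
  unfolding has_partials_def
proof (intro allI impI ballI conjI)
  fix s z :: real assume s: "0 < s"
  have Q: "0 < z\<^sup>2 + K * s" for z using s K by (simp add: add_nonneg_pos)
  have P: "(z\<^sup>2 + K * s) powr (r - 1) = (z\<^sup>2 + K * s) powr r / (z\<^sup>2 + K * s)" for z
    using Q[of z] by (simp add: powr_diff)
  have 0: "((\<lambda>s. (z\<^sup>2 + K * s) powr r) has_real_derivative
      r * K * ((z\<^sup>2 + K * s) powr r / (z\<^sup>2 + K * s))) (at s)"
  proof -
    have "((\<lambda>s. z\<^sup>2 + K * s) has_real_derivative K) (at s)"
      by (auto intro!: derivative_eq_intros)
    from DERIV_fun_powr[OF this Q, of r] show ?thesis
      by (rule DERIV_cong) (simp add: P)
  qed
  show "((\<lambda>s. z * (z\<^sup>2 + K * s) powr r) has_real_derivative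
      r * K * z * ((z\<^sup>2 + K * s) powr r / (z\<^sup>2 + K * s))) (at s)"
    by (rule derivative_eq_intros 0 | simp add: algebra_simps)+
  have 1: "((\<lambda>z. (z\<^sup>2 + K * s) powr r) has_real_derivative
      2 * r * z * ((z\<^sup>2 + K * s) powr r / (z\<^sup>2 + K * s))) (at z)"
  proof -
    have "((\<lambda>z. z\<^sup>2 + K * s) has_real_derivative 2 * z) (at z)"
      by (auto intro!: derivative_eq_intros)
    from DERIV_fun_powr[OF this Q, of r] show ?thesis
      by (rule DERIV_cong) (simp add: P)
  qed
  have Q0: "z\<^sup>2 + K * s \<noteq> 0" using Q[of z] by simp
  show "((\<lambda>z. z * (z\<^sup>2 + K * s) powr r) has_real_derivative
      (z\<^sup>2 + K * s) powr r * (1 + 2 * r * z\<^sup>2 / (z\<^sup>2 + K * s))) (at z)"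
    by (rule DERIV_cong[OF DERIV_mult[OF DERIV_ident 1]]) (simp add: field_simps power2_eq_square)
  have 3: "((\<lambda>z. 1 + 2 * r * z\<^sup>2 / (z\<^sup>2 + K * s)) has_real_derivative
      4 * r * z / (z\<^sup>2 + K * s) - 4 * r * z ^ 3 / (z\<^sup>2 + K * s)\<^sup>2) (at z)"
  proof -
    have a: "((\<lambda>z. 2 * r * z\<^sup>2) has_real_derivative 4 * r * z) (at z)"
      "((\<lambda>z. z\<^sup>2 + K * s) has_real_derivative 2 * z) (at z)"
      by (auto intro!: derivative_eq_intros)
    have "0 + (4 * r * z * Y - 2 * r * z\<^sup>2 * (2 * z)) / (Y * Y) = 4 * r * z / Y - 4 * r * z ^ 3 / Y\<^sup>2"
      if "Y \<noteq> 0" for Y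
      using that by (simp add: field_simps power2_eq_square power3_eq_cube)
    from this[OF Q0] show ?thesis
      using DERIV_cong[OF DERIV_add[OF DERIV_const DERIV_divide[OF a Q0]]] by blast
  qed
  have 4: "2 * r * z * (X / Y) * (1 + 2 * r * z\<^sup>2 / Y) + (4 * r * z / Y - 4 * r * z ^ 3 / Y\<^sup>2) * X
     = X * (6 * r * z / Y + 4 * r * (r - 1) * z ^ 3 / Y\<^sup>2)" if "Y \<noteq> 0" for X Y
    using that by (simp add: field_simps power2_eq_square power3_eq_cube)
  show "((\<lambda>z. (z\<^sup>2 + K * s) powr r * (1 + 2 * r * z\<^sup>2 / (z\<^sup>2 + K * s))) has_real_derivative
      (z\<^sup>2 + K * s) powr r * (6 * r * z / (z\<^sup>2 + K * s) + 4 * r * (r - 1) * z ^ 3 / (z\<^sup>2 + K * s)\<^sup>2)) (at z)"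
    using DERIV_cong[OF DERIV_mult[OF 1 3] 4[OF Q0]] .
qed

text \<open>Multiplied by \<open>s powr (- 3 / 2)\<close> this is the dipole solution of the heat
  equation. Without that factor, time derivative minus second space derivative is
  \<open>3 * z / (2 * s) * exp (- z\<^sup>2 / (4 * s))\<close>, the origin of the term
  \<open>3 / 2 * b s / s\<close> in \<open>b_source\<close>.\<close>

lemma has_partials_gauss:
  "has_partials 0 UNIV (\<lambda>s z. z * exp (- z\<^sup>2 / (4 * s)))
    (\<lambda>s z. z ^ 3 / (4 * s\<^sup>2) * exp (- z\<^sup>2 / (4 * s)))
    (\<lambda>s z. (1 - z\<^sup>2 / (2 * s)) * exp (- z\<^sup>2 / (4 * s)))
    (\<lambda>s z. (z ^ 3 / (4 * s\<^sup>2) - 3 * z / (2 * s)) * exp (- z\<^sup>2 / (4 * s)))"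
  unfolding has_partials_def
proof (intro allI impI ballI conjI)
  fix s z :: real assume s: "0 < s"
  have 0: "((\<lambda>s. - z\<^sup>2 / (4 * s)) has_real_derivative z\<^sup>2 / (4 * s\<^sup>2)) (at s)"
    by (rule derivative_eq_intros refl | use s in \<open>simp add: field_simps power2_eq_square\<close>)+
  show "((\<lambda>s. z * exp (- z\<^sup>2 / (4 * s))) has_real_derivative
      z ^ 3 / (4 * s\<^sup>2) * exp (- z\<^sup>2 / (4 * s))) (at s)"
    using DERIV_cmult[OF DERIV_fun_exp[OF 0], of z]
    by (simp add: power2_eq_square power3_eq_cube mult_ac)
  have "((\<lambda>z. - z\<^sup>2 / (4 * s)) has_real_derivative - z / (2 * s)) (at z)"
    by (rule derivative_eq_intros refl | use s in \<open>simp add: field_simps power2_eq_square\<close>)+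
  note 1 = DERIV_fun_exp[OF this]
  show "((\<lambda>z. z * exp (- z\<^sup>2 / (4 * s))) has_real_derivative
      (1 - z\<^sup>2 / (2 * s)) * exp (- z\<^sup>2 / (4 * s))) (at z)"
    by (rule DERIV_cong[OF DERIV_mult[OF DERIV_ident 1]]) (use s in \<open>simp add: field_simps power2_eq_square\<close>)
  have 2: "((\<lambda>z. 1 - z\<^sup>2 / (2 * s)) has_real_derivative - z / s) (at z)"
    by (rule derivative_eq_intros refl | use s in \<open>simp add: field_simps power2_eq_square\<close>)+
  show "((\<lambda>z. (1 - z\<^sup>2 / (2 * s)) * exp (- z\<^sup>2 / (4 * s))) has_real_derivative
      (z ^ 3 / (4 * s\<^sup>2) - 3 * z / (2 * s)) * exp (- z\<^sup>2 / (4 * s))) (at z)"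
    by (rule DERIV_cong[OF DERIV_mult[OF 2 1]])
       (use s in \<open>simp add: field_simps power2_eq_square power3_eq_cube\<close>)
qed

section \<open>Elementary bounds relating powers, exponentials and Gaussians\<close>

lemma powr_bounds:
  fixes p :: real
  assumes "0 < a"
  obtains c C where "0 < c" "0 < C" "\<And>x. a \<le> x \<Longrightarrow> x \<le> b \<Longrightarrow> c \<le> x powr p \<and> x powr p \<le> C"
proof (cases "a \<le> b")
  case True
  show ?thesis
  proof (rule that)
    show "0 < min (a powr p) (b powr p)" "0 < max (a powr p) (b powr p)"
      using assms True by (auto simp: less_max_iff_disj)
    fix x assume x: "a \<le> x" "x \<le> b"
    show "min (a powr p) (b powr p) \<le> x powr p \<and> x powr p \<le> max (a powr p) (b powr p)"
    proof (cases "0 \<le> p")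
      case True
      then have "a powr p \<le> x powr p" "x powr p \<le> b powr p"
        using x assms by (auto intro!: powr_mono2)
      then show ?thesis by auto
    next
      case False
      then have "x powr p \<le> a powr p" "b powr p \<le> x powr p"
        using x assms by (auto intro!: powr_mono2')
      then show ?thesis by auto
    qed
  qed
next
  case False
  then show ?thesis using that[of 1 1] by auto
qed

lemma powr_le_exp:
  fixes p \<epsilon> a :: real
  assumes "0 < \<epsilon>" "0 < a"
  obtains C where "0 < C" "\<And>x. 0 \<le> x \<Longrightarrow> (a + x) powr p \<le> C * exp (\<epsilon> * x)"
proof (cases "0 < p")
  case True
  define \<delta> where "\<delta> = \<epsilon> / p"
  have \<delta>: "0 < \<delta>" using True assms by (simp add: \<delta>_def)
  show ?thesis
  proof (rule that)
    fix x :: real assume x: "0 \<le> x"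
    have "ln (\<delta> * (a + x)) \<le> \<delta> * (a + x) - 1"
      using \<delta> x assms by (intro ln_le_minus_one) auto
    then have "ln (a + x) \<le> \<delta> * (a + x) - ln \<delta>"
      using \<delta> x assms by (simp add: ln_mult)
    then have "p * ln (a + x) \<le> p * (\<delta> * (a + x) - ln \<delta>)" using True by (intro mult_left_mono) auto
    also have "\<dots> = p * (\<delta> * a - ln \<delta>) + \<epsilon> * x" using True by (simp add: \<delta>_def field_simps)
    finally have "exp (p * ln (a + x)) \<le> exp (p * (\<delta> * a - ln \<delta>) + \<epsilon> * x)" by simp
    then show "(a + x) powr p \<le> exp (p * (\<delta> * a - ln \<delta>)) * exp (\<epsilon> * x)"
      using x assms by (simp add: powr_def exp_add)
  qed simp
next
  case False
  show ?thesis
  proof (rule that)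
    fix x :: real assume x: "0 \<le> x"
    have "(a + x) powr p \<le> a powr p" using False x assms by (intro powr_mono2') auto
    also have "\<dots> \<le> a powr p * exp (\<epsilon> * x)" using assms x by (simp add: mult_le_cancel_left1)
    finally show "(a + x) powr p \<le> a powr p * exp (\<epsilon> * x)" .
  qed (use assms in simp)
qed

text \<open>With \<open>y = z\<^sup>2 / s\<close> the left-hand side dominates the space derivative
  of the Gaussian profile, so the drift acting on that profile can be measured against the power
  profile. The exponential is split in two halves, one for the linear factor and one for the
  possibly decaying power.\<close>

lemma gauss_le_powr:
  fixes r K :: real
  assumes K: "0 < K"
  obtains c where "0 < c" "\<And>y. 0 \<le> y \<Longrightarrow> (1 + y / 2) * exp (- y / 4) \<le> c * (K + y) powr r"
proof -
  obtain C1 where C1: "0 < C1" "\<And>x. 0 \<le> x \<Longrightarrow> (1 + x) powr 1 \<le> C1 * exp ((1 / 8 :: real) * x)"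
    by (rule powr_le_exp[of "1/8" 1 1]) auto
  obtain C2 where C2: "0 < C2" "\<And>x. 0 \<le> x \<Longrightarrow> (K + x) powr (- r) \<le> C2 * exp ((1 / 8 :: real) * x)"
    using powr_le_exp[of "1/8" K "- r"] K by auto
  show ?thesis
  proof (rule that)
    show "0 < C1 * C2" using C1 C2 by simp
    fix y :: real assume y: "0 \<le> y"
    have k: "0 < (K + y) powr r" using K y by simp
    have "1 + y / 2 \<le> C1 * exp (1 / 8 * y)" using C1(2)[OF y] y by simp
    moreover have "1 \<le> C2 * exp (1 / 8 * y) * (K + y) powr r"
    proof -
      have "(K + y) powr (- r) * (K + y) powr r \<le> C2 * exp (1 / 8 * y) * (K + y) powr r"
        using C2(2)[OF y] k by (intro mult_right_mono) auto
      then show ?thesis using K y by (simp add: powr_add[symmetric])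
    qed
    ultimately have "(1 + y / 2) * 1 \<le> (C1 * exp (1 / 8 * y)) * (C2 * exp (1 / 8 * y) * (K + y) powr r)"
      using C1 y by (intro mult_mono) auto
    also have "\<dots> = (C1 * C2 * (K + y) powr r) * exp (1 / 8 * y + 1 / 8 * y)"
      unfolding exp_add by (simp add: mult_ac)
    also have "1 / 8 * y + 1 / 8 * y = y / 4" by simp
    finally have "(1 + y / 2) * exp (- y / 4) \<le> (C1 * C2 * (K + y) powr r) * exp (y / 4) * exp (- y / 4)"
      by (intro mult_right_mono) auto
    then show "(1 + y / 2) * exp (- y / 4) \<le> C1 * C2 * (K + y) powr r"
      by (simp add: mult.assoc exp_add[symmetric])
  qed
qed

lemma powr_quadratic_le_exp:
  fixes K \<epsilon> p :: real
  assumes K: "1 \<le> K" and e: "0 < \<epsilon>"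
  obtains C where "0 < C" "\<And>s z. 1 \<le> s \<Longrightarrow> 0 \<le> z \<Longrightarrow> (K + z\<^sup>2 / s) powr p \<le> C * exp (\<epsilon> * z)"
proof -
  obtain C where C: "0 < C" "\<And>x. 0 \<le> x \<Longrightarrow> (K + x) powr (2 * \<bar>p\<bar>) \<le> C * exp (\<epsilon> * x)"
    using powr_le_exp[of \<epsilon> K "2 * \<bar>p\<bar>"] assms by auto
  show ?thesis
  proof (rule that[OF C(1)])
    fix s z :: real assume s: "1 \<le> s" and z: "0 \<le> z"
    have "z\<^sup>2 / s \<le> z\<^sup>2" using s by (simp add: divide_le_eq mult_le_cancel_left1)
    moreover have "K + z\<^sup>2 \<le> (K + z)\<^sup>2" 
    proof -
      have "K * 1 \<le> K * K" "0 \<le> K * z" using K z by (auto intro: mult_left_mono)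
      then show ?thesis by (simp add: power2_eq_square algebra_simps)
    qed
    ultimately have le: "K + z\<^sup>2 / s \<le> (K + z) powr 2" using K z by (simp add: powr_numeral)
    have ge: "1 \<le> K + z\<^sup>2 / s" using K s by (simp add: add_increasing2)
    have "(K + z\<^sup>2 / s) powr p \<le> (K + z\<^sup>2 / s) powr \<bar>p\<bar>" using ge by (intro powr_mono) auto
    also have "\<dots> \<le> ((K + z) powr 2) powr \<bar>p\<bar>" using le ge by (intro powr_mono2) auto
    also have "\<dots> = (K + z) powr (2 * \<bar>p\<bar>)" by (simp add: powr_powr)
    finally show "(K + z\<^sup>2 / s) powr p \<le> C * exp (\<epsilon> * z)" using C(2)[OF z] by linarith
  qed
qed

lemma powr_quadratic_scale:
  fixes K s z p :: real
  assumes "0 < s" "0 < K"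
  shows "(z\<^sup>2 + K * s) powr p = s powr p * (K + z\<^sup>2 / s) powr p"
proof -
  have "z\<^sup>2 + K * s = s * (K + z\<^sup>2 / s)" using assms by (simp add: field_simps)
  then show ?thesis using assms by (simp add: powr_mult)
qed

text \<open>The left-hand side is the drift, of relative size \<open>1 / s\<close> up to a loss
  \<open>s powr (1 / 8)\<close> that accommodates the logarithm in \<open>b\<close>; the right-hand
  side is the slack from the time factor. For \<open>z\<close> beyond \<open>sqrt s\<close> the
  slack is at least \<open>1 / 4 * s powr (- (3 / 4)) * X\<close>, and replacing \<open>M\<close> by
  \<open>s powr (1 / 8)\<close> turns the drift into exactly this.\<close>

lemma powr_far_absorb:
  fixes M X s z :: real
  assumes s: "1 \<le> s" "M powr 8 \<le> s" "s \<le> z\<^sup>2" and M: "0 \<le> M" and z: "0 < z" and X: "0 < X"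
  shows "X / s * s powr (1 / 8) * (M / 4) \<le> 1 / 4 * s powr (- (5 / 4)) * (z * X)"
proof -
  define W where "W = s powr (- (5 / 4))"
  have sp: "0 < s" "0 < W" using s by (auto simp: W_def)
  have "M = (M powr 8) powr (1 / 8)" using M by (simp only: powr_powr) simp
  also have "\<dots> \<le> s powr (1 / 8)" using s(2) by (intro powr_mono2) auto
  finally have "X / s * s powr (1 / 8) * (M / 4) \<le> X / s * s powr (1 / 8) * (s powr (1 / 8) / 4)"
    using X sp by (intro mult_left_mono) auto
  also have "\<dots> = 1 / 4 * W * (s powr (1 / 2) * X)"
  proof -
    have "s powr (1 / 8) * s powr (1 / 8) = s powr (1 / 4 - 1) * s"
    proof -
      have "s powr (1 / 4 - 1) * s powr 1 = s powr (1 / 4)" by (simp only: powr_add[symmetric]) simp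
      then show ?thesis using sp by (simp add: powr_add[symmetric])
    qed
    moreover have "W * s powr (1 / 2) = s powr (1 / 4 - 1)"
      by (simp add: W_def powr_add[symmetric])
    ultimately have "s powr (1 / 8) * s powr (1 / 8) = W * s powr (1 / 2) * s" by simp
    moreover have "X / s * a * (a / 4) = 1 / 4 * W * (h * X)" if "a * a = W * h * s" for a h
    proof -
      have "X / s * a * (a / 4) = X / s * (a * a) / 4" by simp
      then show ?thesis using that sp by simp
    qed
    ultimately show ?thesis by blast
  qed
  also have "\<dots> \<le> 1 / 4 * W * (z * X)"
  proof -
    have "s powr (1 / 2) \<le> z" using s(3) z sp by (simp add: powr_half_sqrt real_le_lsqrt)
    then show ?thesis using sp X by (intro mult_left_mono mult_right_mono) auto
  qed
  finally show ?thesis unfolding W_def .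
qed

section \<open>The supersolution\<close>

text \<open>\<open>r\<close> is the exponent \<open>k / 2\<close>, \<open>l\<close> the decay rate of the tail, and \<open>ln (b s) / l\<close> the logarithmic
  correction of the front. By \<open>b_source\<close> the Dirichlet mode \<open>b s * z * exp (- z\<^sup>2 / (4 s))\<close> is a strict
  supersolution of the heat equation; this is what forces \<open>k > -3\<close> or the extra logarithm.\<close>

locale rate =
  fixes r \<kappa> s0 cB cb cd l :: real and b b' :: "real \<Rightarrow> real"
  assumes l_pos: "0 < l" and kappa: "0 < \<kappa>" and s0: "1 \<le> s0"
    and cB: "0 < cB" and cb: "0 < cb" and cd: "0 < cd"
    and b_deriv: "\<And>s. s0 \<le> s \<Longrightarrow> (b has_real_derivative b' s) (at s)"
    and b_ge: "\<And>s. s0 \<le> s \<Longrightarrow> s powr r \<le> b s"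
    and b_le: "\<And>s. s0 \<le> s \<Longrightarrow> b s \<le> cB * s powr (r + 1 / 8)"
    and b'_abs: "\<And>s. s0 \<le> s \<Longrightarrow> \<bar>b' s\<bar> \<le> cb * b s / s"
    and b'_le: "\<And>s. s0 \<le> s \<Longrightarrow> b' s \<le> cd * s powr (r - 1)"
    and b_source: "\<And>s. s0 \<le> s \<Longrightarrow> \<kappa> * s powr (r - 1) \<le> b' s + 3 / 2 * b s / s"
begin

lemma b_pos: "s0 \<le> s \<Longrightarrow> 0 < b s"
  using b_ge[of s] s0 by (smt (verit) powr_gt_zero)

lemma b_continuous: "s0 \<le> T \<Longrightarrow> continuous_on {T..} b"
  by (intro continuous_at_imp_continuous_on) (auto intro!: DERIV_isCont[OF b_deriv])

lemma b_gauss_bound: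
  assumes c: "0 \<le> c" "\<And>y. 0 \<le> y \<Longrightarrow> (1 + y / 2) * exp (- y / 4) \<le> c * (K + y) powr r"
    and s: "s0 \<le> s" and K: "0 < K"
  shows "b s * ((1 + z\<^sup>2 / (2 * s)) * exp (- z\<^sup>2 / (4 * s))) \<le> s powr (1 / 8) * (cB * c * (z\<^sup>2 + K * s) powr r)"
proof -
  have sp: "0 < s" "1 \<le> s" using s s0 by auto
  have "b s * ((1 + z\<^sup>2 / (2 * s)) * exp (- z\<^sup>2 / (4 * s)))
      \<le> (cB * s powr (r + 1 / 8)) * (c * (K + z\<^sup>2 / s) powr r)"
    by (rule mult_mono)
       (use b_le[OF s] c(2)[of "z\<^sup>2 / s"] sp b_pos[OF s] cB in \<open>auto simp: mult.commute\<close>)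
  also have "\<dots> = s powr (1 / 8) * (cB * c * (z\<^sup>2 + K * s) powr r)"
    by (simp add: powr_quadratic_scale[OF sp(1) K] powr_add mult_ac)
  finally show ?thesis .
qed

lemma b_gauss_partials:
  assumes "s0 \<le> T"
  shows "has_partials T UNIV (\<lambda>s z. b s * (z * exp (- z\<^sup>2 / (4 * s))))
      (\<lambda>s z. b' s * (z * exp (- z\<^sup>2 / (4 * s))) + b s * (z ^ 3 / (4 * s\<^sup>2) * exp (- z\<^sup>2 / (4 * s))))
      (\<lambda>s z. b s * ((1 - z\<^sup>2 / (2 * s)) * exp (- z\<^sup>2 / (4 * s))))
      (\<lambda>s z. b s * ((z ^ 3 / (4 * s\<^sup>2) - 3 * z / (2 * s)) * exp (- z\<^sup>2 / (4 * s))))"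
  by (rule has_partials_timescale[OF has_partials_mono[OF has_partials_gauss] b_deriv])
     (use assms s0 in auto)

lemma b_fst_continuous:
  assumes "s0 \<le> T" "A \<subseteq> {T..} \<times> UNIV"
  shows "continuous_on A (\<lambda>p::real \<times> real. b (fst p))"
  by (rule continuous_on_compose2[OF b_continuous[OF assms(1)]])
     (use assms(2) in \<open>auto intro!: continuous_intros\<close>)

lemma exp_profile_continuous:
  assumes T: "s0 \<le> T" and A: "A \<subseteq> {T..} \<times> UNIV"
    and H: "continuous_on ({T..} \<times> UNIV) (\<lambda>(s, z). H s z)"
  shows "continuous_on A (\<lambda>(s, z). c * exp (- l * z) * H s z / b s)"
proof -
  have "b (fst p) \<noteq> 0" if "p \<in> A" for p using b_pos[of "fst p"] T A that by force
  then show ?thesis using b_fst_continuous[OF T A] continuous_on_subset[OF H A]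
    unfolding case_prod_beta by (auto intro!: continuous_intros)
qed

text \<open>The profile \<open>z * Q powr r\<close> has the defect
  \<open>4 * r * (r - 1) * z ^ 3 * X / Q\<^sup>2\<close>, at most
  \<open>4 * \<bar>r\<bar> * \<bar>1 - r\<bar>\<close> times \<open>z * X / Q\<close> because
  \<open>z\<^sup>2 \<le> Q\<close>. The extra 1 leaves one such unit to spare.\<close>

definition \<beta>h :: real where "\<beta>h = 4 * \<bar>r\<bar> * \<bar>1 - r\<bar> + 1"

lemma \<beta>h_ge: "1 \<le> \<beta>h" by (simp add: \<beta>h_def)

text \<open>The right-hand side is \<open>F_s - F_zz\<close> for the profile
  \<open>F = A b z E + z Q powr r + \<beta>h s z Q powr (r - 1)\<close>. The \<open>\<beta>h\<close>-term repairs the sign at large \<open>z\<close>,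
  the Gaussian one at \<open>z\<close> of order \<open>sqrt s\<close>.\<close>

definition upper_source_ok :: "real \<Rightarrow> bool" where
  "upper_source_ok A \<longleftrightarrow> (\<forall>s z Q X E. s0 \<le> s \<longrightarrow> 0 < z \<longrightarrow> Q = z\<^sup>2 + 6 * s \<longrightarrow> X = Q powr r \<longrightarrow>
       E = exp (- z\<^sup>2 / (4 * s)) \<longrightarrow>
       A * \<kappa> / 2 * s powr (r - 1) * z * E \<le>
       A * z * E * (b' s + 3 / 2 * b s / s) - 4 * r * (r - 1) * z ^ 3 * X / Q\<^sup>2
        + \<beta>h * (z * X / Q - 4 * (r - 1) * (r - 2) * s * z ^ 3 * X / Q ^ 3))"

text \<open>In units of \<open>y = z * X / Q\<close> the power profiles contribute at least
  \<open>1 - \<beta>c * s / Q\<close>. If \<open>Q\<close> is large against \<open>s\<close>, this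
  is nonnegative. Otherwise \<open>z\<^sup>2 / s\<close> is bounded, the Gaussian \<open>E\<close>
  is bounded below, and half of its source wins for large \<open>A\<close>. The other half is kept
  for the drift.\<close>

lemma upper_source:
  obtains A0 where "0 < A0" "\<And>A. A0 \<le> A \<Longrightarrow> upper_source_ok A"
proof -
  define \<beta>c where "\<beta>c = \<beta>h * (4 * \<bar>r - 1\<bar> * \<bar>r - 2\<bar>)"
  have bc: "0 \<le> \<beta>c" using \<beta>h_ge by (simp add: \<beta>c_def)
  define c1 where "c1 = \<beta>c + 3"
  have c1: "3 \<le> c1" using bc by (simp add: c1_def)
  obtain C2 where C2: "0 < C2" "\<And>x. 6 \<le> x \<Longrightarrow> x \<le> 2 * c1 \<Longrightarrow> x powr (r - 1) \<le> C2"
    using powr_bounds[of 6 "2 * c1" "r - 1"] by (metis zero_less_numeral)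
  define A0 where "A0 = 2 * c1 * C2 * exp (c1 / 2) / \<kappa>"
  show ?thesis
  proof (rule that[of A0])
    show "0 < A0" using C2 c1 kappa by (simp add: A0_def)
    fix A assume A: "A0 \<le> A"
    show "upper_source_ok A"
      unfolding upper_source_ok_def
    proof (intro allI impI)
      fix s z Q X E :: real
      assume s: "s0 \<le> s" and z: "0 < z" and Q: "Q = z\<^sup>2 + 6 * s"
        and X: "X = Q powr r" and E: "E = exp (- z\<^sup>2 / (4 * s))"
      have sp: "0 < s" "1 \<le> s" using s s0 by auto
      have Qp: "0 < Q" using sp by (simp add: Q add_nonneg_pos)
      have Ap: "0 < A" using A \<open>0 < A0\<close> by simp
      have Ep: "0 < E" by (simp add: E)
      have Xp: "0 < X" using Qp by (simp add: X)
      define y where "y = z * X / Q"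
      define q where "q = z\<^sup>2 / Q"
      define t where "t = s / Q"
      have y: "0 < y" using z Xp Qp by (simp add: y_def)
      have q: "0 \<le> q" "q \<le> 1" using Qp sp by (auto simp: q_def Q)
      have t: "0 < t" "t \<le> 1" "1 / t = Q / s" using Qp sp by (auto simp: t_def Q intro: add_increasing)
      have e1: "4 * r * (r - 1) * z ^ 3 * X / Q\<^sup>2 = 4 * r * (r - 1) * q * y"
        using Qp by (simp add: q_def y_def field_simps power2_eq_square power3_eq_cube)
      have e2: "4 * (r - 1) * (r - 2) * s * z ^ 3 * X / Q ^ 3 = 4 * (r - 1) * (r - 2) * q * t * y"
        using Qp by (simp add: q_def t_def y_def field_simps power2_eq_square power3_eq_cube)
      have aq: "a * q \<le> \<bar>a\<bar>" for a
      proof -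
        have "a * q \<le> \<bar>a\<bar> * q" using q by (intro mult_right_mono) auto
        also have "\<dots> \<le> \<bar>a\<bar> * 1" using q by (intro mult_left_mono) auto
        finally show ?thesis by simp
      qed
      have b1: "4 * r * (r - 1) * q * y \<le> (\<beta>h - 1) * y"
      proof -
        have "4 * r * (r - 1) * q \<le> \<bar>4 * r * (r - 1)\<bar>" by (rule aq)
        also have "\<dots> = \<beta>h - 1"
          unfolding \<beta>h_def by (simp add: abs_mult abs_minus_commute[of 1 r])
        finally show ?thesis using y by (intro mult_right_mono) auto
      qed
      have b2: "\<beta>h * (4 * (r - 1) * (r - 2) * q * t * y) \<le> \<beta>c * t * y"
      proof -
        have "4 * (r - 1) * (r - 2) * q \<le> \<bar>4 * (r - 1) * (r - 2)\<bar>" by (rule aq)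
        also have "\<dots> = 4 * \<bar>r - 1\<bar> * \<bar>r - 2\<bar>" by (simp only: abs_mult abs_numeral)
        finally have "\<beta>h * (4 * (r - 1) * (r - 2) * q) \<le> \<beta>c"
          using \<beta>h_ge unfolding \<beta>c_def by (intro mult_left_mono) auto
        then have "\<beta>h * (4 * (r - 1) * (r - 2) * q) * (t * y) \<le> \<beta>c * (t * y)"
          using t y by (intro mult_right_mono) auto
        then show ?thesis by (simp add: mult.assoc)
      qed
      have g: "A * z * E * (\<kappa> * s powr (r - 1)) \<le> A * z * E * (b' s + 3 / 2 * b s / s)"
        using b_source[OF s] Ap z Ep by (intro mult_left_mono) auto
      have main: "c1 * t * y \<le> y + A * z * E * (\<kappa> * s powr (r - 1)) / 2"
      proof (cases "c1 * t \<le> 1")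
        case True
        then have "c1 * t * y \<le> 1 * y" using y by (intro mult_right_mono) auto
        moreover have "0 \<le> A * z * E * (\<kappa> * s powr (r - 1))" using Ap z Ep kappa by simp
        ultimately show ?thesis by linarith
      next
        case False
        then have Qs: "Q / s \<le> 2 * c1" using t c1 by (auto simp: field_simps)
        have Qs6: "6 \<le> Q / s" using sp by (simp add: Q field_simps)
        have "y = z * Q powr (r - 1)" using Qp by (simp add: y_def X powr_diff)
        also have "Q powr (r - 1) = s powr (r - 1) * (Q / s) powr (r - 1)"
          using sp Qp by (subst powr_mult[symmetric]) auto
        finally have "y \<le> z * (s powr (r - 1) * C2)"
          using C2(2)[OF Qs6 Qs] z by (simp add: mult_left_mono)
        then have "c1 * y \<le> c1 * (z * (s powr (r - 1) * C2))" using c1 by (intro mult_left_mono) auto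
        also have "\<dots> = (A0 * \<kappa> / 2) * exp (- (c1 / 2)) * (z * s powr (r - 1))"
          using kappa by (simp add: A0_def exp_minus field_simps)
        also have "\<dots> \<le> (A * \<kappa> / 2) * E * (z * s powr (r - 1))"
        proof -
          have "z\<^sup>2 \<le> Q" using sp by (simp add: Q)
          then have "z\<^sup>2 \<le> 2 * c1 * s" using Qs sp by (simp add: field_simps)
          then have "z\<^sup>2 / (4 * s) \<le> c1 / 2" using sp by (simp add: field_simps)
          then have "exp (- (c1 / 2)) \<le> E" by (simp add: E)
          then show ?thesis using A kappa z Ap by (intro mult_right_mono mult_mono) auto
        qed
        finally have "c1 * y \<le> A * z * E * (\<kappa> * s powr (r - 1)) / 2" by (simp add: mult_ac)
        moreover have "c1 * t * y \<le> c1 * y" using c1 t y by simp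
        ultimately show ?thesis using y by linarith
      qed
      have "\<beta>c * t * y \<le> c1 * t * y" using t y by (simp add: c1_def)
      then show "A * \<kappa> / 2 * s powr (r - 1) * z * E \<le>
         A * z * E * (b' s + 3 / 2 * b s / s) - 4 * r * (r - 1) * z ^ 3 * X / Q\<^sup>2
          + \<beta>h * (z * X / Q - 4 * (r - 1) * (r - 2) * s * z ^ 3 * X / Q ^ 3)"
        using main g b1 b2 unfolding e1 e2 y_def[symmetric] by (simp add: algebra_simps)
    qed
  qed
qed

text \<open>With \<open>G = F_s - F_zz\<close> the right-hand side is the full operator applied to
  \<open>(2 - s powr (- 1 / 4)) * F\<close>.\<close>

definition upper_drift_ok :: "real \<Rightarrow> real \<Rightarrow> real \<Rightarrow> bool" where
  "upper_drift_ok A z1 T \<longleftrightarrow> (\<forall>s\<ge>T. \<forall>z\<ge>z1. \<forall>G Q X E.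
         Q = z\<^sup>2 + 6 * s \<longrightarrow> X = Q powr r \<longrightarrow> E = exp (- z\<^sup>2 / (4 * s)) \<longrightarrow>
         A * \<kappa> / 2 * s powr (r - 1) * z * E \<le> G \<longrightarrow>
         0 \<le> 1 / 4 * s powr (- (5 / 4)) * (A * (b s * (z * E)) + (z * X + \<beta>h * (s * (z * (X / Q)))))
           + (2 - s powr (- (1 / 4))) * G
           - b' s / (l * b s) * ((2 - s powr (- (1 / 4))) * (A * (b s * ((1 - z\<^sup>2 / (2 * s)) * E)) +
                (X * (1 + 2 * r * z\<^sup>2 / Q) + \<beta>h * (s * (X / Q * (1 + 2 * (r - 1) * z\<^sup>2 / Q)))))))"

text \<open>For \<open>s \<le> z\<^sup>2\<close> every drift term is at most a constant times
  \<open>X / s * s powr (1 / 8)\<close> and is absorbed by the growing time factor. For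
  \<open>z\<^sup>2 < s\<close> the Gaussian source dominates: through \<open>z \<ge> z1\<close> it
  beats the drift on the Gaussian, through \<open>A \<ge> A1\<close> the drift on the power
  profiles. The order of choices matters: \<open>z1\<close> and \<open>A1\<close> do not depend on
  \<open>A\<close>, whereas \<open>T\<close> does through \<open>M\<close>.\<close>

lemma upper_drift:
  "\<exists>A1 z1. 0 < A1 \<and> 1 \<le> z1 \<and> (\<forall>A\<ge>A1. \<exists>T\<ge>s0. upper_drift_ok A z1 T)"
proof -
  define c2 where "c2 = 1 + 2 * \<bar>r\<bar> + \<beta>h * (1 + 2 * \<bar>r - 1\<bar>)"
  have c2: "0 < c2" using \<beta>h_ge by (simp add: c2_def add_pos_nonneg)
  define c3 where "c3 = cb / l"
  have c3: "0 < c3" using cb l_pos by (simp add: c3_def)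
  obtain c4 where c4: "0 < c4" "\<And>y. 0 \<le> y \<Longrightarrow> (1 + y / 2) * exp (- y / 4) \<le> c4 * (6 + y) powr r"
    using gauss_le_powr[of 6 r] by auto
  obtain C3 where C3: "0 < C3" "\<And>x. 6 \<le> x \<Longrightarrow> x \<le> 7 \<Longrightarrow> x powr r \<le> C3"
    using powr_bounds[of 6 7 r] by (metis zero_less_numeral)
  \<comment> \<open>This makes \<open>\<kappa> / 2 * z\<close> at least \<open>cd / l + 1\<close>:
    \<open>cd / l\<close> pays for the drift on the Gaussian, 1 for the drift on the power profiles.
    The factor 2 in \<open>A1\<close> compensates \<open>1 / 2 \<le> E\<close>.\<close>
  define z1 where "z1 = max 1 (2 * (cd / l + 1) / \<kappa>)"
  define A1 where "A1 = 2 * (c3 * c2 * C3)"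
  show ?thesis
  proof (rule exI[of _ A1], rule exI[of _ z1], intro conjI allI impI)
    show A1: "0 < A1" using c2 c3 C3 by (simp add: A1_def)
    show "1 \<le> z1" by (simp add: z1_def)
    fix A assume A: "A1 \<le> A"
    have Ap: "0 < A" using A A1 by simp
    define M where "M = 8 * c3 * (A * cB * c4 + c2)"
    have M: "0 < M" using c3 c2 Ap cB c4 by (simp add: M_def add_pos_pos)
    define T where "T = max s0 (M powr 8)"
    show "\<exists>T\<ge>s0. upper_drift_ok A z1 T"
      unfolding upper_drift_ok_def
    proof (intro exI[of _ T] conjI allI impI)
      show "s0 \<le> T" by (simp add: T_def)
      fix s z G Q X E
      assume sT: "T \<le> s" and z: "z1 \<le> z" and Q: "Q = z\<^sup>2 + 6 * s" and X: "X = Q powr r"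
        and E: "E = exp (- z\<^sup>2 / (4 * s))" and G: "A * \<kappa> / 2 * s powr (r - 1) * z * E \<le> G"
      have s: "s0 \<le> s" "M powr 8 \<le> s" using sT by (auto simp: T_def)
      have sp: "0 < s" "1 \<le> s" using s s0 by auto
      have zp: "0 < z" "1 \<le> z" using z by (auto simp: z1_def)
      have Qp: "0 < Q" using sp by (simp add: Q add_nonneg_pos)
      have Ep: "0 < E" by (simp add: E)
      have Xp: "0 < X" using Qp by (simp add: X)
      have bp: "0 < b s" using b_pos[OF s(1)] .
      define \<omega> where "\<omega> = 2 - s powr (- (1 / 4))"
      have om: "1 \<le> \<omega>" "\<omega> \<le> 2" using sp
        by (auto simp: \<omega>_def powr_minus inverse_le_1_iff ge_one_powr_ge_zero)
      define R where "R = X * (1 + 2 * r * z\<^sup>2 / Q) + \<beta>h * (s * (X / Q * (1 + 2 * (r - 1) * z\<^sup>2 / Q)))"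
      define \<theta> where "\<theta> = b' s / (l * b s)"
      have th: "\<bar>\<theta>\<bar> \<le> c3 / s"
      proof -
        have "\<bar>\<theta>\<bar> = \<bar>b' s\<bar> / (l * b s)" using l_pos bp by (simp add: \<theta>_def abs_mult)
        also have "\<dots> \<le> (cb * b s / s) / (l * b s)"
          using b'_abs[OF s(1)] l_pos bp by (intro divide_right_mono) auto
        also have "\<dots> = c3 / s" using bp by (simp add: c3_def)
        finally show ?thesis .
      qed
      define q where "q = z\<^sup>2 / Q"
      have q: "0 \<le> q" "q \<le> 1" using Qp sp by (auto simp: q_def Q)
      have lin: "\<bar>1 + 2 * p * q\<bar> \<le> 1 + 2 * \<bar>p\<bar>" for p
      proof -
        have "\<bar>p\<bar> * q \<le> \<bar>p\<bar>" using q by (simp add: mult_left_le)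
        then show ?thesis using abs_triangle_ineq[of 1 "2 * p * q"] q by (simp add: abs_mult)
      qed
      have R: "\<bar>R\<bar> \<le> c2 * X"
      proof -
        have "R = X * ((1 + 2 * r * q) + \<beta>h * (s / Q) * (1 + 2 * (r - 1) * q))"
        proof -
          have "2 * p * z\<^sup>2 / Q = 2 * p * q" for p by (simp add: q_def)
          then have "R = X * (1 + 2 * r * q) + \<beta>h * (s * (X / Q * (1 + 2 * (r - 1) * q)))"
            unfolding R_def by (simp only:)
          moreover have "X * v + \<beta>h * (s * (X / Q * w)) = X * (v + \<beta>h * (s / Q) * w)" for v w
            by (simp add: algebra_simps)
          ultimately show ?thesis by simp
        qed
        moreover have "\<bar>(1 + 2 * r * q) + \<beta>h * (s / Q) * (1 + 2 * (r - 1) * q)\<bar> \<le> c2"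
        proof -
          have "\<bar>\<beta>h * (s / Q) * (1 + 2 * (r - 1) * q)\<bar> = \<beta>h * (s / Q) * \<bar>1 + 2 * (r - 1) * q\<bar>"
            using \<beta>h_ge sp Qp by (simp add: abs_mult)
          also have "\<dots> \<le> \<beta>h * 1 * (1 + 2 * \<bar>r - 1\<bar>)"
          proof (intro mult_mono lin)
            show "s / Q \<le> 1" using sp Qp by (simp add: Q add_increasing)
          qed (use \<beta>h_ge sp Qp in auto)
          finally show ?thesis using lin[of r] unfolding c2_def by linarith
        qed
        ultimately show ?thesis using Xp by (simp add: abs_mult mult.commute mult_left_mono)
      qed
      have drift2: "\<theta> * (\<omega> * R) \<le> \<omega> * (c3 / s * (c2 * X))"
      proof -
        have "\<bar>\<theta>\<bar> * \<bar>R\<bar> \<le> c3 / s * (c2 * X)" using th R c3 sp by (intro mult_mono) auto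
        then have "\<theta> * R \<le> c3 / s * (c2 * X)" using abs_ge_self[of "\<theta> * R"] by (simp add: abs_mult)
        then have "\<omega> * (\<theta> * R) \<le> \<omega> * (c3 / s * (c2 * X))" using om by (intro mult_left_mono) auto
        then show ?thesis by (simp add: mult_ac)
      qed
      have F: "z * X \<le> A * (b s * (z * E)) + (z * X + \<beta>h * (s * (z * (X / Q))))"
        using Ap bp zp Ep \<beta>h_ge sp Xp Qp by simp
      define W where "W = s powr (- (5 / 4))"
      have W: "0 < W" using sp by (simp add: W_def)
      have F': "1 / 4 * W * (z * X) \<le> 1 / 4 * W * (A * (b s * (z * E)) + (z * X + \<beta>h * (s * (z * (X / Q)))))"
        using F W by (intro mult_left_mono) auto
      have "0 \<le> A * \<kappa> / 2 * s powr (r - 1) * z * E" using Ap kappa zp Ep by simp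
      then have G0: "0 \<le> G" using G by linarith
      have G': "\<omega> * (A * \<kappa> / 2 * s powr (r - 1) * z * E) \<le> \<omega> * G" using G om by (intro mult_left_mono) auto
      have Xs: "X = s powr r * (6 + z\<^sup>2 / s) powr r"
        unfolding X Q by (rule powr_quadratic_scale) (use sp in auto)
      have "0 \<le> 1 / 4 * W * (A * (b s * (z * E)) + (z * X + \<beta>h * (s * (z * (X / Q))))) + \<omega> * G
         - \<theta> * (\<omega> * (A * (b s * ((1 - z\<^sup>2 / (2 * s)) * E)) + R))"
      proof (cases "s \<le> z\<^sup>2")
        case True
        have bE: "b s * ((1 + z\<^sup>2 / (2 * s)) * E) \<le> s powr (1 / 8) * (cB * c4 * X)"
          unfolding X Q E by (rule b_gauss_bound[OF less_imp_le[OF c4(1)] c4(2) s(1)]) simp_all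
        have "\<bar>1 - z\<^sup>2 / (2 * s)\<bar> \<le> 1 + z\<^sup>2 / (2 * s)" using sp by (intro order_trans[OF abs_triangle_ineq4]) auto
        then have "\<bar>b s * ((1 - z\<^sup>2 / (2 * s)) * E)\<bar> \<le> b s * ((1 + z\<^sup>2 / (2 * s)) * E)"
          using bp Ep by (simp add: abs_mult)
        then have "A * \<bar>b s * ((1 - z\<^sup>2 / (2 * s)) * E)\<bar> \<le> A * (s powr (1 / 8) * (cB * c4 * X))"
          using bE Ap by (intro mult_left_mono) auto
        then have d1: "\<bar>\<theta>\<bar> * (A * \<bar>b s * ((1 - z\<^sup>2 / (2 * s)) * E)\<bar>) \<le> c3 / s * (A * (s powr (1 / 8) * (cB * c4 * X)))"
          using th Ap c3 sp by (intro mult_mono) auto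
        have "\<theta> * (A * (b s * ((1 - z\<^sup>2 / (2 * s)) * E))) \<le> c3 / s * (A * (s powr (1 / 8) * (cB * c4 * X)))"
        proof -
          have "\<theta> * (A * Y) \<le> \<bar>\<theta>\<bar> * (A * \<bar>Y\<bar>)" for Y
            using abs_ge_self[of "\<theta> * (A * Y)"] Ap by (simp add: abs_mult)
          then show ?thesis using d1 by (rule order_trans)
        qed
        then have "\<omega> * (\<theta> * (A * (b s * ((1 - z\<^sup>2 / (2 * s)) * E)))) \<le> \<omega> * (c3 / s * (A * (s powr (1 / 8) * (cB * c4 * X))))"
          using om by (intro mult_left_mono) auto
        then have "\<theta> * (\<omega> * (A * (b s * ((1 - z\<^sup>2 / (2 * s)) * E)) + R))
            \<le> \<omega> * (c3 / s * (A * (s powr (1 / 8) * (cB * c4 * X)))) + \<omega> * (c3 / s * (c2 * X))"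
          using drift2 by (simp add: algebra_simps)
        also have "\<dots> = \<omega> * (c3 / s * X) * (s powr (1 / 8) * (A * cB * c4) + c2)" by (simp add: algebra_simps)
        also have "\<dots> \<le> 2 * (c3 / s * X) * (s powr (1 / 8) * (A * cB * c4) + s powr (1 / 8) * c2)"
        proof -
          have "1 * c2 \<le> s powr (1 / 8) * c2" using sp c2 by (intro mult_right_mono ge_one_powr_ge_zero) auto
          then show ?thesis using om c3 sp Xp Ap cB c4 c2 by (intro mult_mono) (auto intro!: add_nonneg_nonneg)
        qed
        also have "\<dots> = X / s * s powr (1 / 8) * (M / 4)" by (simp add: M_def algebra_simps)
        also have "\<dots> \<le> 1 / 4 * W * (z * X)"
          unfolding W_def using powr_far_absorb[OF sp(2) s(2) True _ zp(1) Xp] M by simp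
        finally show ?thesis using F' G0 om mult_nonneg_nonneg[of \<omega> G] by linarith
      next
        case False
        have y: "0 \<le> z\<^sup>2 / s" "z\<^sup>2 / s \<le> 1" using False sp by auto
        have X3: "X \<le> s powr r * C3" using C3(2)[of "6 + z\<^sup>2 / s"] y by (simp add: Xs mult_left_mono)
        have E2: "1 / 2 \<le> E"
        proof -
          have "1 + - (z\<^sup>2 / (4 * s)) \<le> exp (- (z\<^sup>2 / (4 * s)))" by (rule exp_ge_add_one_self)
          moreover have "z\<^sup>2 / (4 * s) \<le> 1 / 4" using False sp by (simp add: field_simps)
          ultimately show ?thesis by (simp add: E)
        qed
        \<comment> \<open>Only an upper bound on \<open>b'\<close> is used, since the Gaussian
          factor \<open>w\<close> is nonnegative for \<open>z\<^sup>2 < s\<close>. This one-sided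
          bound contains no logarithm, unlike the bound on the absolute value.\<close>
        have tb: "\<theta> * b s \<le> cd / l * s powr (r - 1)"
        proof -
          have "b' s / l \<le> cd * s powr (r - 1) / l" using b'_le[OF s(1)] l_pos by (intro divide_right_mono) auto
          then show ?thesis using bp by (simp add: \<theta>_def)
        qed
        define S where "S = s powr (r - 1)"
        have S: "0 < S" using sp by (simp add: S_def)
        define w where "w = (1 - z\<^sup>2 / (2 * s)) * E"
        have w: "0 \<le> w" "w \<le> E" using Ep y by (auto simp: w_def mult_le_cancel_right1)
        have "\<theta> * b s * w \<le> cd / l * S * w" using tb w by (intro mult_right_mono) (auto simp: S_def)
        also have "\<dots> \<le> cd / l * S * E" using w cd l_pos S by (intro mult_left_mono) auto
        finally have "\<omega> * A * (\<theta> * b s * w) \<le> \<omega> * A * (cd / l * S * E)"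
          using om Ap by (intro mult_left_mono) auto
        then have d1: "\<theta> * (\<omega> * (A * (b s * w))) \<le> \<omega> * S * (A * E) * (cd / l)" by (simp add: mult_ac)
        have "c3 / s * (c2 * X) \<le> c3 / s * (c2 * (s powr r * C3))"
          using X3 c3 c2 sp by (intro mult_left_mono) auto
        also have "\<dots> = S * (c3 * c2 * C3)" using sp by (simp add: S_def powr_diff)
        finally have "\<omega> * (c3 / s * (c2 * X)) \<le> \<omega> * (S * (c3 * c2 * C3))"
          using om by (intro mult_left_mono) auto
        then have d2: "\<theta> * (\<omega> * R) \<le> \<omega> * S * (c3 * c2 * C3)" using drift2 by simp
        have "c3 * c2 * C3 \<le> A * E"
        proof -
          have "A1 * (1 / 2) \<le> A * E" using A E2 A1 by (intro mult_mono) auto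
          then show ?thesis by (simp add: A1_def)
        qed
        then have d3: "\<omega> * S * (c3 * c2 * C3) \<le> \<omega> * S * (A * E)" using om S by (intro mult_left_mono) auto
        have "2 * (cd / l + 1) / \<kappa> \<le> z" using z by (simp add: z1_def)
        then have "cd / l + 1 \<le> \<kappa> / 2 * z" using kappa by (simp add: field_simps)
        then have "\<omega> * S * (A * E) * (cd / l + 1) \<le> \<omega> * S * (A * E) * (\<kappa> / 2 * z)"
          using om S Ap Ep by (intro mult_left_mono) auto
        then have d4: "\<omega> * S * (A * E) * (cd / l) + \<omega> * S * (A * E) \<le> \<omega> * G"
        proof -
          have "\<omega> * S * (A * E) * (\<kappa> / 2 * z) = \<omega> * (A * \<kappa> / 2 * s powr (r - 1) * z * E)"
            by (simp add: S_def mult_ac)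
          moreover have "\<omega> * S * (A * E) * (cd / l + 1) = \<omega> * S * (A * E) * (cd / l) + \<omega> * S * (A * E)"
            by (simp add: distrib_left)
          ultimately show ?thesis
            using \<open>\<omega> * S * (A * E) * (cd / l + 1) \<le> \<omega> * S * (A * E) * (\<kappa> / 2 * z)\<close> G' by linarith
        qed
        have "0 \<le> 1 / 4 * W * (z * X)" using W zp Xp by simp
        moreover have "\<theta> * (\<omega> * (A * (b s * w) + R)) = \<theta> * (\<omega> * (A * (b s * w))) + \<theta> * (\<omega> * R)"
          by (simp add: distrib_left)
        ultimately show ?thesis using F' d1 d2 d3 d4 unfolding w_def[symmetric] by linarith
      qed
      then show "0 \<le> 1 / 4 * s powr (- (5 / 4)) * (A * (b s * (z * E)) + (z * X + \<beta>h * (s * (z * (X / Q)))))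
         + (2 - s powr (- (1 / 4))) * G
         - b' s / (l * b s) * ((2 - s powr (- (1 / 4))) * (A * (b s * ((1 - z\<^sup>2 / (2 * s)) * E)) +
              (X * (1 + 2 * r * z\<^sup>2 / Q) + \<beta>h * (s * (X / Q * (1 + 2 * (r - 1) * z\<^sup>2 / Q))))))"
        unfolding \<omega>_def R_def \<theta>_def W_def .
    qed
  qed
qed


text \<open>The last three bounds serve the comparison: the first dominates the initial tail, the
  second makes \<open>exp (- l * z) * H / b\<close> at least 1 on the boundary after scaling, and
  the third leaves it exponentially small in \<open>z\<close>, uniformly in time.\<close>

lemma upper_barrier:
  obtains T z1 c C H Hs Hz Hzz where
    "s0 \<le> T" "1 \<le> z1" "0 < c" "0 < C"
    "has_partials T UNIV H Hs Hz Hzz"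
    "\<And>s z. T < s \<Longrightarrow> z1 < z \<Longrightarrow> 0 \<le> Hs s z - Hzz s z - b' s / (l * b s) * Hz s z"
    "continuous_on ({T..} \<times> UNIV) (\<lambda>(s, z). H s z)"
    "\<And>s z. T \<le> s \<Longrightarrow> z1 \<le> z \<Longrightarrow> 0 \<le> H s z"
    "\<And>z. z1 \<le> z \<Longrightarrow> c * z powr (2 * r + 1) \<le> H T z"
    "\<And>s. T \<le> s \<Longrightarrow> c * b s \<le> H s z1"
    "\<And>s z. T \<le> s \<Longrightarrow> z1 \<le> z \<Longrightarrow> H s z \<le> C * b s * exp (l / 2 * z)"
proof -
  obtain A0 where A0: "0 < A0" and src: "\<And>A. A0 \<le> A \<Longrightarrow> upper_source_ok A"
    using upper_source by blast
  obtain A1 z1 where z1: "1 \<le> z1" and dr: "\<forall>A\<ge>A1. \<exists>T\<ge>s0. upper_drift_ok A z1 T"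
    using upper_drift by blast
  define A where "A = max A0 A1"
  have A: "A0 \<le> A" "A1 \<le> A" "0 < A" using A0 by (auto simp: A_def)
  obtain T where T: "s0 \<le> T" and dr': "upper_drift_ok A z1 T"
    using dr A(2) by blast
  have Tp: "0 < T" "1 \<le> T" using T s0 by auto
  define \<omega> where "\<omega> = (\<lambda>s::real. 2 - s powr (- (1 / 4)))"
  \<comment> \<open>The coefficient 6 makes the terms \<open>6 * p * z * Q powr p / Q\<close> of the
    time derivative and of the second space derivative cancel for both exponents, \<open>r\<close>
    and \<open>r - 1\<close>, whatever their sign.\<close>
  define F where "F = (\<lambda>s z. A * (b s * (z * exp (- z\<^sup>2 / (4 * s)))) +
     (z * (z\<^sup>2 + 6 * s) powr r + \<beta>h * (s * (z * (z\<^sup>2 + 6 * s) powr (r - 1)))))"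
  define H where "H = (\<lambda>s z. \<omega> s * F s z)"
  note g = b_gauss_partials[OF T]
  have w: "has_partials T UNIV (\<lambda>s z. z * (z\<^sup>2 + 6 * s) powr p)
    (\<lambda>s z. p * 6 * z * ((z\<^sup>2 + 6 * s) powr p / (z\<^sup>2 + 6 * s)))
    (\<lambda>s z. (z\<^sup>2 + 6 * s) powr p * (1 + 2 * p * z\<^sup>2 / (z\<^sup>2 + 6 * s)))
    (\<lambda>s z. (z\<^sup>2 + 6 * s) powr p * (6 * p * z / (z\<^sup>2 + 6 * s) + 4 * p * (p - 1) * z ^ 3 / (z\<^sup>2 + 6 * s)\<^sup>2))" for p
    by (rule has_partials_mono[OF has_partials_powr]) (use Tp in auto)
  define Fs where "Fs = (\<lambda>s z. A * (b' s * (z * exp (- z\<^sup>2 / (4 * s))) + b s * (z ^ 3 / (4 * s\<^sup>2) * exp (- z\<^sup>2 / (4 * s)))) +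
     (r * 6 * z * ((z\<^sup>2 + 6 * s) powr r / (z\<^sup>2 + 6 * s)) +
      \<beta>h * (1 * (z * (z\<^sup>2 + 6 * s) powr (r - 1)) + s * ((r - 1) * 6 * z * ((z\<^sup>2 + 6 * s) powr (r - 1) / (z\<^sup>2 + 6 * s))))))"
  define Fz where "Fz = (\<lambda>s z. A * (b s * ((1 - z\<^sup>2 / (2 * s)) * exp (- z\<^sup>2 / (4 * s)))) +
     ((z\<^sup>2 + 6 * s) powr r * (1 + 2 * r * z\<^sup>2 / (z\<^sup>2 + 6 * s)) +
      \<beta>h * (s * ((z\<^sup>2 + 6 * s) powr (r - 1) * (1 + 2 * (r - 1) * z\<^sup>2 / (z\<^sup>2 + 6 * s))))))"
  define Fzz where "Fzz = (\<lambda>s z. A * (b s * ((z ^ 3 / (4 * s\<^sup>2) - 3 * z / (2 * s)) * exp (- z\<^sup>2 / (4 * s)))) +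
     ((z\<^sup>2 + 6 * s) powr r * (6 * r * z / (z\<^sup>2 + 6 * s) + 4 * r * (r - 1) * z ^ 3 / (z\<^sup>2 + 6 * s)\<^sup>2) +
      \<beta>h * (s * ((z\<^sup>2 + 6 * s) powr (r - 1) * (6 * (r - 1) * z / (z\<^sup>2 + 6 * s) + 4 * (r - 1) * (r - 1 - 1) * z ^ 3 / (z\<^sup>2 + 6 * s)\<^sup>2)))))"
  have hF: "has_partials T UNIV F Fs Fz Fzz"
    unfolding F_def Fs_def Fz_def Fzz_def
    by (rule has_partials_add[OF has_partials_cmult[OF g, of A] has_partials_add[OF w[of r]
      has_partials_cmult[OF has_partials_timescale[OF w[of "r - 1"] DERIV_ident], of \<beta>h]]])
  have om: "(\<omega> has_real_derivative 1 / 4 * s powr (- (5 / 4))) (at s)" if "T < s" for s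
    unfolding \<omega>_def
    by (rule DERIV_cong[OF DERIV_diff[OF DERIV_const has_real_derivative_powr]]) (use that Tp in auto)
  have hH: "has_partials T UNIV H (\<lambda>s z. 1 / 4 * s powr (- (5 / 4)) * F s z + \<omega> s * Fs s z)
      (\<lambda>s z. \<omega> s * Fz s z) (\<lambda>s z. \<omega> s * Fzz s z)"
    unfolding H_def by (rule has_partials_timescale[OF hF om])
  have om1: "1 \<le> \<omega> s" "\<omega> s \<le> 2" if "T \<le> s" for s
    using that Tp by (auto simp: \<omega>_def powr_minus inverse_le_1_iff ge_one_powr_ge_zero)
  have Fge: "0 \<le> F s z" "z * (z\<^sup>2 + 6 * s) powr r \<le> F s z" "A * (b s * (z * exp (- z\<^sup>2 / (4 * s)))) \<le> F s z"
    if "T \<le> s" "z1 \<le> z" for s z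
    using that T Tp z1 A \<beta>h_ge b_pos[of s] by (auto simp: F_def)
  have HF: "F s z \<le> H s z" "H s z \<le> 2 * F s z" if "T \<le> s" "z1 \<le> z" for s z
    using mult_right_mono[OF om1(1) Fge(1)] mult_right_mono[OF om1(2) Fge(1)] that by (auto simp: H_def)
  obtain c0 where c0: "0 < c0" "\<And>x. 1 \<le> x \<Longrightarrow> x \<le> 1 + 6 * T \<Longrightarrow> c0 \<le> x powr r"
    using powr_bounds[of 1 "1 + 6 * T" r] by (metis zero_less_one)
  define c where "c = min c0 (A * z1 * exp (- z1\<^sup>2 / 4))"
  obtain C5 where C5: "0 < C5" "\<And>s z. 1 \<le> s \<Longrightarrow> 0 \<le> z \<Longrightarrow> (6 + z\<^sup>2 / s) powr r \<le> C5 * exp (l / 4 * z)"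
    by (rule powr_quadratic_le_exp[of 6 "l / 4" r]) (use l_pos in auto)
  obtain C6 where C6: "0 < C6" "\<And>x. 0 \<le> x \<Longrightarrow> (1 + x) powr 1 \<le> C6 * exp (l / 4 * x)"
    by (rule powr_le_exp[of "l / 4" 1 1]) (use l_pos in auto)
  define C where "C = 2 * (A * C6 + C6 * C5 * (1 + \<beta>h))"
  show ?thesis
  proof (rule that[OF T z1 _ _ hH])
    show "0 < c" using c0 A z1 by (simp add: c_def)
    show "0 < C" using C5 C6 A \<beta>h_ge by (simp add: C_def add_pos_pos)
    fix s z assume s: "T \<le> s" and z: "z1 \<le> z"
    show "0 \<le> H s z" using HF(1)[OF s z] Fge(1)[OF s z] by linarith
    have sp: "0 < s" "1 \<le> s" and zp: "0 < z" "0 \<le> z" using s z Tp z1 by auto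
    have ez: "z \<le> C6 * exp (l / 4 * z)" using C6(2)[of z] zp by simp
    have X: "(z\<^sup>2 + 6 * s) powr r \<le> b s * (C5 * exp (l / 4 * z))"
    proof -
      have "(z\<^sup>2 + 6 * s) powr r = s powr r * (6 + z\<^sup>2 / s) powr r"
        by (rule powr_quadratic_scale) (use sp in auto)
      also have "\<dots> \<le> b s * (C5 * exp (l / 4 * z))"
        using b_ge[of s] b_pos[of s] C5(2)[OF sp(2) zp(2)] s T by (intro mult_mono) auto
      finally show ?thesis .
    qed
    have bp: "0 < b s" using b_pos[of s] s T by simp
    have ee: "exp (l / 4 * z) * exp (l / 4 * z) = exp (l / 2 * z)"
      by (simp add: exp_add[symmetric])
    have e1: "exp (l / 4 * z) \<le> exp (l / 2 * z)" using l_pos zp by simp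
    have f1: "A * (b s * (z * exp (- z\<^sup>2 / (4 * s)))) \<le> A * (b s * (C6 * exp (l / 2 * z)))"
    proof -
      have "z * exp (- z\<^sup>2 / (4 * s)) \<le> (C6 * exp (l / 2 * z)) * 1"
        using ez e1 C6 zp sp by (intro mult_mono) (auto intro: order_trans[OF ez] mult_left_mono)
      then show ?thesis using A bp by simp
    qed
    have f2: "z * (z\<^sup>2 + 6 * s) powr r \<le> C6 * C5 * b s * exp (l / 2 * z)"
    proof -
      have "z * (z\<^sup>2 + 6 * s) powr r \<le> (C6 * exp (l / 4 * z)) * (b s * (C5 * exp (l / 4 * z)))"
        using X ez zp C6 by (intro mult_mono) auto
      also have "\<dots> = C6 * C5 * b s * (exp (l / 4 * z) * exp (l / 4 * z))" by (simp only: mult_ac)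
      finally show ?thesis unfolding ee .
    qed
    have f3: "\<beta>h * (s * (z * (z\<^sup>2 + 6 * s) powr (r - 1))) \<le> \<beta>h * (C6 * C5 * b s * exp (l / 2 * z))"
    proof -
      have "(z\<^sup>2 + 6 * s) powr (r - 1) = (z\<^sup>2 + 6 * s) powr r / (z\<^sup>2 + 6 * s)"
        using sp by (simp add: powr_diff add_nonneg_pos)
      then have "s * (z * (z\<^sup>2 + 6 * s) powr (r - 1)) = s / (z\<^sup>2 + 6 * s) * (z * (z\<^sup>2 + 6 * s) powr r)"
        by simp
      also have "\<dots> \<le> 1 * (z * (z\<^sup>2 + 6 * s) powr r)"
      proof (intro mult_right_mono)
        show "s / (z\<^sup>2 + 6 * s) \<le> 1" using sp by (simp add: add_nonneg_pos add_increasing)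
      qed (use zp in auto)
      finally show ?thesis using f2 \<beta>h_ge by (intro mult_left_mono) auto
    qed
    have "F s z \<le> A * (b s * (C6 * exp (l / 2 * z))) + (C6 * C5 * b s * exp (l / 2 * z) + \<beta>h * (C6 * C5 * b s * exp (l / 2 * z)))"
      unfolding F_def using f1 f2 f3 by linarith
    also have "2 * \<dots> = C * b s * exp (l / 2 * z)" by (simp add: C_def algebra_simps)
    finally show "H s z \<le> C * b s * exp (l / 2 * z)" using HF(2)[OF s z] by linarith
  next
    fix z assume z: "z1 \<le> z"
    have zp: "1 \<le> z" "0 < z" using z z1 by auto
    have "T / z\<^sup>2 \<le> T" using zp Tp by (simp add: divide_le_eq mult_le_cancel_left1 one_le_power)
    then have "c0 \<le> (1 + 6 * T / z\<^sup>2) powr r" using zp Tp by (intro c0(2)) auto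
    then have "z * (z powr (2 * r) * c0) \<le> z * (z powr (2 * r) * (1 + 6 * T / z\<^sup>2) powr r)"
      using zp by (intro mult_left_mono) auto
    also have "z powr (2 * r) = (z\<^sup>2) powr r" using zp by (simp add: powr_powr[symmetric])
    also have "(z\<^sup>2) powr r * (1 + 6 * T / z\<^sup>2) powr r = (z\<^sup>2 + 6 * T) powr r"
    proof -
      have "z\<^sup>2 + 6 * T = z\<^sup>2 * (1 + 6 * T / z\<^sup>2)" using zp by (simp add: distrib_left)
      then show ?thesis using zp Tp by (simp add: powr_mult)
    qed
    also have "(z\<^sup>2) powr r = z powr (2 * r)" using zp by (simp add: powr_powr[symmetric])
    also have "z * (z powr (2 * r) * c0) = c0 * z powr (2 * r + 1)" using zp by (simp add: powr_add)
    finally have "c0 * z powr (2 * r + 1) \<le> F T z"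
      using Fge(2)[of T z] z by simp
    moreover have "c * z powr (2 * r + 1) \<le> c0 * z powr (2 * r + 1)"
      by (intro mult_right_mono) (auto simp: c_def)
    ultimately show "c * z powr (2 * r + 1) \<le> H T z" using HF(1)[of T z] z by linarith
  next
    fix s assume s: "T \<le> s"
    have "z1\<^sup>2 / (4 * s) \<le> z1\<^sup>2 / 4" using s Tp by (intro divide_left_mono) auto
    then have "exp (- z1\<^sup>2 / 4) \<le> exp (- z1\<^sup>2 / (4 * s))" by simp
    then have "A * z1 * exp (- z1\<^sup>2 / 4) * b s \<le> A * z1 * exp (- z1\<^sup>2 / (4 * s)) * b s"
      using A z1 b_pos[of s] s T by (intro mult_right_mono mult_left_mono) auto
    moreover have "c * b s \<le> A * z1 * exp (- z1\<^sup>2 / 4) * b s"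
      using b_pos[of s] s T by (intro mult_right_mono) (auto simp: c_def)
    ultimately show "c * b s \<le> H s z1"
      using HF(1)[OF s order_refl] Fge(3)[OF s order_refl] by (simp add: mult_ac)
  next
    note c1 = b_fst_continuous[OF T order_refl]
    have "\<And>p. p \<in> {T..} \<times> UNIV \<Longrightarrow> (snd p)\<^sup>2 + 6 * fst p \<noteq> 0 \<and> fst p \<noteq> 0"
    proof -
      fix p assume "p \<in> {T..} \<times> (UNIV :: real set)"
      then have "0 < fst p" using Tp by auto
      then show "(snd p)\<^sup>2 + 6 * fst p \<noteq> 0 \<and> fst p \<noteq> 0" by (smt (verit) zero_le_power2)
    qed
    then show "continuous_on ({T..} \<times> UNIV) (\<lambda>(s, z). H s z)"
      unfolding H_def F_def \<omega>_def case_prod_beta by (auto intro!: continuous_intros c1)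
  next
    fix s z assume s: "T < s" and z: "z1 < z"
    have sp: "0 < s" and zp: "0 < z" using s z Tp z1 by auto
    have Qp: "0 < z\<^sup>2 + 6 * s" using sp by (simp add: add_nonneg_pos)
    define Q X E where "Q = z\<^sup>2 + 6 * s" and "X = Q powr r" and "E = exp (- z\<^sup>2 / (4 * s))"
    have Q0: "Q \<noteq> 0" using Qp by (simp add: Q_def)
    have XQ: "Q powr (r - 1) = X / Q" using Qp by (simp add: X_def Q_def powr_diff)
    have F1: "F s z = A * (b s * (z * E)) + (z * X + \<beta>h * (s * (z * (X / Q))))"
      unfolding F_def Q_def[symmetric] E_def[symmetric] XQ X_def[symmetric] ..
    have F2: "Fz s z = A * (b s * ((1 - z\<^sup>2 / (2 * s)) * E)) +
              (X * (1 + 2 * r * z\<^sup>2 / Q) + \<beta>h * (s * (X / Q * (1 + 2 * (r - 1) * z\<^sup>2 / Q))))"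
      unfolding Fz_def Q_def[symmetric] E_def[symmetric] XQ X_def[symmetric] ..
    have "Fs s z - Fzz s z = A * (b' s * (z * E) + b s * (z ^ 3 / (4 * s\<^sup>2) * E) - b s * ((z ^ 3 / (4 * s\<^sup>2) - 3 * z / (2 * s)) * E))
       + (r * 6 * z * (X / Q) - X * (6 * r * z / Q + 4 * r * (r - 1) * z ^ 3 / Q\<^sup>2))
       + \<beta>h * (z * (X / Q) + s * ((r - 1) * 6 * z * (X / Q / Q)) -
           s * (X / Q * (6 * (r - 1) * z / Q + 4 * (r - 1) * (r - 1 - 1) * z ^ 3 / Q\<^sup>2)))"
      unfolding Fs_def Fzz_def Q_def[symmetric] E_def[symmetric] XQ X_def[symmetric]
      by (simp add: right_diff_distrib)
    also have "b' s * (z * E) + b s * (z ^ 3 / (4 * s\<^sup>2) * E) - b s * ((z ^ 3 / (4 * s\<^sup>2) - 3 * z / (2 * s)) * E)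
       = z * E * (b' s + 3 / 2 * b s / s)"
      using sp by (simp add: algebra_simps)
    also have "r * 6 * z * (X / Q) - X * (6 * r * z / Q + 4 * r * (r - 1) * z ^ 3 / Q\<^sup>2)
       = - 4 * r * (r - 1) * z ^ 3 * X / Q\<^sup>2"
      using Q0 by (simp add: field_simps)
    also have "z * (X / Q) + s * ((r - 1) * 6 * z * (X / Q / Q)) -
           s * (X / Q * (6 * (r - 1) * z / Q + 4 * (r - 1) * (r - 1 - 1) * z ^ 3 / Q\<^sup>2))
       = z * X / Q - 4 * (r - 1) * (r - 2) * s * z ^ 3 * X / Q ^ 3"
      using Q0 by (simp add: field_simps power2_eq_square power3_eq_cube)
    finally have G: "A * \<kappa> / 2 * s powr (r - 1) * z * E \<le> Fs s z - Fzz s z"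
      using src[OF A(1), unfolded upper_source_ok_def, rule_format, OF _ zp Q_def X_def E_def] s T by (simp add: mult_ac)
    have "0 \<le> 1 / 4 * s powr (- (5 / 4)) * F s z + \<omega> s * (Fs s z - Fzz s z) - b' s / (l * b s) * (\<omega> s * Fz s z)"
      unfolding F1 F2 \<omega>_def using dr'[unfolded upper_drift_ok_def, rule_format, OF _ _ Q_def X_def E_def G] s z by simp
    then show "0 \<le> 1 / 4 * s powr (- (5 / 4)) * F s z + \<omega> s * Fs s z - \<omega> s * Fzz s z - b' s / (l * b s) * (\<omega> s * Fz s z)"
      by (simp add: algebra_simps)
  qed
qed

end

section \<open>The subsolution\<close>

text \<open>The conditions \<open>K_sign\<close> make both coefficients in the source of
  \<open>z * (z\<^sup>2 + K * s) powr r\<close> negative with size proportional to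
  \<open>\<bar>r\<bar>\<close>. As \<open>b'_abs_r\<close> gives the drift the same factor, constant
  \<open>b\<close> is covered as well. In the logarithmic alternative of \<open>b_cases\<close> the
  source of the Gaussian mode is free of logarithms, although \<open>b\<close> is not.\<close>

locale rate_lower = rate +
  fixes K cr :: real
  assumes K: "1 \<le> K" and cr: "0 < cr"
    and K_sign: "r * (K - 2 - 4 * r) \<le> - \<bar>r\<bar>" "r * (K * (K - 6)) \<le> - \<bar>r\<bar> * K"
    and b'_abs_r: "\<And>s. s0 \<le> s \<Longrightarrow> \<bar>b' s\<bar> \<le> cr * \<bar>r\<bar> * b s / s"
    and b_cases: "(\<forall>s\<ge>s0. b s = s powr r) \<or>
      r < 0 \<and> (\<forall>s\<ge>s0. b s = s powr r * ln s \<and> b' s + 3 / 2 * b s / s = s powr (r - 1))"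
begin

text \<open>The left-hand side is the operator applied to
  \<open>(1 + s powr (- 1 / 4)) * (z Q powr r + \<eta> b z E)\<close>.\<close>

definition lower_ok :: "real \<Rightarrow> real \<Rightarrow> real \<Rightarrow> bool" where
  "lower_ok \<eta> D T \<longleftrightarrow> (\<forall>s z Q X E. T \<le> s \<longrightarrow> - 1 \<le> z \<longrightarrow> Q = z\<^sup>2 + K * s \<longrightarrow> X = Q powr r \<longrightarrow>
      E = exp (- z\<^sup>2 / (4 * s)) \<longrightarrow>
      - (1 / 4) * s powr (- (5 / 4)) * (z * X + \<eta> * (b s * (z * E)))
      + (1 + s powr (- (1 / 4))) *
         (z * X / Q\<^sup>2 * (r * (K - 2 - 4 * r) * z\<^sup>2 + r * (K * (K - 6)) * s)
           + \<eta> * z * E * (b' s + 3 / 2 * b s / s))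
      - b' s / (l * b s) * ((1 + s powr (- (1 / 4))) *
         (X * (1 + 2 * r * z\<^sup>2 / Q) + \<eta> * (b s * ((1 - z\<^sup>2 / (2 * s)) * E))))
      \<le> l\<^sup>2 / 8 * D * b s * exp (- (l / 2) * z))"

text \<open>For a pure power \<open>b\<close>, the power profile already has height \<open>b\<close>
  and \<open>\<eta> = 0\<close> works. In the logarithmic case that profile lacks a factor
  \<open>ln s\<close>, so some Gaussian is indispensable. Its source has the wrong sign, hence
  \<open>\<eta>\<close> is small enough to spend at most half of the opposite source of the power
  profile. The last bound is the condition that the barrier be nonpositive at
  \<open>z = - 1\<close>.\<close>

lemma lower_params:
  fixes c8 :: real
  assumes c8: "0 < c8"
    and c7: "0 < c7" "\<And>x. K \<le> x \<Longrightarrow> x \<le> K + 1 \<Longrightarrow> c7 \<le> x powr r"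
  obtains \<eta> D where "0 \<le> \<eta>" "0 < D"
    "\<And>s z. s0 \<le> s \<Longrightarrow> 0 \<le> z \<Longrightarrow> \<eta> * z * exp (- z\<^sup>2 / (4 * s)) * (b' s + 3 / 2 * b s / s)
       \<le> \<bar>r\<bar> / 2 * (z * ((z\<^sup>2 + K * s) powr r / (z\<^sup>2 + K * s)))"
    "\<And>s. s0 \<le> s \<Longrightarrow> \<eta> * b s \<le> c8 * s powr r * ln s"
    "\<And>s. s0 \<le> s \<Longrightarrow> D * exp (l / 2) * b s \<le> ((- 1)\<^sup>2 + K * s) powr r + \<eta> * b s * exp (- (- 1)\<^sup>2 / (4 * s))"
  using b_cases
proof
  assume b: "\<forall>s\<ge>s0. b s = s powr r"
  show thesis
  proof (rule that[of 0 "c7 * exp (- (l / 2))"])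
    fix s assume s: "s0 \<le> s"
    then have sp: "0 < s" "1 \<le> s" using s0 by auto
    show "0 * b s \<le> c8 * s powr r * ln s" using c8 sp by simp
    have "c7 \<le> (K + (- 1)\<^sup>2 / s) powr r" using sp by (intro c7(2)) auto
    then have "c7 * s powr r \<le> ((- 1)\<^sup>2 + K * s) powr r"
      using powr_quadratic_scale[of s K "- 1" r] sp K by (simp add: mult.commute)
    then show "c7 * exp (- (l / 2)) * exp (l / 2) * b s \<le> ((- 1)\<^sup>2 + K * s) powr r + 0 * b s * exp (- (- 1)\<^sup>2 / (4 * s))"
      using b s by (simp add: mult.assoc exp_add[symmetric])
  next
    fix s z :: real assume "s0 \<le> s" "0 \<le> z"
    then have "0 \<le> z\<^sup>2 + K * s" using K s0 by (simp add: add_nonneg_nonneg)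
    then show "0 * z * exp (- z\<^sup>2 / (4 * s)) * (b' s + 3 / 2 * b s / s)
       \<le> \<bar>r\<bar> / 2 * (z * ((z\<^sup>2 + K * s) powr r / (z\<^sup>2 + K * s)))" using \<open>0 \<le> z\<close> by simp
  qed (use c7 in auto)
next
  assume "r < 0 \<and> (\<forall>s\<ge>s0. b s = s powr r * ln s \<and> b' s + 3 / 2 * b s / s = s powr (r - 1))"
  then have r: "r < 0" and b: "\<And>s. s0 \<le> s \<Longrightarrow> b s = s powr r * ln s"
    "\<And>s. s0 \<le> s \<Longrightarrow> b' s + 3 / 2 * b s / s = s powr (r - 1)" by auto
  obtain c where c: "0 < c" "\<And>y. 0 \<le> y \<Longrightarrow> (1 + y / 2) * exp (- y / 4) \<le> c * (K + y) powr (r - 1)"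
    using gauss_le_powr[of K "r - 1"] K by auto
  define \<eta> where "\<eta> = min c8 (\<bar>r\<bar> / 2 / c)"
  have eta: "0 < \<eta>" "\<eta> \<le> c8" "\<eta> \<le> \<bar>r\<bar> / 2 / c" using c8 c r by (auto simp: \<eta>_def min_def divide_neg_pos)
  show thesis
  proof (rule that[of \<eta> "\<eta> / 2 * exp (- (l / 2))"])
    fix s assume s: "s0 \<le> s"
    then have sp: "0 < s" "1 \<le> s" using s0 by auto
    have "\<eta> * (s powr r * ln s) \<le> c8 * (s powr r * ln s)" using eta sp by (intro mult_right_mono) auto
    then show "\<eta> * b s \<le> c8 * s powr r * ln s" using b(1)[OF s] by simp
    have "1 + - (1 / (4 * s)) \<le> exp (- (1 / (4 * s)))" by (rule exp_ge_add_one_self)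
    moreover have "1 / (4 * s) \<le> 1 / 2" using sp by (simp add: field_simps)
    ultimately have "1 / 2 \<le> exp (- (1 / (4 * s)))" by linarith
    then have "\<eta> * b s * (1 / 2) \<le> \<eta> * b s * exp (- (1 / (4 * s)))"
      using eta b_pos[OF s] by (intro mult_left_mono) auto
    moreover have "0 \<le> ((- 1)\<^sup>2 + K * s) powr r" by simp
    moreover have "\<eta> / 2 * exp (- (l / 2)) * exp (l / 2) * b s = \<eta> * b s * (1 / 2)"
    proof -
      have "exp (- (l / 2)) * exp (l / 2) = 1" by (simp add: exp_minus)
      moreover have "\<eta> / 2 * e1 * e2 * b s = \<eta> * b s * (1 / 2)" if "e1 * e2 = 1" for e1 e2
        using that by simp
      ultimately show ?thesis by blast
    qed
    moreover have e: "exp (- (- 1)\<^sup>2 / (4 * s)) = exp (- (1 / (4 * s)))" by simp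
    ultimately show "\<eta> / 2 * exp (- (l / 2)) * exp (l / 2) * b s
        \<le> ((- 1)\<^sup>2 + K * s) powr r + \<eta> * b s * exp (- (- 1)\<^sup>2 / (4 * s))"
      unfolding e by linarith
  next
    fix s z :: real assume s: "s0 \<le> s" and z: "0 \<le> z"
    then have sp: "0 < s" "1 \<le> s" using s0 by auto
    have Q: "0 < z\<^sup>2 + K * s" using K sp by (simp add: add_nonneg_pos)
    have "exp (- z\<^sup>2 / (4 * s)) \<le> (1 + (z\<^sup>2 / s) / 2) * exp (- (z\<^sup>2 / s) / 4)"
      using sp by (simp add: mult_le_cancel_right1 mult.commute)
    also have "\<dots> \<le> c * (K + z\<^sup>2 / s) powr (r - 1)" using sp by (intro c(2)) simp
    finally have "\<eta> * exp (- z\<^sup>2 / (4 * s)) \<le> (\<bar>r\<bar> / 2 / c) * (c * (K + z\<^sup>2 / s) powr (r - 1))"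
      using eta by (intro mult_mono) auto
    then have "\<eta> * exp (- z\<^sup>2 / (4 * s)) \<le> \<bar>r\<bar> / 2 * (K + z\<^sup>2 / s) powr (r - 1)" using c by simp
    then have "\<eta> * exp (- z\<^sup>2 / (4 * s)) * (z * s powr (r - 1)) \<le> \<bar>r\<bar> / 2 * (K + z\<^sup>2 / s) powr (r - 1) * (z * s powr (r - 1))"
      using z by (intro mult_right_mono) auto
    also have "\<dots> = \<bar>r\<bar> / 2 * (z * (z\<^sup>2 + K * s) powr (r - 1))"
      using powr_quadratic_scale[of s K z "r - 1"] sp K by (simp add: mult_ac)
    also have "(z\<^sup>2 + K * s) powr (r - 1) = (z\<^sup>2 + K * s) powr r / (z\<^sup>2 + K * s)"
      using Q by (simp add: powr_diff)
    finally show "\<eta> * z * exp (- z\<^sup>2 / (4 * s)) * (b' s + 3 / 2 * b s / s)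
       \<le> \<bar>r\<bar> / 2 * (z * ((z\<^sup>2 + K * s) powr r / (z\<^sup>2 + K * s)))"
      unfolding b(2)[OF s] by (simp add: mult_ac)
  qed (use eta in auto)
qed

text \<open>The term \<open>D b e\<^bsup>- l z / 2\<^esup>\<close> absorbs the drift up to distance of order \<open>ln s\<close>; beyond that the
  source of the power profile does, and beyond distance \<open>sqrt s\<close> the decreasing factor
  \<open>1 + s powr (- 1 / 4)\<close>.\<close>

lemma lower_drift:
  obtains \<eta> D T where "0 \<le> \<eta>" "0 < D" "s0 \<le> T" "lower_ok \<eta> D T"
    "\<And>s. T \<le> s \<Longrightarrow> D * exp (l / 2) * b s \<le> ((- 1)\<^sup>2 + K * s) powr r + \<eta> * b s * exp (- (- 1)\<^sup>2 / (4 * s))"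
proof -
  define c2 where "c2 = 1 + 2 * \<bar>r\<bar>"
  have c2: "0 < c2" by (simp add: c2_def)
  define c3 where "c3 = cr / l"
  have c3: "0 < c3" using cr l_pos by (simp add: c3_def)
  obtain c4 where c4: "0 < c4" "\<And>y. 0 \<le> y \<Longrightarrow> (1 + y / 2) * exp (- y / 4) \<le> c4 * (K + y) powr r"
    using gauss_le_powr[of K r] K by auto
  obtain c7 C7 where c7: "0 < c7" "0 < C7" "\<And>x. K \<le> x \<Longrightarrow> x \<le> K + 1 \<Longrightarrow> c7 \<le> x powr r \<and> x powr r \<le> C7"
    using powr_bounds[of K "K + 1" r] K by auto
  define c8 where "c8 = c7 / (2 * (K + 1))"
  have c8: "0 < c8" using c7 K by (simp add: c8_def)
  \<comment> \<open>With this bound on \<open>\<eta> * b s\<close> the drift on the Gaussian is at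
    most half the remaining source once \<open>ln s / l \<le> z\<close>. The other half pays for the
    drift on the power profile once \<open>z1 \<le> z\<close>.\<close>
  have "0 < c8 / (8 * c3 * l)" using c8 c3 l_pos by simp
  from lower_params[OF this c7(1)] c7(3) obtain \<eta> D where eta: "0 \<le> \<eta>" and D: "0 < D"
    and eta2: "\<And>s z. s0 \<le> s \<Longrightarrow> 0 \<le> z \<Longrightarrow> \<eta> * z * exp (- z\<^sup>2 / (4 * s)) * (b' s + 3 / 2 * b s / s)
       \<le> \<bar>r\<bar> / 2 * (z * ((z\<^sup>2 + K * s) powr r / (z\<^sup>2 + K * s)))"
    and eta3: "\<And>s. s0 \<le> s \<Longrightarrow> \<eta> * b s \<le> c8 / (8 * c3 * l) * s powr r * ln s"
    and eta4: "\<And>s. s0 \<le> s \<Longrightarrow> D * exp (l / 2) * b s \<le> ((- 1)\<^sup>2 + K * s) powr r + \<eta> * b s * exp (- (- 1)\<^sup>2 / (4 * s))"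
    by metis
  define M where "M = 8 * c3 * \<bar>r\<bar> * (\<eta> * cB * c4 + c2)"
  have M: "0 \<le> M" using c3 c2 eta cB c4 by (simp add: M_def)
  define z1 where "z1 = max 1 (4 * c3 * c2 * C7 / c8)"
  define Cq where "Cq = 1 + 32 * \<bar>r\<bar> * c3 * \<eta> / (l\<^sup>2 * D)"
  have Cq: "1 \<le> Cq" using c3 eta D by (simp add: Cq_def)
  define C9 where "C9 = C7 + \<eta> + 2 * (\<bar>r\<bar> * \<bar>K - 2 - 4 * r\<bar> + \<bar>r\<bar> * \<bar>K - 6\<bar> * K) * C7 + 2 * \<eta> * (cb + 2)
      + 2 * c3 * \<bar>r\<bar> * (c2 * C7 + 2 * \<eta>)"
  have C9: "0 \<le> C9" using c7 eta cb c3 c2 K unfolding C9_def by (intro add_nonneg_nonneg mult_nonneg_nonneg) auto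
  define T where "T = max (max s0 (M powr 8 + 1)) (max (max (2 + z1\<^sup>2) (Cq\<^sup>2)) (8 * C9 * exp (l / 2 * z1) / (l\<^sup>2 * D)))"
  have "lower_ok \<eta> D T"
    unfolding lower_ok_def
  proof (intro allI impI)
    fix s z Q X E :: real
    assume sT: "T \<le> s" and z: "- 1 \<le> z" and Q: "Q = z\<^sup>2 + K * s" and X: "X = Q powr r"
      and E: "E = exp (- z\<^sup>2 / (4 * s))"
    have s: "s0 \<le> s" "M powr 8 \<le> s" "2 + z1\<^sup>2 \<le> s" "Cq\<^sup>2 \<le> s" "8 * C9 * exp (l / 2 * z1) / (l\<^sup>2 * D) \<le> s"
      using sT by (auto simp: T_def)
    have sp: "0 < s" "1 \<le> s" using s s0 by auto
    have Qp: "0 < Q" using sp K by (simp add: Q add_nonneg_pos)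
    have Ep: "0 < E" "E \<le> 1" using sp by (auto simp: E)
    have Xp: "0 < X" using Qp by (simp add: X)
    have bp: "0 < b s" using b_pos[OF s(1)] .
    define \<omega> where "\<omega> = 1 + s powr (- (1 / 4))"
    have om: "1 \<le> \<omega>" "\<omega> \<le> 2" using sp
      by (auto simp: \<omega>_def powr_minus inverse_le_1_iff ge_one_powr_ge_zero)
    define R where "R = X * (1 + 2 * r * z\<^sup>2 / Q) + \<eta> * (b s * ((1 - z\<^sup>2 / (2 * s)) * E))"
    define \<theta> where "\<theta> = b' s / (l * b s)"
    have th: "\<bar>\<theta>\<bar> \<le> c3 * \<bar>r\<bar> / s"
    proof -
      have "\<bar>\<theta>\<bar> = \<bar>b' s\<bar> / (l * b s)" using l_pos bp by (simp add: \<theta>_def abs_mult)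
      also have "\<dots> \<le> (cr * \<bar>r\<bar> * b s / s) / (l * b s)"
        using b'_abs_r[OF s(1)] l_pos bp by (intro divide_right_mono) auto
      also have "\<dots> = c3 * \<bar>r\<bar> / s" using bp by (simp add: c3_def)
      finally show ?thesis .
    qed
    define q where "q = z\<^sup>2 / Q"
    have q: "0 \<le> q" "q \<le> 1" using Qp sp K by (auto simp: q_def Q)
    have R: "\<bar>R\<bar> \<le> c2 * X + \<eta> * (b s * ((1 + z\<^sup>2 / (2 * s)) * E))"
    proof -
      have "\<bar>r\<bar> * q \<le> \<bar>r\<bar>" using q by (simp add: mult_left_le)
      then have "\<bar>1 + 2 * r * q\<bar> \<le> c2"
        using abs_triangle_ineq[of 1 "2 * r * q"] q by (simp add: abs_mult c2_def)
      then have "\<bar>X * (1 + 2 * r * z\<^sup>2 / Q)\<bar> \<le> c2 * X"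
        using Xp by (simp add: abs_mult q_def mult.commute)
      moreover have "\<bar>1 - z\<^sup>2 / (2 * s)\<bar> \<le> 1 + z\<^sup>2 / (2 * s)" using sp by (intro order_trans[OF abs_triangle_ineq4]) auto
      then have "\<eta> * (b s * (\<bar>1 - z\<^sup>2 / (2 * s)\<bar> * E)) \<le> \<eta> * (b s * ((1 + z\<^sup>2 / (2 * s)) * E))"
        using bp Ep eta by (intro mult_left_mono mult_right_mono) auto
      then have "\<bar>\<eta> * (b s * ((1 - z\<^sup>2 / (2 * s)) * E))\<bar> \<le> \<eta> * (b s * ((1 + z\<^sup>2 / (2 * s)) * E))"
        using bp Ep eta by (simp add: abs_mult)
      ultimately show ?thesis unfolding R_def by linarith
    qed
    have drift: "- (\<theta> * (\<omega> * R)) \<le> 2 * (c3 * \<bar>r\<bar> / s) * (c2 * X + \<eta> * (b s * ((1 + z\<^sup>2 / (2 * s)) * E)))"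
    proof -
      have "- (\<theta> * (\<omega> * R)) \<le> \<omega> * (\<bar>\<theta>\<bar> * \<bar>R\<bar>)"
        using abs_ge_minus_self[of "\<theta> * (\<omega> * R)"] om by (simp add: abs_mult mult_ac)
      also have "\<dots> \<le> 2 * (c3 * \<bar>r\<bar> / s * (c2 * X + \<eta> * (b s * ((1 + z\<^sup>2 / (2 * s)) * E))))"
        using om th R c3 sp by (intro mult_mono) auto
      finally show ?thesis by (simp add: mult.assoc)
    qed
    have Xs: "X = s powr r * (K + z\<^sup>2 / s) powr r"
      unfolding X Q by (rule powr_quadratic_scale) (use sp K in auto)
    define W where "W = s powr (- (5 / 4))"
    have W: "0 < W" "W \<le> 1 / s"
    proof -
      have "W \<le> s powr (- 1)" unfolding W_def using sp by (intro powr_mono) auto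
      then show "W \<le> 1 / s" using sp by (simp add: powr_minus_divide)
    qed (use sp in \<open>simp add: W_def\<close>)
    define G where "G = z * X / Q\<^sup>2 * (r * (K - 2 - 4 * r) * z\<^sup>2 + r * (K * (K - 6)) * s)
           + \<eta> * z * E * (b' s + 3 / 2 * b s / s)"
    have Gneg: "G \<le> - (\<bar>r\<bar> / 2 * (z * (X / Q)))" if z0: "0 \<le> z"
    proof -
      have "r * (K - 2 - 4 * r) * z\<^sup>2 + r * (K * (K - 6)) * s \<le> - \<bar>r\<bar> * z\<^sup>2 + - \<bar>r\<bar> * K * s"
        using sp by (intro add_mono mult_right_mono K_sign) auto
      also have "\<dots> = - \<bar>r\<bar> * Q" by (simp add: Q algebra_simps)
      finally have "z * X / Q\<^sup>2 * (r * (K - 2 - 4 * r) * z\<^sup>2 + r * (K * (K - 6)) * s) \<le> z * X / Q\<^sup>2 * (- \<bar>r\<bar> * Q)"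
        using z0 Xp by (intro mult_left_mono) auto
      also have "\<dots> = - \<bar>r\<bar> * (z * (X / Q))" using Qp by (simp add: power2_eq_square)
      finally show ?thesis using eta2[OF s(1) z0] unfolding G_def E X Q by linarith
    qed
    define rhs where "rhs = l\<^sup>2 / 8 * D * b s * exp (- (l / 2) * z)"
    have rhs: "0 < rhs" using l_pos D bp by (simp add: rhs_def)
    have "- (1 / 4) * W * (z * X + \<eta> * (b s * (z * E))) + \<omega> * G - \<theta> * (\<omega> * R) \<le> rhs"
    proof (cases "s \<le> z\<^sup>2")
      case True
      have z0: "0 < z"
      proof (rule ccontr)
        assume "\<not> 0 < z"
        then have "\<bar>z\<bar> \<le> 1" using z by auto
        then have "z\<^sup>2 \<le> 1" by (simp add: abs_square_le_1)
        then show False using True s(3) zero_le_power2[of z1] by linarith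
      qed
      have bE: "b s * ((1 + z\<^sup>2 / (2 * s)) * E) \<le> s powr (1 / 8) * (cB * c4 * X)"
        unfolding X Q E by (rule b_gauss_bound[OF less_imp_le[OF c4(1)] c4(2) s(1)]) (use K in simp_all)
      have "c2 * X + \<eta> * (b s * ((1 + z\<^sup>2 / (2 * s)) * E))
         \<le> s powr (1 / 8) * (c2 * X) + \<eta> * (s powr (1 / 8) * (cB * c4 * X))"
      proof -
        have "1 * (c2 * X) \<le> s powr (1 / 8) * (c2 * X)"
          using sp c2 Xp by (intro mult_right_mono ge_one_powr_ge_zero) auto
        then show ?thesis using mult_left_mono[OF bE eta] by linarith
      qed
      then have "2 * (c3 * \<bar>r\<bar> / s) * (c2 * X + \<eta> * (b s * ((1 + z\<^sup>2 / (2 * s)) * E)))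
         \<le> 2 * (c3 * \<bar>r\<bar> / s) * (s powr (1 / 8) * (c2 * X) + \<eta> * (s powr (1 / 8) * (cB * c4 * X)))"
        using c3 sp by (intro mult_left_mono) auto
      also have "\<dots> = X / s * s powr (1 / 8) * (M / 4)" by (simp add: M_def algebra_simps)
      also have "\<dots> \<le> 1 / 4 * W * (z * X)"
        unfolding W_def by (rule powr_far_absorb[OF sp(2) s(2) True M z0 Xp])
      finally have d: "- (\<theta> * (\<omega> * R)) \<le> 1 / 4 * W * (z * X)" using drift by linarith
      have "0 \<le> \<bar>r\<bar> / 2 * (z * (X / Q))" using z0 Xp Qp by simp
      then have "G \<le> 0" using Gneg z0 by linarith
      then have g: "\<omega> * G \<le> 0" using om by (simp add: mult_nonneg_nonpos)
      have "0 \<le> 1 / 4 * W * (\<eta> * (b s * (z * E)))" using W eta bp z0 Ep by simp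
      moreover have "1 / 4 * W * (z * X + \<eta> * (b s * (z * E))) = 1 / 4 * W * (z * X) + 1 / 4 * W * (\<eta> * (b s * (z * E)))"
        by (simp add: distrib_left)
      ultimately show ?thesis using d g rhs by linarith
    next
      case False
      have y: "0 \<le> z\<^sup>2 / s" "z\<^sup>2 / s \<le> 1" using False sp by auto
      have X7: "c7 * s powr r \<le> X" "X \<le> C7 * s powr r"
        using c7(3)[of "K + z\<^sup>2 / s"] y sp by (auto simp: Xs mult.commute)
      have Qs: "s \<le> Q" "Q \<le> (K + 1) * s"
      proof -
        have "1 * s \<le> K * s" using K sp by (intro mult_right_mono) auto
        then show "s \<le> Q" by (simp add: Q add_increasing)
        show "Q \<le> (K + 1) * s" using False by (simp add: Q algebra_simps)
      qed
      have Y: "(1 + z\<^sup>2 / (2 * s)) * E \<le> 2"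
      proof -
        have "1 + z\<^sup>2 / (2 * s) \<le> 2" using y(2) sp by (simp add: field_simps)
        then have "(1 + z\<^sup>2 / (2 * s)) * E \<le> 2 * 1" using Ep sp by (intro mult_mono) auto
        then show ?thesis by simp
      qed
      have d: "- (\<theta> * (\<omega> * R)) \<le> 2 * (c3 * \<bar>r\<bar> / s) * (c2 * (C7 * s powr r) + \<eta> * (b s * 2))"
      proof -
        have "c2 * X + \<eta> * (b s * ((1 + z\<^sup>2 / (2 * s)) * E)) \<le> c2 * (C7 * s powr r) + \<eta> * (b s * 2)"
          using X7 Y c2 eta bp by (intro add_mono mult_left_mono) auto
        then have "2 * (c3 * \<bar>r\<bar> / s) * (c2 * X + \<eta> * (b s * ((1 + z\<^sup>2 / (2 * s)) * E)))
           \<le> 2 * (c3 * \<bar>r\<bar> / s) * (c2 * (C7 * s powr r) + \<eta> * (b s * 2))"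
          using c3 sp by (intro mult_left_mono) auto
        then show ?thesis using drift by linarith
      qed
      show ?thesis
      proof (cases "z1 \<le> z")
        case True
        have z0: "0 \<le> z" "1 \<le> z" using True by (auto simp: z1_def)
        define S where "S = s powr r / s"
        have S: "0 < S" using sp by (simp add: S_def)
        have F0: "0 \<le> 1 / 4 * W * (z * X + \<eta> * (b s * (z * E)))"
          using W z0 Xp eta bp Ep by simp
        have g: "\<omega> * G \<le> - (\<bar>r\<bar> * c8 * z * S)"
        proof -
          have "c7 * s powr r / ((K + 1) * s) \<le> X / Q"
            using X7 Qs Xp Qp by (intro frac_le) auto
          then have "\<bar>r\<bar> / 2 * (z * (c7 * s powr r / ((K + 1) * s))) \<le> \<bar>r\<bar> / 2 * (z * (X / Q))"
            using z0 by (intro mult_left_mono) auto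
          moreover have "\<bar>r\<bar> / 2 * (z * (c7 * s powr r / ((K + 1) * s))) = \<bar>r\<bar> * c8 * z * S"
            using K sp by (simp add: c8_def S_def field_simps)
          ultimately have "G \<le> - (\<bar>r\<bar> * c8 * z * S)" using Gneg[OF z0(1)] by linarith
          moreover have "0 \<le> \<bar>r\<bar> * c8 * z * S" using c8 z0 S by simp
          ultimately have "\<omega> * G \<le> 1 * G" using om by (intro mult_right_mono_neg) auto
          then show ?thesis using \<open>G \<le> - (\<bar>r\<bar> * c8 * z * S)\<close> by linarith
        qed
        have t1: "2 * (c3 * \<bar>r\<bar> / s) * (c2 * (C7 * s powr r)) \<le> \<bar>r\<bar> * c8 * z * S / 2"
        proof -
          have "4 * c3 * c2 * C7 / c8 \<le> z" using True by (simp add: z1_def)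
          then have "2 * c3 * c2 * C7 \<le> c8 * z / 2" using c8 by (simp add: field_simps)
          then have "\<bar>r\<bar> * S * (2 * c3 * c2 * C7) \<le> \<bar>r\<bar> * S * (c8 * z / 2)"
            using S by (intro mult_left_mono) auto
          then show ?thesis by (simp add: S_def mult_ac)
        qed
        have t2: "2 * (c3 * \<bar>r\<bar> / s) * (\<eta> * (b s * 2)) \<le> \<bar>r\<bar> * c8 * z * S / 2 + rhs"
        proof (cases "ln s / l \<le> z")
          case True
          have "2 * (c3 * \<bar>r\<bar> / s) * (\<eta> * (b s * 2)) = 4 * c3 * \<bar>r\<bar> / s * (\<eta> * b s)" by simp
          also have "\<dots> \<le> 4 * c3 * \<bar>r\<bar> / s * (c8 / (8 * c3 * l) * s powr r * ln s)"
            using eta3[OF s(1)] c3 sp by (intro mult_left_mono) auto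
          also have "\<dots> = \<bar>r\<bar> * c8 * S / 2 * (ln s / l)"
            using c3 l_pos sp by (simp add: S_def field_simps)
          also have "\<dots> \<le> \<bar>r\<bar> * c8 * S / 2 * z" using True c8 S by (intro mult_left_mono) auto
          also have "\<dots> = \<bar>r\<bar> * c8 * z * S / 2" by simp
          finally show ?thesis using rhs by linarith
        next
          case False
          \<comment> \<open>Below \<open>ln s / l\<close> the exponential in \<open>rhs\<close> is
            at least \<open>1 / sqrt s\<close>, which exceeds the order \<open>1 / s\<close> of the
            drift by any constant \<open>Cq\<close> as soon as
            \<open>Cq\<^sup>2 \<le> s\<close>.\<close>
          then have "l / 2 * z \<le> ln s / 2" using l_pos by (simp add: field_simps)
          then have "exp (- (ln s / 2)) \<le> exp (- (l / 2) * z)" by simp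
          moreover have "exp (- (ln s / 2)) = 1 / sqrt s"
            using sp by (simp add: exp_minus ln_sqrt[symmetric] inverse_eq_divide)
          moreover have "Cq / s \<le> 1 / sqrt s"
          proof -
            have "Cq \<le> sqrt s" using s(4) Cq by (simp add: real_le_rsqrt)
            then have "Cq * sqrt s \<le> sqrt s * sqrt s" using sp by (intro mult_right_mono) auto
            then have "Cq * sqrt s \<le> s" using sp by simp
            then show ?thesis using sp by (simp add: field_simps)
          qed
          ultimately have "l\<^sup>2 / 8 * D * b s * (Cq / s) \<le> rhs"
            unfolding rhs_def using l_pos D bp by (intro mult_left_mono) auto
          moreover have "l\<^sup>2 / 8 * D * b s * (Cq / s) = (l\<^sup>2 / 8 * D) * (b s / s) + 4 * \<bar>r\<bar> * c3 * \<eta> * (b s / s)"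
          proof -
            have "l\<^sup>2 / 8 * D * Cq = l\<^sup>2 / 8 * D + 4 * \<bar>r\<bar> * c3 * \<eta>"
            proof -
              define N where "N = l\<^sup>2 * D"
              have "N / 8 * (1 + 32 * \<bar>r\<bar> * c3 * \<eta> / N) = N / 8 + 4 * \<bar>r\<bar> * c3 * \<eta>"
                using l_pos D by (simp add: N_def distrib_left)
              then show ?thesis by (simp add: N_def Cq_def)
            qed
            then have "(l\<^sup>2 / 8 * D * Cq) * (b s / s) = (l\<^sup>2 / 8 * D) * (b s / s) + 4 * \<bar>r\<bar> * c3 * \<eta> * (b s / s)"
              by (simp only: distrib_right)
            moreover have "l\<^sup>2 / 8 * D * b s * (Cq / s) = (l\<^sup>2 / 8 * D * Cq) * (b s / s)" by simp
            ultimately show ?thesis by (rule trans[rotated])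
          qed
          moreover have "0 \<le> (l\<^sup>2 / 8 * D) * (b s / s)" using D bp sp by simp
          moreover have "2 * (c3 * \<bar>r\<bar> / s) * (\<eta> * (b s * 2)) = 4 * \<bar>r\<bar> * c3 * \<eta> * (b s / s)" by simp
          moreover have "0 \<le> \<bar>r\<bar> * c8 * z * S / 2" using c8 z0 S by simp
          ultimately show ?thesis by linarith
        qed
        have "2 * (c3 * \<bar>r\<bar> / s) * (c2 * (C7 * s powr r) + \<eta> * (b s * 2))
           = 2 * (c3 * \<bar>r\<bar> / s) * (c2 * (C7 * s powr r)) + 2 * (c3 * \<bar>r\<bar> / s) * (\<eta> * (b s * 2))"
          by (simp only: distrib_left)
        then show ?thesis using d t1 t2 g F0 by linarith
      next
        \<comment> \<open>On the bounded strip \<open>- 1 \<le> z < z1\<close>, where for negative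
          \<open>z\<close> the source has the wrong sign, all terms are at most a constant times
          \<open>b s / s\<close>. They are collected in \<open>C9\<close>; \<open>rhs\<close> is of
          order \<open>b s\<close> there.\<close>
        case False
        have zz: "z\<^sup>2 \<le> Q" "\<bar>z\<bar> \<le> z1" using K sp False z by (auto simp: Q z1_def)
        have Srb: "s powr r / s \<le> b s / s" using b_ge[OF s(1)] sp by (intro divide_right_mono) auto
        have bs: "0 < b s / s" using bp sp by simp
        have f: "- (1 / 4) * W * (z * X + \<eta> * (b s * (z * E))) \<le> (C7 + \<eta>) * (b s / s)"
        proof -
          have Y0: "0 \<le> X + \<eta> * (b s * E)" using Xp eta bp Ep by simp
          have "- 1 * (X + \<eta> * (b s * E)) \<le> z * (X + \<eta> * (b s * E))"
            using z Y0 by (intro mult_right_mono) auto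
          then have "1 / 4 * W * (- (z * (X + \<eta> * (b s * E)))) \<le> 1 / 4 * W * (X + \<eta> * (b s * E))"
            using W by (intro mult_left_mono) auto
          also have "\<dots> \<le> 1 * (1 / s) * (C7 * b s + \<eta> * (b s * 1))"
          proof (intro mult_mono)
            have "X \<le> C7 * b s" using X7(2) mult_left_mono[OF b_ge[OF s(1)], of C7] c7 by linarith
            then show "X + \<eta> * (b s * E) \<le> C7 * b s + \<eta> * (b s * 1)"
              using Ep eta bp by (intro add_mono mult_left_mono) auto
          qed (use W Y0 sp in auto)
          finally show ?thesis by (simp add: algebra_simps add_divide_distrib)
        qed
        define kk where "kk = \<bar>r\<bar> * \<bar>K - 2 - 4 * r\<bar> + \<bar>r\<bar> * \<bar>K - 6\<bar> * K"
        have kk: "0 \<le> kk" using K by (simp add: kk_def)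
        have g: "\<omega> * G \<le> 2 * (kk * C7 * (b s / s) + \<eta> * (cb + 2) * (b s / s))"
        proof (cases "0 \<le> z")
          case True
          have "0 \<le> \<bar>r\<bar> / 2 * (z * (X / Q))" using True Xp Qp by simp
          then have "G \<le> 0" using Gneg True by linarith
          then have "\<omega> * G \<le> 0" using om by (simp add: mult_nonneg_nonpos)
          moreover have "0 \<le> 2 * (kk * C7 * (b s / s) + \<eta> * (cb + 2) * (b s / s))"
            using kk c7 bs eta cb by (intro add_nonneg_nonneg mult_nonneg_nonneg) auto
          ultimately show ?thesis by (rule order_trans)
        next
          case False
          have za: "\<bar>z\<bar> \<le> 1" using False z by auto
          have "\<bar>r * (K - 2 - 4 * r) * z\<^sup>2 + r * (K * (K - 6)) * s\<bar> \<le> kk * Q"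
          proof -
            have "\<bar>r * (K - 2 - 4 * r) * z\<^sup>2\<bar> \<le> \<bar>r\<bar> * \<bar>K - 2 - 4 * r\<bar> * Q"
              using zz by (simp add: abs_mult mult_left_mono)
            moreover have "\<bar>r * (K * (K - 6)) * s\<bar> = \<bar>r\<bar> * \<bar>K - 6\<bar> * K * s"
              using K sp by (simp add: abs_mult)
            moreover have "\<bar>r\<bar> * \<bar>K - 6\<bar> * K * s \<le> \<bar>r\<bar> * \<bar>K - 6\<bar> * K * Q"
              using Qs K by (intro mult_left_mono) auto
            ultimately show ?thesis unfolding kk_def
              using abs_triangle_ineq[of "r * (K - 2 - 4 * r) * z\<^sup>2" "r * (K * (K - 6)) * s"]
              by (simp add: distrib_right)
          qed
          then have "\<bar>z\<bar> * X / Q\<^sup>2 * \<bar>r * (K - 2 - 4 * r) * z\<^sup>2 + r * (K * (K - 6)) * s\<bar> \<le> 1 * X / Q\<^sup>2 * (kk * Q)"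
            using za Xp Qp by (intro mult_mono divide_right_mono) auto
          also have "\<dots> = kk * (X / Q)" using Qp by (simp add: power2_eq_square)
          also have "\<dots> \<le> kk * (C7 * (b s / s))"
          proof -
            have "X / Q \<le> (C7 * s powr r) / s" using X7(2) Qs sp Xp by (intro frac_le) auto
            also have "\<dots> \<le> C7 * (b s / s)" using mult_left_mono[OF Srb, of C7] c7 by simp
            finally show ?thesis using kk by (intro mult_left_mono) auto
          qed
          finally have g1: "\<bar>z * X / Q\<^sup>2 * (r * (K - 2 - 4 * r) * z\<^sup>2 + r * (K * (K - 6)) * s)\<bar> \<le> kk * C7 * (b s / s)"
            using Xp by (simp add: abs_mult mult.assoc)
          have "\<bar>b' s + 3 / 2 * b s / s\<bar> \<le> (cb + 2) * (b s / s)"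
          proof -
            have "\<bar>3 / 2 * b s / s\<bar> = 3 / 2 * (b s / s)" using bp sp by simp
            then have "\<bar>b' s + 3 / 2 * b s / s\<bar> \<le> cb * (b s / s) + 3 / 2 * (b s / s)"
              using b'_abs[OF s(1)] abs_triangle_ineq[of "b' s" "3 / 2 * b s / s"] by simp
            also have "\<dots> \<le> cb * (b s / s) + 2 * (b s / s)" using bs by simp
            finally show ?thesis by (simp only: distrib_right)
          qed
          then have "\<eta> * \<bar>z\<bar> * E * \<bar>b' s + 3 / 2 * b s / s\<bar> \<le> \<eta> * 1 * 1 * ((cb + 2) * (b s / s))"
            using za Ep eta cb bs by (intro mult_mono) auto
          then have g2: "\<bar>\<eta> * z * E * (b' s + 3 / 2 * b s / s)\<bar> \<le> \<eta> * (cb + 2) * (b s / s)"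
            using eta Ep by (simp add: abs_mult mult.assoc)
          have G': "\<bar>G\<bar> \<le> kk * C7 * (b s / s) + \<eta> * (cb + 2) * (b s / s)"
            unfolding G_def using g1 g2 by linarith
          have "\<omega> * G \<le> \<omega> * \<bar>G\<bar>" using om by (intro mult_left_mono) auto
          also have "\<dots> \<le> 2 * (kk * C7 * (b s / s) + \<eta> * (cb + 2) * (b s / s))"
            using G' om by (intro mult_mono) auto
          finally show ?thesis .
        qed
        have d': "- (\<theta> * (\<omega> * R)) \<le> 2 * c3 * \<bar>r\<bar> * (c2 * C7 + 2 * \<eta>) * (b s / s)"
        proof -
          have "c2 * (C7 * s powr r) + \<eta> * (b s * 2) \<le> c2 * (C7 * b s) + \<eta> * (b s * 2)"
            using b_ge[OF s(1)] c2 c7 by (intro add_mono mult_left_mono order_refl) auto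
          then have "2 * (c3 * \<bar>r\<bar> / s) * (c2 * (C7 * s powr r) + \<eta> * (b s * 2))
              \<le> 2 * (c3 * \<bar>r\<bar> / s) * (c2 * (C7 * b s) + \<eta> * (b s * 2))"
            using c3 sp by (intro mult_left_mono) auto
          also have "\<dots> = 2 * c3 * \<bar>r\<bar> * (c2 * C7 + 2 * \<eta>) * (b s / s)" by (simp add: algebra_simps)
          finally show ?thesis using d by linarith
        qed
        have "(C7 + \<eta>) * (b s / s) + 2 * (kk * C7 * (b s / s) + \<eta> * (cb + 2) * (b s / s))
            + 2 * c3 * \<bar>r\<bar> * (c2 * C7 + 2 * \<eta>) * (b s / s) = C9 * (b s / s)"
          unfolding C9_def kk_def[symmetric] by (simp only: distrib_right distrib_left mult.assoc)
        moreover have "C9 * (b s / s) \<le> rhs"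
        proof -
          have "8 * C9 * exp (l / 2 * z1) \<le> s * (l\<^sup>2 * D)"
            using s(5) l_pos D by (simp add: pos_divide_le_eq)
          then have "C9 * exp (l / 2 * z1) * exp (- (l / 2 * z1)) \<le> s * (l\<^sup>2 * D) / 8 * exp (- (l / 2 * z1))"
            by (intro mult_right_mono) auto
          then have "C9 \<le> s * (l\<^sup>2 * D) / 8 * exp (- (l / 2 * z1))"
            by (simp add: mult.assoc exp_add[symmetric])
          also have "\<dots> \<le> s * (l\<^sup>2 * D) / 8 * exp (- (l / 2) * z)"
            using False l_pos D sp by (intro mult_left_mono) auto
          finally have "C9 * (b s / s) \<le> s * (l\<^sup>2 * D) / 8 * exp (- (l / 2) * z) * (b s / s)"
            using bs by (intro mult_right_mono) auto
          also have "\<dots> = rhs" using sp by (simp add: rhs_def)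
          finally show ?thesis .
        qed
        moreover have "- (1 / 4) * W * (z * X + \<eta> * (b s * (z * E))) + \<omega> * G - \<theta> * (\<omega> * R) =
           - (1 / 4) * W * (z * X + \<eta> * (b s * (z * E))) + \<omega> * G + - (\<theta> * (\<omega> * R))" by simp
        ultimately show ?thesis using f g d' by linarith
      qed
    qed
    then show "- (1 / 4) * s powr (- (5 / 4)) * (z * X + \<eta> * (b s * (z * E)))
      + (1 + s powr (- (1 / 4))) *
         (z * X / Q\<^sup>2 * (r * (K - 2 - 4 * r) * z\<^sup>2 + r * (K * (K - 6)) * s)
           + \<eta> * z * E * (b' s + 3 / 2 * b s / s))
      - b' s / (l * b s) * ((1 + s powr (- (1 / 4))) *
         (X * (1 + 2 * r * z\<^sup>2 / Q) + \<eta> * (b s * ((1 - z\<^sup>2 / (2 * s)) * E))))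
      \<le> l\<^sup>2 / 8 * D * b s * exp (- (l / 2) * z)"
      unfolding \<omega>_def R_def \<theta>_def W_def G_def rhs_def .
  qed
  moreover have "s0 \<le> T" by (simp add: T_def)
  ultimately show ?thesis using that[of \<eta> D T] eta D eta4 by auto
qed


text \<open>The domain starts at \<open>- 1\<close> because the exponential term is positive at 0:
  the boundary has to lie where the odd profiles are negative enough to outweigh it. The base
  \<open>z + 2\<close> keeps the initial power bounded away from 0 on this domain. The growth rate
  \<open>l / 8\<close> lies below \<open>l / 4\<close>, so that the square of
  \<open>exp (- l * z) * H / b\<close> decays faster than \<open>exp (- (3 / 2) * l * z)\<close>,
  the rate of the reserve left by the operator.\<close>

lemma lower_barrier:
  obtains T D C H Hs Hz Hzz where
    "s0 \<le> T" "0 < D" "0 < C"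
    "has_partials T UNIV H Hs Hz Hzz"
    "\<And>s z. T < s \<Longrightarrow> - 1 < z \<Longrightarrow>
       Hs s z - Hzz s z - b' s / (l * b s) * Hz s z \<le> - (D * b s * exp (- (l / 2) * z))"
    "continuous_on ({T..} \<times> UNIV) (\<lambda>(s, z). H s z)"
    "\<And>s. T \<le> s \<Longrightarrow> H s (- 1) \<le> 0"
    "\<And>s z. T \<le> s \<Longrightarrow> 0 \<le> z \<Longrightarrow> D * b s * exp (- (l / 2) * z) \<le> H s z"
    "\<And>s z. T \<le> s \<Longrightarrow> - 1 \<le> z \<Longrightarrow> H s z \<le> C * b s * exp (l / 8 * z)"
    "\<And>z. - 1 \<le> z \<Longrightarrow> H T z \<le> C * (z + 2) powr (2 * r + 1)"
proof -
  obtain \<eta> D0 T0 where eta: "0 \<le> \<eta>" and D0: "0 < D0" and T0: "s0 \<le> T0" and ok: "lower_ok \<eta> D0 T0"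
    and left: "\<And>s. T0 \<le> s \<Longrightarrow> D0 * exp (l / 2) * b s \<le> ((- 1)\<^sup>2 + K * s) powr r + \<eta> * b s * exp (- (- 1)\<^sup>2 / (4 * s))"
    using lower_drift by metis
  \<comment> \<open>On \<open>b s * exp (- l * z / 2)\<close> the operator gives the coefficient
    \<open>3 / 2 * b' s - l\<^sup>2 / 4 * b s\<close>, and
    \<open>24 * cb / l\<^sup>2 \<le> s\<close> brings it below
    \<open>- 3 / 16 * l\<^sup>2 * b s\<close>. Of these three sixteenths, two pay for the right-hand
    side of \<open>lower_ok\<close> and one is the reserve recorded in \<open>D\<close>.\<close>
  define T where "T = max T0 (24 * cb / l\<^sup>2)"
  have T: "s0 \<le> T" "T0 \<le> T" "24 * cb / l\<^sup>2 \<le> T" using T0 by (auto simp: T_def)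
  have Tp: "0 < T" "1 \<le> T" using T s0 by auto
  define D where "D = min D0 (l\<^sup>2 / 16 * D0)"
  have D: "0 < D" "D \<le> D0" "D \<le> l\<^sup>2 / 16 * D0" using D0 l_pos by (auto simp: D_def)
  define \<omega> where "\<omega> = (\<lambda>s::real. 1 + s powr (- (1 / 4)))"
  define F where "F = (\<lambda>s z. z * (z\<^sup>2 + K * s) powr r + \<eta> * (b s * (z * exp (- z\<^sup>2 / (4 * s)))))"
  define Fs where "Fs = (\<lambda>s z. r * K * z * ((z\<^sup>2 + K * s) powr r / (z\<^sup>2 + K * s)) +
     \<eta> * (b' s * (z * exp (- z\<^sup>2 / (4 * s))) + b s * (z ^ 3 / (4 * s\<^sup>2) * exp (- z\<^sup>2 / (4 * s)))))"
  define Fz where "Fz = (\<lambda>s z. (z\<^sup>2 + K * s) powr r * (1 + 2 * r * z\<^sup>2 / (z\<^sup>2 + K * s)) +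
     \<eta> * (b s * ((1 - z\<^sup>2 / (2 * s)) * exp (- z\<^sup>2 / (4 * s)))))"
  define Fzz where "Fzz = (\<lambda>s z. (z\<^sup>2 + K * s) powr r * (6 * r * z / (z\<^sup>2 + K * s) + 4 * r * (r - 1) * z ^ 3 / (z\<^sup>2 + K * s)\<^sup>2) +
     \<eta> * (b s * ((z ^ 3 / (4 * s\<^sup>2) - 3 * z / (2 * s)) * exp (- z\<^sup>2 / (4 * s)))))"
  define e where "e = (\<lambda>z. exp (- (l / 2) * z))"
  have bd: "(b has_real_derivative b' s) (at s)" if "T < s" for s using b_deriv[of s] T that by simp
  note g = b_gauss_partials[OF T(1)]
  have hF: "has_partials T UNIV F Fs Fz Fzz"
    unfolding F_def Fs_def Fz_def Fzz_def
    by (rule has_partials_add[OF has_partials_mono[OF has_partials_powr] has_partials_cmult[OF g]])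
       (use Tp K in auto)
  have om: "(\<omega> has_real_derivative - (1 / 4) * s powr (- (5 / 4))) (at s)" if "T < s" for s
    unfolding \<omega>_def
    by (rule DERIV_cong[OF DERIV_add[OF DERIV_const has_real_derivative_powr]]) (use that Tp in auto)
  have he: "has_partials T UNIV (\<lambda>s. e) (\<lambda>s z. 0) (\<lambda>s z. - (l / 2) * e z) (\<lambda>s z. (l / 2)\<^sup>2 * e z)"
    unfolding has_partials_def e_def by (auto intro!: derivative_eq_intros simp: power2_eq_square)
  define H where "H = (\<lambda>s z. \<omega> s * F s z + D0 * (b s * e z))"
  have hH: "has_partials T UNIV H
      (\<lambda>s z. (- (1 / 4) * s powr (- (5 / 4)) * F s z + \<omega> s * Fs s z) + D0 * (b' s * e z + b s * 0))
      (\<lambda>s z. \<omega> s * Fz s z + D0 * (b s * (- (l / 2) * e z)))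
      (\<lambda>s z. \<omega> s * Fzz s z + D0 * (b s * ((l / 2)\<^sup>2 * e z)))"
    unfolding H_def
    by (rule has_partials_add[OF has_partials_timescale[OF hF om] has_partials_cmult[OF has_partials_timescale[OF he bd]]])
  have om1: "1 \<le> \<omega> s" "\<omega> s \<le> 2" if "T \<le> s" for s
    using that Tp by (auto simp: \<omega>_def powr_minus inverse_le_1_iff ge_one_powr_ge_zero)
  have bp: "0 < b s" if "T \<le> s" for s using b_pos[of s] T that by simp
  have Fge: "0 \<le> F s z" if "T \<le> s" "0 \<le> z" for s z
    using that eta bp[of s] by (simp add: F_def)
  have Fle: "F s z \<le> 0" if "T \<le> s" "z \<le> 0" for s z
  proof -
    have "z * (z\<^sup>2 + K * s) powr r \<le> 0" using that by (simp add: mult_nonpos_nonneg)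
    moreover have "z * exp (- z\<^sup>2 / (4 * s)) \<le> 0" using that by (simp add: mult_nonpos_nonneg)
    then have "\<eta> * (b s * (z * exp (- z\<^sup>2 / (4 * s)))) \<le> 0"
      by (rule mult_nonneg_nonpos[OF eta mult_nonneg_nonpos[OF less_imp_le[OF bp[OF that(1)]]]])
    ultimately show ?thesis by (simp add: F_def)
  qed
  have Hpos: "H s z \<le> 2 * F s z + D0 * (b s * e z)" if "T \<le> s" "0 \<le> z" for s z
    using mult_right_mono[OF om1(2) Fge] that by (simp add: H_def)
  have Hneg: "H s z \<le> D0 * b s * exp (l / 2)" if "T \<le> s" "- 1 \<le> z" "z \<le> 0" for s z
  proof -
    have "\<omega> s * F s z \<le> 0" using Fle[OF that(1,3)] om1[OF that(1)] by (simp add: mult_nonneg_nonpos)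
    moreover have "l * (- 1) \<le> l * z" using that l_pos by (intro mult_left_mono) auto
    then have "e z \<le> exp (l / 2)" by (simp add: e_def)
    then have "D0 * (b s * e z) \<le> D0 * (b s * exp (l / 2))"
      using D0 bp[OF that(1)] by simp
    ultimately show ?thesis by (simp add: H_def)
  qed
  obtain C5 where C5: "0 < C5" "\<And>s z. 1 \<le> s \<Longrightarrow> 0 \<le> z \<Longrightarrow> (K + z\<^sup>2 / s) powr r \<le> C5 * exp (l / 16 * z)"
    by (rule powr_quadratic_le_exp[of K "l / 16" r]) (use l_pos K in auto)
  obtain C6 where C6: "0 < C6" "\<And>x. 0 \<le> x \<Longrightarrow> (1 + x) powr 1 \<le> C6 * exp (l / 16 * x)"
    by (rule powr_le_exp[of "l / 16" 1 1]) (use l_pos in auto)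
  obtain C11 c11 where C11: "0 < c11" "\<And>x. 1 \<le> x \<Longrightarrow> x \<le> 2 \<Longrightarrow> c11 \<le> x powr (2 * r + 1) \<and> x powr (2 * r + 1) \<le> C11"
    using powr_bounds[of 1 2 "2 * r + 1"] by (metis zero_less_one)
  obtain C12 c12 where C12: "0 < C12" "\<And>x. 1 / 8 \<le> x \<Longrightarrow> x \<le> 1 + K * T \<Longrightarrow> c12 \<le> x powr r \<and> x powr r \<le> C12"
    using powr_bounds[of "1 / 8" "1 + K * T" r] by (metis zero_less_divide_1_iff zero_less_numeral)
  obtain C13 where C13: "0 < C13" "\<And>x. 0 \<le> x \<Longrightarrow> (2 + x) powr (- (2 * r + 1)) \<le> C13 * exp (l / 2 * x)"
    by (rule powr_le_exp[of "l / 2" 2 "- (2 * r + 1)"]) (use l_pos in auto)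
  define C1 where "C1 = D0 * exp (l / 2) * exp (l / 8) + 2 * (C6 * C5 + \<eta> * C6) + D0"
  define C2 where "C2 = D0 * b T * exp (l / 2) / c11 + 2 * (C12 + \<eta> * b T * C6 * exp (T * l\<^sup>2) * C13) + D0 * b T * C13"
  have C1: "0 < C1" "D0 * exp (l / 2) * exp (l / 8) \<le> C1" "2 * (C6 * C5 + \<eta> * C6) + D0 \<le> C1"
    using D0 C5 C6 eta by (auto simp: C1_def add_pos_nonneg)
  have C2: "0 < C2" "D0 * b T * exp (l / 2) / c11 \<le> C2"
    "2 * (C12 + \<eta> * b T * C6 * exp (T * l\<^sup>2) * C13) + D0 * b T * C13 \<le> C2"
    using D0 C12 C6 C11 C13 eta bp[of T] by (auto simp: C2_def intro!: add_pos_nonneg add_nonneg_nonneg mult_nonneg_nonneg)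
  have sum_mono: "h \<le> 2 * (a' + c') + d'" if "h \<le> 2 * (a + c) + d" "a \<le> a'" "c \<le> c'" "d \<le> d'"
    for h a a' c c' d d' :: real using that by simp
  show ?thesis
  proof (rule that[OF T(1) D(1) _ hH])
    show "0 < C1 + C2" using C1 C2 by simp
    fix s :: real assume s: "T \<le> s"
    define Y where "Y = ((- 1)\<^sup>2 + K * s) powr r + \<eta> * b s * exp (- (- 1)\<^sup>2 / (4 * s))"
    have "H s (- 1) = - (\<omega> s * Y) + D0 * exp (l / 2) * b s"
      by (simp add: H_def F_def e_def Y_def algebra_simps)
    moreover have "D0 * exp (l / 2) * b s \<le> Y"
      unfolding Y_def by (rule left) (use s T in simp)
    moreover have "0 \<le> Y" using eta bp[OF s] by (simp add: Y_def)
    then have "1 * Y \<le> \<omega> s * Y" using om1[OF s] by (intro mult_right_mono) auto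
    ultimately show "H s (- 1) \<le> 0" by linarith
  next
    fix s z :: real assume s: "T \<le> s" and z: "0 \<le> z"
    have "0 \<le> \<omega> s * F s z" using Fge[OF s z] om1[OF s] by simp
    moreover have "D * (b s * e z) \<le> D0 * (b s * e z)" using D bp[OF s] by (intro mult_right_mono) (auto simp: e_def)
    ultimately show "D * b s * exp (- (l / 2) * z) \<le> H s z" by (simp add: H_def e_def)
  next
    fix s z :: real assume s: "T \<le> s" and z: "- 1 \<le> z"
    have eC: "x \<le> (C1 + C2) * b s * exp (l / 8 * z)" if "x \<le> C1 * b s * exp (l / 8 * z)" for x
      using that C2(1) bp[OF s] by (simp add: distrib_right add_increasing2)
    show "H s z \<le> (C1 + C2) * b s * exp (l / 8 * z)"
    proof (rule eC, cases "0 \<le> z")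
      case True
      have sp: "0 < s" "1 \<le> s" using s Tp by auto
      have ee: "exp (l / 16 * z) * exp (l / 16 * z) = exp (l / 8 * z)" by (simp add: exp_add[symmetric])
      have zC: "z \<le> C6 * exp (l / 16 * z)" using C6(2)[OF True] True by simp
      have f1: "z * (z\<^sup>2 + K * s) powr r \<le> C6 * C5 * b s * exp (l / 8 * z)"
      proof -
        have "(z\<^sup>2 + K * s) powr r = s powr r * (K + z\<^sup>2 / s) powr r"
          by (rule powr_quadratic_scale) (use sp K in auto)
        also have "\<dots> \<le> b s * (C5 * exp (l / 16 * z))"
          using b_ge[of s] C5(2)[OF sp(2) True] s T bp[OF s] by (intro mult_mono) auto
        finally have "z * (z\<^sup>2 + K * s) powr r \<le> (C6 * exp (l / 16 * z)) * (b s * (C5 * exp (l / 16 * z)))"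
          using zC True C6 by (intro mult_mono) auto
        also have "\<dots> = C6 * C5 * b s * (exp (l / 16 * z) * exp (l / 16 * z))" by (simp only: mult_ac)
        finally show ?thesis unfolding ee .
      qed
      have e16: "exp (l / 16 * z) \<le> exp (l / 8 * z)" using True l_pos by simp
      have "z * exp (- z\<^sup>2 / (4 * s)) \<le> (C6 * exp (l / 8 * z)) * 1"
        using zC e16 C6 True sp by (intro mult_mono) (auto intro: order_trans[OF zC] mult_left_mono)
      then have f2: "\<eta> * (b s * (z * exp (- z\<^sup>2 / (4 * s)))) \<le> \<eta> * (b s * (C6 * exp (l / 8 * z)))"
        using eta bp[OF s] by (intro mult_left_mono) auto
      have "e z \<le> exp (l / 8 * z)" using True l_pos by (simp add: e_def)
      then have f3: "D0 * (b s * e z) \<le> D0 * (b s * exp (l / 8 * z))" using D0 bp[OF s] by (intro mult_left_mono) auto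
      have "H s z \<le> 2 * (C6 * C5 * b s * exp (l / 8 * z) + \<eta> * (b s * (C6 * exp (l / 8 * z)))) + D0 * (b s * exp (l / 8 * z))"
        using sum_mono[OF Hpos[OF s True, unfolded F_def] f1 f2 f3] .
      also have "\<dots> = (2 * (C6 * C5 + \<eta> * C6) + D0) * (b s * exp (l / 8 * z))" by (simp add: algebra_simps)
      also have "\<dots> \<le> C1 * (b s * exp (l / 8 * z))" using C1 bp[OF s] by (intro mult_right_mono) auto
      finally show "H s z \<le> C1 * b s * exp (l / 8 * z)" by (simp add: mult.assoc)
    next
      case False
      have "l * (- 1) \<le> l * z" using z l_pos by (intro mult_left_mono) auto
      then have "1 \<le> exp (l / 8) * exp (l / 8 * z)" by (simp add: exp_add[symmetric])
      then have "D0 * b s * exp (l / 2) * 1 \<le> D0 * b s * exp (l / 2) * (exp (l / 8) * exp (l / 8 * z))"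
        using D0 bp[OF s] by (intro mult_left_mono) auto
      also have "\<dots> = D0 * exp (l / 2) * exp (l / 8) * (b s * exp (l / 8 * z))" by (simp only: mult_ac)
      also have "\<dots> \<le> C1 * (b s * exp (l / 8 * z))" using C1 bp[OF s] by (intro mult_right_mono) auto
      finally show "H s z \<le> C1 * b s * exp (l / 8 * z)" using Hneg[OF s z] False by (simp add: mult.assoc)
    qed
  next
    fix z :: real assume z: "- 1 \<le> z"
    define P where "P = (z + 2) powr (2 * r + 1)"
    have P: "0 < P" using z by (simp add: P_def)
    have bT: "0 < b T" using bp[of T] by simp
    have "H T z \<le> C2 * P"
    proof (cases "0 \<le> z")
      case False
      have "c11 \<le> P" using C11(2)[of "z + 2"] False z by (simp add: P_def)
      then have "D0 * b T * exp (l / 2) / c11 * c11 \<le> D0 * b T * exp (l / 2) / c11 * P"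
        using D0 bT C11 by (intro mult_left_mono) auto
      also have "\<dots> \<le> C2 * P" using C2 P by (intro mult_right_mono) auto
      finally show ?thesis using Hneg[of T z] False z C11 by simp
    next
      case True
      have f1: "z * (z\<^sup>2 + K * T) powr r \<le> C12 * P"
      proof -
        have KT: "1 * 1 \<le> K * T" using K Tp by (intro mult_mono) auto
        have z2: "0 < (z + 2)\<^sup>2" "1 \<le> (z + 2)\<^sup>2" "z\<^sup>2 \<le> (z + 2)\<^sup>2" using True by (auto simp: one_le_power)
        have "K * T * 1 \<le> K * T * (z + 2)\<^sup>2" using KT z2 by (intro mult_left_mono) auto
        then have u: "z\<^sup>2 + K * T \<le> (1 + K * T) * (z + 2)\<^sup>2" using z2 by (simp add: algebra_simps)
        have "0 \<le> (z - 2)\<^sup>2" by simp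
        then have w: "(z + 2)\<^sup>2 \<le> 8 * (z\<^sup>2 + K * T)"
        proof -
          have "(z + 2)\<^sup>2 = z\<^sup>2 + 4 * z + 4" "(z - 2)\<^sup>2 = z\<^sup>2 - 4 * z + 4"
            by (simp_all add: power2_eq_square algebra_simps)
          moreover have "8 * (z\<^sup>2 + K * T) = 8 * z\<^sup>2 + 8 * (K * T)" by simp
          moreover have "0 \<le> z\<^sup>2" by simp
          ultimately show ?thesis using KT \<open>0 \<le> (z - 2)\<^sup>2\<close> by linarith
        qed
        define x where "x = (z\<^sup>2 + K * T) / (z + 2)\<^sup>2"
        have "1 / 8 \<le> x" "x \<le> 1 + K * T" using u w z2 by (simp_all add: x_def le_divide_eq divide_le_eq)
        then have xr: "x powr r \<le> C12" "0 < x" using C12(2)[of x] by auto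
        have "z\<^sup>2 + K * T = (z + 2) powr 2 * x" using z2 True by (simp add: x_def)
        then have "(z\<^sup>2 + K * T) powr r = ((z + 2) powr 2 * x) powr r" by (simp only:)
        also have "\<dots> = ((z + 2) powr 2) powr r * x powr r" by (rule powr_mult)
        also have "\<dots> = (z + 2) powr (2 * r) * x powr r" by (simp only: powr_powr)
        also have "\<dots> \<le> (z + 2) powr (2 * r) * C12" using xr by (intro mult_left_mono) auto
        finally have "z * (z\<^sup>2 + K * T) powr r \<le> (z + 2) * ((z + 2) powr (2 * r) * C12)"
          using True by (intro mult_mono) auto
        also have "\<dots> = C12 * P" using True by (simp add: P_def powr_add)
        finally show ?thesis .
      qed
      have f3: "e z \<le> C13 * P"
      proof -
        have "(2 + z) powr (- (2 * r + 1)) * P \<le> C13 * exp (l / 2 * z) * P"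
          using C13(2)[OF True] P by (intro mult_right_mono) auto
        moreover have "(2 + z) powr (- (2 * r + 1)) * P = 1"
          unfolding P_def using True by (simp add: powr_add[symmetric] add.commute)
        ultimately have "1 * e z \<le> C13 * exp (l / 2 * z) * P * e z" by (intro mult_right_mono) (auto simp: e_def)
        also have "\<dots> = C13 * P * (exp (l / 2 * z) * e z)" by simp
        also have "exp (l / 2 * z) * e z = 1" by (simp add: e_def exp_add[symmetric])
        finally show ?thesis by simp
      qed
      have f2: "z * exp (- z\<^sup>2 / (4 * T)) \<le> C6 * exp (T * l\<^sup>2) * (C13 * P)"
      proof -
        have "z \<le> C6 * exp (l / 2 * z)"
        proof -
          have "z \<le> C6 * exp (l / 16 * z)" using C6(2)[OF True] True by simp
          also have "\<dots> \<le> C6 * exp (l / 2 * z)" using C6 True l_pos by (intro mult_left_mono) auto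
          finally show ?thesis .
        qed
        moreover have "exp (- z\<^sup>2 / (4 * T)) \<le> exp (T * l\<^sup>2) * exp (- (l * z))"
        proof -
          have "0 \<le> (z - 2 * T * l)\<^sup>2" by simp
          then have "4 * T * (l * z) \<le> z\<^sup>2 + 4 * T * (T * l\<^sup>2)" by (simp add: power2_eq_square algebra_simps)
          then have "l * z \<le> z\<^sup>2 / (4 * T) + T * l\<^sup>2" using Tp by (simp add: field_simps)
          then show ?thesis by (simp add: exp_add[symmetric])
        qed
        ultimately have "z * exp (- z\<^sup>2 / (4 * T)) \<le> (C6 * exp (l / 2 * z)) * (exp (T * l\<^sup>2) * exp (- (l * z)))"
          using True C6 by (intro mult_mono) auto
        also have "\<dots> = C6 * exp (T * l\<^sup>2) * (exp (l / 2 * z) * exp (- (l * z)))" by (simp only: mult_ac)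
        also have "exp (l / 2 * z) * exp (- (l * z)) = e z" by (simp add: e_def exp_add[symmetric])
        also have "C6 * exp (T * l\<^sup>2) * e z \<le> C6 * exp (T * l\<^sup>2) * (C13 * P)"
          using f3 C6 by (intro mult_left_mono) auto
        finally show ?thesis .
      qed
      have "\<eta> * (b T * (z * exp (- z\<^sup>2 / (4 * T)))) \<le> \<eta> * (b T * (C6 * exp (T * l\<^sup>2) * (C13 * P)))"
        using f2 eta bT by (intro mult_left_mono) auto
      moreover have "D0 * (b T * e z) \<le> D0 * (b T * (C13 * P))" using f3 D0 bT by (intro mult_left_mono) auto
      ultimately have "H T z \<le> 2 * (C12 * P + \<eta> * (b T * (C6 * exp (T * l\<^sup>2) * (C13 * P)))) + D0 * (b T * (C13 * P))"
        using sum_mono[OF Hpos[OF order_refl True, unfolded F_def] f1] by blast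
      also have "\<dots> = (2 * (C12 + \<eta> * b T * C6 * exp (T * l\<^sup>2) * C13) + D0 * b T * C13) * P"
        by (simp add: algebra_simps)
      also have "\<dots> \<le> C2 * P" using C2 P by (intro mult_right_mono) auto
      finally show ?thesis .
    qed
    then show "H T z \<le> (C1 + C2) * (z + 2) powr (2 * r + 1)"
      using C1 P by (simp add: P_def distrib_right add_increasing)
  next
    note c1 = b_fst_continuous[OF T(1) order_refl]
    have "\<And>p. p \<in> {T..} \<times> UNIV \<Longrightarrow> (snd p)\<^sup>2 + K * fst p \<noteq> 0 \<and> fst p \<noteq> 0"
    proof -
      fix p assume "p \<in> {T..} \<times> (UNIV :: real set)"
      then have "0 < fst p" using Tp by auto
      then have "0 < fst p" "0 < K * fst p" using K by auto
      then show "(snd p)\<^sup>2 + K * fst p \<noteq> 0 \<and> fst p \<noteq> 0" using zero_le_power2[of "snd p"] by linarith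
    qed
    then show "continuous_on ({T..} \<times> UNIV) (\<lambda>(s, z). H s z)"
      unfolding H_def F_def \<omega>_def e_def case_prod_beta by (auto intro!: continuous_intros c1)
  next
    fix s z :: real assume s: "T < s" and z: "- 1 < z"
    have sp: "0 < s" using s Tp by auto
    have bs: "0 < b s" using bp s by simp
    define Q X E where "Q = z\<^sup>2 + K * s" and "X = Q powr r" and "E = exp (- z\<^sup>2 / (4 * s))"
    have Q0: "Q \<noteq> 0" using sp K by (simp add: Q_def) (smt (verit) mult_pos_pos zero_le_power2)
    define \<theta> where "\<theta> = b' s / (l * b s)"
    have F1: "F s z = z * X + \<eta> * (b s * (z * E))"
      unfolding F_def Q_def[symmetric] E_def[symmetric] X_def[symmetric] ..
    have F2: "Fz s z = X * (1 + 2 * r * z\<^sup>2 / Q) + \<eta> * (b s * ((1 - z\<^sup>2 / (2 * s)) * E))"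
      unfolding Fz_def Q_def[symmetric] E_def[symmetric] X_def[symmetric] ..
    have "Fs s z - Fzz s z = (r * K * z * (X / Q) - X * (6 * r * z / Q + 4 * r * (r - 1) * z ^ 3 / Q\<^sup>2))
       + \<eta> * (b' s * (z * E) + b s * (z ^ 3 / (4 * s\<^sup>2) * E) - b s * ((z ^ 3 / (4 * s\<^sup>2) - 3 * z / (2 * s)) * E))"
      unfolding Fs_def Fzz_def Q_def[symmetric] E_def[symmetric] X_def[symmetric]
      by (simp add: right_diff_distrib)
    also have "b' s * (z * E) + b s * (z ^ 3 / (4 * s\<^sup>2) * E) - b s * ((z ^ 3 / (4 * s\<^sup>2) - 3 * z / (2 * s)) * E)
       = z * E * (b' s + 3 / 2 * b s / s)"
      using sp by (simp add: algebra_simps)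
    also have "r * K * z * (X / Q) - X * (6 * r * z / Q + 4 * r * (r - 1) * z ^ 3 / Q\<^sup>2)
       = z * X / Q\<^sup>2 * (r * (K - 6) * Q - 4 * r * (r - 1) * z\<^sup>2)"
      using Q0 by (simp add: field_simps power2_eq_square power3_eq_cube)
    also have "r * (K - 6) * Q - 4 * r * (r - 1) * z\<^sup>2 = r * (K - 2 - 4 * r) * z\<^sup>2 + r * (K * (K - 6)) * s"
      by (simp add: Q_def algebra_simps)
    finally have G: "Fs s z - Fzz s z = z * X / Q\<^sup>2 * (r * (K - 2 - 4 * r) * z\<^sup>2 + r * (K * (K - 6)) * s)
           + \<eta> * z * E * (b' s + 3 / 2 * b s / s)" by (simp add: mult.assoc)
    have 1: "- (1 / 4) * s powr (- (5 / 4)) * F s z + \<omega> s * (Fs s z - Fzz s z) - \<theta> * (\<omega> s * Fz s z)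
        \<le> l\<^sup>2 / 8 * D0 * b s * e z"
      unfolding F1 F2 G \<omega>_def e_def \<theta>_def
      using ok[unfolded lower_ok_def, rule_format, OF _ _ Q_def X_def E_def] s z T by simp
    have "b' s - (l / 2)\<^sup>2 * b s + \<theta> * (l / 2) * b s \<le> - (3 * l\<^sup>2 / 16) * b s"
    proof -
      have "\<theta> * (l / 2) * b s = b' s / 2" using l_pos bs by (simp add: \<theta>_def)
      moreover have "b' s \<le> cb * b s / s" using b'_abs[of s] s T by simp
      moreover have "24 * (cb * b s / s) \<le> l\<^sup>2 * b s"
      proof -
        have "24 * cb \<le> l\<^sup>2 * T" using T(3) l_pos by (simp add: pos_divide_le_eq mult.commute)
        also have "\<dots> \<le> l\<^sup>2 * s" using s by (intro mult_left_mono) auto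
        finally have "24 * cb * b s \<le> l\<^sup>2 * s * b s" using bs by (intro mult_right_mono) auto
        then show ?thesis using sp by (simp add: field_simps)
      qed
      moreover have "(l / 2)\<^sup>2 * b s = l\<^sup>2 * b s / 4" by (simp add: power2_eq_square)
      moreover have "- (3 * l\<^sup>2 / 16) * b s = - (3 / 16 * (l\<^sup>2 * b s))" by simp
      ultimately show ?thesis by linarith
    qed
    then have "D0 * e z * (b' s - (l / 2)\<^sup>2 * b s + \<theta> * (l / 2) * b s) \<le> D0 * e z * (- (3 * l\<^sup>2 / 16) * b s)"
      using D0 by (intro mult_left_mono) (auto simp: e_def)
    then have 2: "D0 * (b' s * e z) - D0 * (b s * ((l / 2)\<^sup>2 * e z)) - \<theta> * (D0 * (b s * (- (l / 2) * e z)))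
        \<le> - (3 / 16 * (l\<^sup>2 * D0 * b s * e z))"
      by (simp add: algebra_simps)
    have "D * (b s * e z) \<le> l\<^sup>2 / 16 * D0 * (b s * e z)"
      using D(3) bs by (intro mult_right_mono) (auto simp: e_def)
    then have 3: "D * b s * e z \<le> l\<^sup>2 * D0 * b s * e z / 16" by (simp add: mult_ac)
    have "(- (1 / 4) * s powr (- (5 / 4)) * F s z + \<omega> s * Fs s z) + D0 * (b' s * e z + b s * 0) -
        (\<omega> s * Fzz s z + D0 * (b s * ((l / 2)\<^sup>2 * e z))) - \<theta> * (\<omega> s * Fz s z + D0 * (b s * (- (l / 2) * e z)))
      = (- (1 / 4) * s powr (- (5 / 4)) * F s z + \<omega> s * (Fs s z - Fzz s z) - \<theta> * (\<omega> s * Fz s z))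
       + (D0 * (b' s * e z) - D0 * (b s * ((l / 2)\<^sup>2 * e z)) - \<theta> * (D0 * (b s * (- (l / 2) * e z))))"
      by (simp only: distrib_left right_diff_distrib mult_zero_right)
    also have "\<dots> \<le> - (D * b s * e z)" using 1 2 3 by linarith
    finally show "(- (1 / 4) * s powr (- (5 / 4)) * F s z + \<omega> s * Fs s z) + D0 * (b' s * e z + b s * 0) -
        (\<omega> s * Fzz s z + D0 * (b s * ((l / 2)\<^sup>2 * e z))) -
        b' s / (l * b s) * (\<omega> s * Fz s z + D0 * (b s * (- (l / 2) * e z))) \<le> - (D * b s * exp (- (l / 2) * z))"
      by (simp only: \<theta>_def e_def)
  qed
qed

end

section \<open>The position of the front\<close>

context rate
begin

lemma drift_bound: "s0 \<le> s \<Longrightarrow> \<bar>b' s / (l * b s)\<bar> \<le> cb / l"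
proof -
  assume s: "s0 \<le> s"
  have bp: "0 < b s" "1 \<le> s" using b_pos[OF s] s s0 by auto
  have "\<bar>b' s\<bar> \<le> cb * b s / s" by (rule b'_abs[OF s])
  also have "\<dots> \<le> cb * b s / 1" using bp cb by (intro divide_left_mono) auto
  finally have "\<bar>b' s\<bar> / (l * b s) \<le> cb * b s / (l * b s)"
    using bp l_pos by (intro divide_right_mono) auto
  then show ?thesis using bp l_pos by (simp add: abs_mult)
qed

lemma ln_b_deriv:
  assumes "s0 \<le> s"
  shows "((\<lambda>s. ln (b s) / l) has_real_derivative b' s / (l * b s)) (at s)"
  using b_deriv[OF assms] b_pos[OF assms] l_pos
  by (auto intro!: derivative_eq_intros simp: field_simps)

text \<open>Shifts of time, both the \<open>T\<close> of the barriers and the waiting time of the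
  growing bump, thus change the logarithmic correction by a bounded amount.\<close>

lemma ln_b_lipschitz:
  assumes "s0 \<le> s" "s0 \<le> s'"
  shows "\<bar>ln (b s) / l - ln (b s') / l\<bar> \<le> cb / l * \<bar>s - s'\<bar>"
proof -
  have "norm (ln (b s) / l - ln (b s') / l) \<le> cb / l * norm (s - s')"
  proof (rule field_differentiable_bound[of "{s0..}" "\<lambda>s. ln (b s) / l" "\<lambda>s. b' s / (l * b s)"])
    show "convex {s0..}" by simp
  qed (use ln_b_deriv drift_bound assms in \<open>auto intro: has_field_derivative_at_within\<close>)
  then show ?thesis by simp
qed

lemma frame_deriv:
  assumes "s0 \<le> T" "T < s"
  shows "((\<lambda>s. 2 * l * (s - T) + ln (b s) / l + x0) has_real_derivative 2 * l + b' s / (l * b s)) (at s)"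
  by (rule DERIV_cong[OF DERIV_add[OF DERIV_add[OF _ ln_b_deriv] DERIV_const]])
     (use assms in \<open>auto intro!: derivative_eq_intros\<close>)

lemma frame_speed_bound:
  assumes "s0 \<le> s"
  shows "\<bar>2 * l + b' s / (l * b s)\<bar> \<le> 2 * l + cb / l"
  using drift_bound[OF assms] l_pos by (intro order_trans[OF abs_triangle_ineq]) auto

lemma frame_continuous:
  assumes "s0 \<le> T"
  shows "continuous_on {T..} (\<lambda>s. 2 * l * (s - T) + ln (b s) / l + x0)"
proof -
  have c: "continuous_on {T..} (\<lambda>s. ln (b s) / l)"
    by (intro continuous_at_imp_continuous_on) (use assms in \<open>auto intro!: DERIV_isCont[OF ln_b_deriv]\<close>)
  show ?thesis
    by (intro continuous_on_add[OF continuous_on_add[OF _ c] continuous_on_const]) (intro continuous_intros)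
qed

end

context kpp
begin

text \<open>The supersolution is at most a constant times \<open>exp (- lam * z / 2)\<close>
  uniformly in time, hence below any given level far enough to the right in the frame.\<close>

lemma front_upper:
  assumes rate: "rate r \<kappa> s0 cB cb cd lam b b'"
    and tail: "\<And>x. x1 \<le> x \<Longrightarrow> u0 x \<le> a * x powr (2 * r + 1) * exp (- lam * x)"
    and a: "0 < a"
  shows "\<exists>T x0. s0 \<le> T \<and> (\<forall>m>0. \<exists>Z. \<forall>t\<ge>0. \<forall>z\<ge>Z. u t (z + (2 * lam * t + ln (b (t + T)) / lam + x0)) < m)"
proof -
  interpret rate r \<kappa> s0 cB cb cd lam b b' by (rule rate)
  obtain T z1 c C H Hs Hz Hzz where T: "s0 \<le> T" and z1: "1 \<le> z1" and c: "0 < c" and C: "0 < C"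
    and hH: "has_partials T UNIV H Hs Hz Hzz"
    and op: "\<And>s z. T < s \<Longrightarrow> z1 < z \<Longrightarrow> 0 \<le> Hs s z - Hzz s z - b' s / (lam * b s) * Hz s z"
    and Hc: "continuous_on ({T..} \<times> UNIV) (\<lambda>(s, z). H s z)"
    and H0: "\<And>s z. T \<le> s \<Longrightarrow> z1 \<le> z \<Longrightarrow> 0 \<le> H s z"
    and Hinit: "\<And>z. z1 \<le> z \<Longrightarrow> c * z powr (2 * r + 1) \<le> H T z"
    and Hbd: "\<And>s. T \<le> s \<Longrightarrow> c * b s \<le> H s z1"
    and Hle: "\<And>s z. T \<le> s \<Longrightarrow> z1 \<le> z \<Longrightarrow> H s z \<le> C * b s * exp (lam / 2 * z)"
    using upper_barrier by blast
  have bp: "0 < b s" if "T \<le> s" for s using b_pos[of s] T that by simp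
  \<comment> \<open>At \<open>s = T\<close> the frame is the plain shift by \<open>y\<close>, so
    every \<open>z \<ge> z1\<close> is mapped into the range of the tail bound.\<close>
  define y where "y = \<bar>x1\<bar>"
  define x0 where "x0 = y - ln (b T) / lam"
  define \<zeta> where "\<zeta> = (\<lambda>s. 2 * lam * (s - T) + ln (b s) / lam + x0)"
  obtain c' C' where C': "0 < C'" "\<And>x. 1 \<le> x \<Longrightarrow> x \<le> 1 + y \<Longrightarrow> c' \<le> x powr (2 * r + 1) \<and> x powr (2 * r + 1) \<le> C'"
    using powr_bounds[of 1 "1 + y" "2 * r + 1"] by (metis zero_less_one)
  \<comment> \<open>The first summand puts \<open>V\<close> above \<open>u0\<close> at
    \<open>s = T\<close>, the second makes \<open>V\<close> at least 1 at
    \<open>z = z1\<close>.\<close>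
  define \<Lambda> where "\<Lambda> = a * C' * b T / c + exp (lam * z1) / c"
  have Lp: "0 < \<Lambda>" using a C' c bp[of T] by (simp add: \<Lambda>_def add_pos_pos)
  define V where "V = (\<lambda>s z. \<Lambda> * exp (- lam * z) * H s z / b s)"
  have le: "u (s - T) (z + \<zeta> s) \<le> V s z" if s: "T \<le> s" and z: "z1 \<le> z" for s z
  proof (rule frame_supersolution[where S = "{z1..}" and \<zeta>' = "\<lambda>s. 2 * lam + b' s / (lam * b s)" and
        \<beta>max = "2 * lam + cb / lam"])
    show "(\<zeta> has_real_derivative 2 * lam + b' s / (lam * b s)) (at s)" if "T < s" for s
      unfolding \<zeta>_def by (rule frame_deriv[OF T that])
    show "continuous_on {T..} \<zeta>" unfolding \<zeta>_def by (rule frame_continuous[OF T])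
    show "\<bar>2 * lam + b' s / (lam * b s)\<bar> \<le> 2 * lam + cb / lam" if "T < s" for s
      using frame_speed_bound[of s] that T by simp
    show "closed {z1..}" by simp
    show "has_partials T (interior {z1..}) V
       (\<lambda>s z. \<Lambda> * exp (- lam * z) * (Hs s z / b s - H s z * b' s / (b s)\<^sup>2))
       (\<lambda>s z. \<Lambda> * exp (- lam * z) * (Hz s z - lam * H s z) / b s)
       (\<lambda>s z. \<Lambda> * exp (- lam * z) * (Hzz s z - 2 * lam * Hz s z + lam\<^sup>2 * H s z) / b s)"
      unfolding V_def
      by (rule has_partials_exp_decay[OF has_partials_subset[OF hH]])
         (use b_deriv bp T in \<open>auto simp: less_imp_neq[symmetric]\<close>)
    show "continuous_on ({T..} \<times> {z1..}) (\<lambda>(s, z). V s z)"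
      unfolding V_def by (rule exp_profile_continuous[OF T _ Hc]) auto
    show "0 \<le> V s z" if "T \<le> s" "z \<in> {z1..}" for s z
      using H0[of s z] bp[of s] that Lp by (simp add: V_def)
    show "1 \<le> V s z" if "T < s" "z \<in> {z1..} - interior {z1..}" for s z
    proof -
      have "z = z1" using that by auto
      have "exp (lam * z1) / c \<le> \<Lambda>" using a C' c bp[of T] by (simp add: \<Lambda>_def)
      then have "exp (lam * z1) / c * exp (- lam * z1) * (c * b s) \<le> \<Lambda> * exp (- lam * z1) * H s z1"
        using Hbd[of s] bp[of s] that Lp c by (intro mult_mono) auto
      moreover have "exp (lam * z1) / c * exp (- lam * z1) * (c * b s) = b s * (exp (lam * z1) * exp (- lam * z1))"
        using c by simp
      ultimately have "b s \<le> \<Lambda> * exp (- lam * z1) * H s z1" by (simp add: exp_add[symmetric])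
      then show ?thesis using \<open>z = z1\<close> bp[of s] that by (simp add: V_def)
    qed
    show "u0 (z + \<zeta> T) \<le> V T z" if "z \<in> {z1..}" for z
    proof -
      have zp: "1 \<le> z" "z1 \<le> z" using that z1 by auto
      have zT: "\<zeta> T = y" by (simp add: \<zeta>_def x0_def)
      have y0: "0 \<le> y" by (simp add: y_def)
      have "(z + y) / z \<le> 1 + y"
      proof -
        have "y * 1 \<le> y * z" using y0 zp by (intro mult_left_mono) auto
        then show ?thesis using zp by (simp add: field_simps)
      qed
      moreover have "1 \<le> (z + y) / z" using zp y0 by (simp add: field_simps)
      ultimately have "((z + y) / z) powr (2 * r + 1) \<le> C'" using C'(2) by blast
      then have "z powr (2 * r + 1) * ((z + y) / z) powr (2 * r + 1) \<le> z powr (2 * r + 1) * C'"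
        by (intro mult_left_mono) auto
      then have pw: "(z + y) powr (2 * r + 1) \<le> C' * z powr (2 * r + 1)"
        using zp y0 by (simp add: powr_mult[symmetric] mult.commute)
      have ex: "exp (- lam * (z + y)) \<le> exp (- lam * z)"
        using lam_pos y0 by simp
      have "u0 (z + y) \<le> a * (z + y) powr (2 * r + 1) * exp (- lam * (z + y))"
        by (rule tail) (use zp y_def in auto)
      also have "\<dots> \<le> a * (C' * z powr (2 * r + 1)) * exp (- lam * z)"
        using pw ex a C' by (intro mult_mono) auto
      also have "\<dots> = a * C' * b T / c * exp (- lam * z) * (c * z powr (2 * r + 1)) / b T"
        using c bp[of T] by simp
      also have "\<dots> \<le> \<Lambda> * exp (- lam * z) * H T z / b T"
      proof (intro divide_right_mono mult_mono)
        show "a * C' * b T / c \<le> \<Lambda>" using c by (simp add: \<Lambda>_def)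
      qed (use Hinit[OF zp(2)] c bp[of T] Lp in auto)
      finally show ?thesis by (simp add: zT V_def)
    qed
    show "\<Lambda> * exp (- lam * z) * (Hzz s z - 2 * lam * Hz s z + lam\<^sup>2 * H s z) / b s +
        (2 * lam + b' s / (lam * b s)) * (\<Lambda> * exp (- lam * z) * (Hz s z - lam * H s z) / b s) + lam\<^sup>2 * V s z
        \<le> \<Lambda> * exp (- lam * z) * (Hs s z / b s - H s z * b' s / (b s)\<^sup>2)"
      if "T < s" "z \<in> interior {z1..}" for s z
    proof -
      have b0: "b s \<noteq> 0" "0 < b s" using bp[of s] that by auto
      have "0 \<le> \<Lambda> * exp (- lam * z) / b s * (Hs s z - Hzz s z - b' s / (lam * b s) * Hz s z)"
        using op[of s z] that Lp b0 by simp
      then show ?thesis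
        unfolding V_def exp_decay_operator[OF less_imp_neq[OF lam_pos, symmetric] b0(1), where Hs = "Hs s z"]
        by simp
    qed
  qed (use s z in auto)
  have "\<exists>Z. \<forall>t\<ge>0. \<forall>z\<ge>Z. u t (z + (2 * lam * t + ln (b (t + T)) / lam + x0)) < m" if m: "0 < m" for m
  proof -
    define Z where "Z = max z1 (2 / lam * (ln (\<Lambda> * C / m) + 1))"
    have "u t (z + (2 * lam * t + ln (b (t + T)) / lam + x0)) < m" if t: "0 \<le> t" and z: "Z \<le> z" for t z
    proof -
      have zz: "z1 \<le> z" "2 / lam * (ln (\<Lambda> * C / m) + 1) \<le> z" using z by (auto simp: Z_def)
      have bt: "0 < b (t + T)" using bp[of "t + T"] t by simp
      have "u t (z + (2 * lam * t + ln (b (t + T)) / lam + x0)) \<le> V (t + T) z"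
        using le[of "t + T" z] t zz by (simp add: \<zeta>_def)
      also have "\<dots> \<le> \<Lambda> * exp (- lam * z) * (C * b (t + T) * exp (lam / 2 * z)) / b (t + T)"
        unfolding V_def using Hle[of "t + T" z] t zz Lp bt by (intro divide_right_mono mult_left_mono) auto
      also have "\<dots> = \<Lambda> * C * (exp (- lam * z) * exp (lam / 2 * z))" using bt by simp
      also have "exp (- lam * z) * exp (lam / 2 * z) = exp (- (lam / 2 * z))" by (simp add: exp_add[symmetric])
      also have "\<Lambda> * C * exp (- (lam / 2 * z)) < \<Lambda> * C * (m / (\<Lambda> * C))"
      proof -
        have "ln (\<Lambda> * C / m) + 1 \<le> lam / 2 * z" using zz(2) lam_pos by (simp add: field_simps)
        then have "exp (- (lam / 2 * z)) < exp (- ln (\<Lambda> * C / m))" by simp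
        also have "\<dots> = m / (\<Lambda> * C)" using Lp C m by (simp add: exp_minus inverse_eq_divide)
        finally show ?thesis using Lp C by (intro mult_strict_left_mono) auto
      qed
      also have "\<dots> = m" using Lp C by simp
      finally show ?thesis .
    qed
    then show ?thesis by blast
  qed
  then show ?thesis using T by blast
qed

lemma front_lower:
  assumes rate: "rate_lower r \<kappa> s0 cB cb cd lam b b' K cr"
    and tail: "\<And>x. x1 \<le> x \<Longrightarrow> a * x powr (2 * r + 1) * exp (- lam * x) \<le> u0 x"
    and a: "0 < a"
  shows "\<exists>T x0. s0 \<le> T \<and> (\<forall>L. \<exists>k>0. \<forall>t\<ge>0. \<forall>z\<in>{0..L}. k \<le> u t (z + (2 * lam * t + ln (b (t + T)) / lam + x0)))"
proof -
  interpret rate_lower r \<kappa> s0 cB cb cd lam b b' K cr by (rule rate)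
  obtain T D C H Hs Hz Hzz where T: "s0 \<le> T" and D: "0 < D" and C: "0 < C"
    and hH: "has_partials T UNIV H Hs Hz Hzz"
    and op: "\<And>s z. T < s \<Longrightarrow> - 1 < z \<Longrightarrow>
       Hs s z - Hzz s z - b' s / (lam * b s) * Hz s z \<le> - (D * b s * exp (- (lam / 2) * z))"
    and Hc: "continuous_on ({T..} \<times> UNIV) (\<lambda>(s, z). H s z)"
    and Hbd: "\<And>s. T \<le> s \<Longrightarrow> H s (- 1) \<le> 0"
    and Hge: "\<And>s z. T \<le> s \<Longrightarrow> 0 \<le> z \<Longrightarrow> D * b s * exp (- (lam / 2) * z) \<le> H s z"
    and Hle: "\<And>s z. T \<le> s \<Longrightarrow> - 1 \<le> z \<Longrightarrow> H s z \<le> C * b s * exp (lam / 8 * z)"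
    and Hinit: "\<And>z. - 1 \<le> z \<Longrightarrow> H T z \<le> C * (z + 2) powr (2 * r + 1)"
    using lower_barrier by blast
  have bp: "0 < b s" if "T \<le> s" for s using b_pos[of s] T that by simp
  obtain M where M: "0 \<le> M" "\<And>x. x \<in> {0..1} \<Longrightarrow> lam\<^sup>2 * x - M * x\<^sup>2 \<le> f x"
    using f_ge by blast
  \<comment> \<open>The added 1 makes up for \<open>z\<close> reaching down to \<open>- 1\<close>,
    so that \<open>z + y\<close> stays in the range of the tail bound; \<open>2 \<le> y\<close>
    keeps \<open>(z + y) / (z + 2)\<close> at least 1.\<close>
  define y where "y = max x1 2 + 1"
  define x0 where "x0 = y - ln (b T) / lam"
  define \<zeta> where "\<zeta> = (\<lambda>s. 2 * lam * (s - T) + ln (b s) / lam + x0)"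
  obtain c' C' where c': "0 < c'" "\<And>x. 1 \<le> x \<Longrightarrow> x \<le> y \<Longrightarrow> c' \<le> x powr (2 * r + 1) \<and> x powr (2 * r + 1) \<le> C'"
    using powr_bounds[of 1 y "2 * r + 1"] by (metis zero_less_one)
  \<comment> \<open>The three entries ensure in turn that \<open>V\<close> starts below
    \<open>u0\<close>, that \<open>V \<le> 1\<close>, and that the quadratic loss of
    \<open>f\<close> fits into the reserve of the barrier.\<close>
  define \<epsilon> where "\<epsilon> = min (a * c' * exp (- lam * y) * b T / C) (min (exp (- lam) / C) (D * exp (- lam) / ((M + 1) * C\<^sup>2)))"
  have ep: "0 < \<epsilon>" using a c' C D M bp[of T] by (simp add: \<epsilon>_def)
  have e1: "\<epsilon> * C \<le> a * c' * exp (- lam * y) * b T"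
    using C by (simp add: \<epsilon>_def pos_le_divide_eq[symmetric] min.coboundedI1)
  have e2: "\<epsilon> * C \<le> exp (- lam)"
    using C by (simp add: \<epsilon>_def pos_le_divide_eq[symmetric] min.coboundedI1 min.coboundedI2)
  have e3: "\<epsilon> * ((M + 1) * C\<^sup>2) \<le> D * exp (- lam)"
    using C M by (simp add: \<epsilon>_def pos_le_divide_eq[symmetric] min.coboundedI1 min.coboundedI2)
  define V where "V = (\<lambda>s z. \<epsilon> * exp (- lam * z) * H s z / b s)"
  have Vle: "V s z \<le> \<epsilon> * C * exp (- (7 / 8 * lam * z))" if "T \<le> s" "- 1 \<le> z" for s z
  proof -
    have "V s z \<le> \<epsilon> * exp (- lam * z) * (C * b s * exp (lam / 8 * z)) / b s"
      unfolding V_def using Hle[OF that] ep bp[OF that(1)] by (intro divide_right_mono mult_left_mono) auto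
    also have "\<dots> = \<epsilon> * C * (exp (- lam * z) * exp (lam / 8 * z))" using bp[OF that(1)] by simp
    also have "exp (- lam * z) * exp (lam / 8 * z) = exp (- (7 / 8 * lam * z))"
      by (simp add: exp_add[symmetric])
    finally show ?thesis .
  qed
  have V1: "V s z \<le> 1" if "T \<le> s" "- 1 \<le> z" for s z
  proof -
    have "lam * (- 1) \<le> lam * z" using that lam_pos by (intro mult_left_mono) auto
    then have "exp (- (7 / 8 * lam * z)) \<le> exp lam" using lam_pos by simp
    then have "\<epsilon> * C * exp (- (7 / 8 * lam * z)) \<le> exp (- lam) * exp lam"
      using e2 by (intro mult_mono) auto
    then show ?thesis using Vle[OF that] by (simp add: exp_add[symmetric])
  qed
  have ge: "V s z \<le> u (s - T) (z + \<zeta> s)" if s: "T \<le> s" and z: "- 1 \<le> z" for s z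
  proof (rule frame_subsolution[where S = "{- 1..}" and \<zeta>' = "\<lambda>s. 2 * lam + b' s / (lam * b s)" and
        \<beta>max = "2 * lam + cb / lam" and s = s and T = T and \<zeta> = \<zeta>])
    show "(\<zeta> has_real_derivative 2 * lam + b' s / (lam * b s)) (at s)" if "T < s" for s
      unfolding \<zeta>_def by (rule frame_deriv[OF T that])
    show "continuous_on {T..} \<zeta>" unfolding \<zeta>_def by (rule frame_continuous[OF T])
    show "\<bar>2 * lam + b' s / (lam * b s)\<bar> \<le> 2 * lam + cb / lam" if "T < s" for s
      using frame_speed_bound[of s] that T by simp
    show "T \<le> T" by simp
    show "closed {- 1 :: real..}" by simp
    show "has_partials T (interior {- 1..}) V
       (\<lambda>s z. \<epsilon> * exp (- lam * z) * (Hs s z / b s - H s z * b' s / (b s)\<^sup>2))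
       (\<lambda>s z. \<epsilon> * exp (- lam * z) * (Hz s z - lam * H s z) / b s)
       (\<lambda>s z. \<epsilon> * exp (- lam * z) * (Hzz s z - 2 * lam * Hz s z + lam\<^sup>2 * H s z) / b s)"
      unfolding V_def
      by (rule has_partials_exp_decay[OF has_partials_subset[OF hH]])
         (use b_deriv bp T in \<open>auto simp: less_imp_neq[symmetric]\<close>)
    show "continuous_on ({T..s} \<times> {- 1..}) (\<lambda>(s, z). V s z)"
      unfolding V_def by (rule exp_profile_continuous[OF T _ Hc]) auto
    show "V s' z \<le> 1" if "T \<le> s'" "z \<in> {- 1..}" for s' z using V1 that by simp
    show "V s' z \<le> 0" if "T < s'" "z \<in> {- 1..} - interior {- 1..}" for s' z
    proof -
      have "z = - 1" using that by auto
      then show ?thesis using Hbd[of s'] bp[of s'] that ep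
        by (simp add: V_def divide_le_0_iff mult_nonneg_nonpos)
    qed
    show "V T z \<le> u (T - T) (z + \<zeta> T)" if "z \<in> {- 1..}" for z
    proof -
      have z: "- 1 \<le> z" using that by simp
      have y: "3 \<le> y" "x1 + 1 \<le> y" by (auto simp: y_def)
      have zT: "\<zeta> T = y" by (simp add: \<zeta>_def x0_def)
      define q where "q = (z + y) / (z + 2)"
      have "1 \<le> q" using z y by (simp add: q_def field_simps)
      moreover have "q \<le> y"
      proof -
        have "0 \<le> (y - 1) * (z + 1)" using y z by (intro mult_nonneg_nonneg) auto
        then have "z + y \<le> y * (z + 2)" using y z by (simp add: algebra_simps)
        then show ?thesis using z by (simp add: q_def divide_le_eq)
      qed
      ultimately have "c' \<le> q powr (2 * r + 1)" using c'(2) by blast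
      then have "(z + 2) powr (2 * r + 1) * c' \<le> (z + 2) powr (2 * r + 1) * q powr (2 * r + 1)"
        by (intro mult_left_mono) auto
      also have "\<dots> = (z + y) powr (2 * r + 1)"
        using z by (simp add: powr_mult[symmetric] q_def)
      finally have pw: "c' * (z + 2) powr (2 * r + 1) \<le> (z + y) powr (2 * r + 1)" by (simp add: mult.commute)
      have "V T z \<le> \<epsilon> * exp (- lam * z) * (C * (z + 2) powr (2 * r + 1)) / b T"
        unfolding V_def using Hinit[OF z] ep bp[of T] by (intro divide_right_mono mult_left_mono) auto
      also have "\<dots> = (\<epsilon> * C) * (exp (- lam * z) * (z + 2) powr (2 * r + 1) / b T)" by simp
      also have "\<dots> \<le> (a * c' * exp (- lam * y) * b T) * (exp (- lam * z) * (z + 2) powr (2 * r + 1) / b T)"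
        using e1 bp[of T] by (intro mult_right_mono) auto
      also have "\<dots> = a * (c' * (z + 2) powr (2 * r + 1)) * (exp (- lam * y) * exp (- lam * z))"
        using bp[of T] by simp
      also have "exp (- lam * y) * exp (- lam * z) = exp (- lam * (z + y))"
        by (simp add: exp_add[symmetric] algebra_simps)
      also have "a * (c' * (z + 2) powr (2 * r + 1)) * exp (- lam * (z + y))
          \<le> a * (z + y) powr (2 * r + 1) * exp (- lam * (z + y))"
        using pw a by (intro mult_right_mono mult_left_mono) auto
      also have "\<dots> \<le> u0 (z + y)" by (rule tail) (use y z in auto)
      finally show ?thesis by (simp add: zT u_init)
    qed
    show "\<epsilon> * exp (- lam * z) * (Hs s' z / b s' - H s' z * b' s' / (b s')\<^sup>2)
      \<le> \<epsilon> * exp (- lam * z) * (Hzz s' z - 2 * lam * Hz s' z + lam\<^sup>2 * H s' z) / b s' +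
        (2 * lam + b' s' / (lam * b s')) * (\<epsilon> * exp (- lam * z) * (Hz s' z - lam * H s' z) / b s') + f (V s' z)"
      if s': "T < s'" "s' \<le> s" and zi: "z \<in> interior {- 1..}" and V0: "0 < V s' z" and Vl: "V s' z \<le> 1" for s' z
    proof -
      have z: "- 1 < z" using zi by simp
      have b0: "b s' \<noteq> 0" "0 < b s'" using bp[of s'] s' by auto
      define w where "w = exp (- (3 / 2 * lam * z))"
      have "\<epsilon> * exp (- lam * z) / b s' * (Hs s' z - Hzz s' z - b' s' / (lam * b s') * Hz s' z)
         \<le> \<epsilon> * exp (- lam * z) / b s' * (- (D * b s' * exp (- (lam / 2) * z)))"
        using op[OF s'(1) z] ep b0 by (intro mult_left_mono) auto
      also have "\<dots> = - (\<epsilon> * D * (exp (- lam * z) * exp (- (lam / 2) * z)))" using b0 by simp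
      also have "exp (- lam * z) * exp (- (lam / 2) * z) = w" by (simp add: w_def exp_add[symmetric])
      finally have o: "\<epsilon> * exp (- lam * z) / b s' * (Hs s' z - Hzz s' z - b' s' / (lam * b s') * Hz s' z) \<le> - (\<epsilon> * D * w)" .
      \<comment> \<open>The loss decays like \<open>exp (- (7 / 4) * lam * z)\<close>, the reserve
        like \<open>w\<close>. Their ratio is at most \<open>exp lam\<close> on
        \<open>- 1 \<le> z\<close>, and since the loss is quadratic in \<open>\<epsilon>\<close>
        while the reserve is linear, a small \<open>\<epsilon>\<close> covers the constants.\<close>
      have Mv: "M * (V s' z)\<^sup>2 \<le> \<epsilon> * D * w"
      proof -
        have "(V s' z)\<^sup>2 \<le> (\<epsilon> * C * exp (- (7 / 8 * lam * z)))\<^sup>2"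
          using Vle[of s' z] V0 z s' by (intro power_mono) auto
        also have "\<dots> = \<epsilon>\<^sup>2 * C\<^sup>2 * (exp (- (7 / 8 * lam * z)))\<^sup>2" by (simp add: power_mult_distrib)
        also have "(exp (- (7 / 8 * lam * z)))\<^sup>2 = w * exp (- (lam * z / 4))"
          by (simp add: w_def power2_eq_square exp_add[symmetric])
        also have "exp (- (lam * z / 4)) \<le> exp lam"
        proof -
          have "lam * (- 1) \<le> lam * z" using z lam_pos by (intro mult_left_mono) auto
          then show ?thesis using lam_pos by simp
        qed
        finally have "(V s' z)\<^sup>2 \<le> \<epsilon>\<^sup>2 * C\<^sup>2 * (w * exp lam)" by (simp add: w_def mult_left_mono)
        then have "M * (V s' z)\<^sup>2 \<le> (M + 1) * (\<epsilon>\<^sup>2 * C\<^sup>2 * (w * exp lam))"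
          using M by (intro mult_mono) auto
        also have "\<dots> = \<epsilon> * (\<epsilon> * ((M + 1) * C\<^sup>2)) * (w * exp lam)" by (simp add: power2_eq_square)
        also have "\<dots> \<le> \<epsilon> * (D * exp (- lam)) * (w * exp lam)"
          using e3 ep by (intro mult_right_mono mult_left_mono) (auto simp: w_def)
        also have "\<dots> = \<epsilon> * D * w * (exp (- lam) * exp lam)" by simp
        also have "\<dots> = \<epsilon> * D * w" by (simp add: exp_add[symmetric])
        finally show ?thesis .
      qed
      have "lam\<^sup>2 * V s' z - M * (V s' z)\<^sup>2 \<le> f (V s' z)" using V0 Vl by (intro M(2)) auto
      moreover have Vd: "\<epsilon> * exp (- lam * z) * H s' z / b s' = V s' z" by (simp add: V_def)
      note exp_decay_operator[OF less_imp_neq[OF lam_pos, symmetric] b0(1), where Hs = "Hs s' z" and H = "H s' z"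
          and Hz = "Hz s' z" and Hzz = "Hzz s' z" and B' = "b' s'" and c = \<epsilon> and E = "exp (- lam * z)", unfolded Vd]
      ultimately show ?thesis using o Mv by linarith
    qed
  qed (use s z in auto)
  have "\<exists>k>0. \<forall>t\<ge>0. \<forall>z\<in>{0..L}. k \<le> u t (z + (2 * lam * t + ln (b (t + T)) / lam + x0))" for L
  proof (intro exI[of _ "\<epsilon> * D * exp (- (3 / 2 * lam * L))"] conjI allI impI ballI)
    show "0 < \<epsilon> * D * exp (- (3 / 2 * lam * L))" using ep D by simp
    fix t z :: real assume t: "0 \<le> t" and z: "z \<in> {0..L}"
    have bt: "0 < b (t + T)" using bp[of "t + T"] t by simp
    have "\<epsilon> * D * exp (- (3 / 2 * lam * L)) \<le> \<epsilon> * D * exp (- (3 / 2 * lam * z))"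
      using z lam_pos ep D by simp
    also have "exp (- (3 / 2 * lam * z)) = exp (- lam * z) * exp (- (lam / 2) * z)"
      by (simp add: exp_add[symmetric])
    also have "\<epsilon> * D * (exp (- lam * z) * exp (- (lam / 2) * z)) = \<epsilon> * exp (- lam * z) * (D * b (t + T) * exp (- (lam / 2) * z)) / b (t + T)"
      using bt by simp
    also have "\<dots> \<le> V (t + T) z"
      unfolding V_def using Hge[of "t + T" z] t z ep bt by (intro divide_right_mono mult_left_mono) auto
    also have "\<dots> \<le> u t (z + (2 * lam * t + ln (b (t + T)) / lam + x0))"
      using ge[of "t + T" z] t z by (simp add: \<zeta>_def)
    finally show "\<epsilon> * D * exp (- (3 / 2 * lam * L)) \<le> u t (z + (2 * lam * t + ln (b (t + T)) / lam + x0))" .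
  qed
  then show ?thesis using T by blast
qed

text \<open>The frequency with \<open>w\<^sup>2 = \<rho> / 2\<close> splits the reaction
  \<open>\<rho> * V\<close> evenly: one half balances diffusion, the other drives exponential
  growth. The length \<open>pi / w\<close> makes the cosine vanish at both ends. \<open>L\<close>
  depends on \<open>m\<close> alone and \<open>\<tau>\<close> on \<open>m\<close> and
  \<open>k\<close> only, so the waiting time is uniform over starting times and places.\<close>

lemma hair_trigger:
  assumes m: "0 < m" "m < 1"
  shows "\<exists>L. \<forall>k>0. \<exists>\<tau>\<ge>0. \<forall>t0\<ge>0. \<forall>y. (\<forall>x\<in>{y..y + L}. k \<le> u t0 x) \<longrightarrow> m \<le> u (t0 + \<tau>) (y + L / 2)"
proof -
  obtain \<rho> where rho: "0 < \<rho>" "\<And>x. x \<in> {0..m} \<Longrightarrow> \<rho> * x \<le> f x"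
    using f_linear_lower[OF m] by blast
  define w where "w = sqrt (\<rho> / 2)"
  have w: "0 < w" "w\<^sup>2 = \<rho> / 2" using rho by (auto simp: w_def)
  define L where "L = pi / w"
  have L: "0 < L" using w by (simp add: L_def)
  have "\<exists>\<tau>\<ge>0. \<forall>t0\<ge>0. \<forall>y. (\<forall>x\<in>{y..y + L}. k \<le> u t0 x) \<longrightarrow> m \<le> u (t0 + \<tau>) (y + L / 2)"
    if k: "0 < k" for k
  proof -
    \<comment> \<open>Capped by \<open>m\<close> so that the growth time \<open>\<tau>\<close> is
      nonnegative.\<close>
    define c where "c = min k m"
    have c: "0 < c" "c \<le> k" "c \<le> m" using k m by (auto simp: c_def)
    define \<tau> where "\<tau> = ln (m / c) / (\<rho> / 2)"
    have tau: "0 \<le> \<tau>" using c rho by (simp add: \<tau>_def)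
    have growth: "c * exp (\<rho> / 2 * \<tau>) = m" using c rho m by (simp add: \<tau>_def)
    have "m \<le> u (t0 + \<tau>) (y + L / 2)" if t0: "0 \<le> t0" and ini: "\<forall>x\<in>{y..y + L}. k \<le> u t0 x" for t0 y
    proof -
      define V where "V = (\<lambda>s x. c * exp (\<rho> / 2 * (s - t0)) * cos (w * (x - (y + L / 2))))"
      have Vm: "V s x \<le> m" if "s \<le> t0 + \<tau>" for s x
      proof -
        have "c * exp (\<rho> / 2 * (s - t0)) \<le> c * exp (\<rho> / 2 * \<tau>)" using c rho that by simp
        then have "c * exp (\<rho> / 2 * (s - t0)) \<le> m" using growth by simp
        moreover have "V s x \<le> c * exp (\<rho> / 2 * (s - t0)) * 1"
          unfolding V_def using c by (intro mult_left_mono) auto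
        ultimately show ?thesis by simp
      qed
      have "V (t0 + \<tau>) (y + L / 2) \<le> u (t0 + \<tau> - 0) (y + L / 2 + 0)"
      proof (rule frame_subsolution[where V = V and s = "t0 + \<tau>" and z = "y + L / 2" and T = 0 and \<zeta> = "\<lambda>_. 0" and \<zeta>' = "\<lambda>_. 0" and \<beta>max = 0 and s0 = t0
            and S = "{y..y + L}" and Vs = "\<lambda>s x. \<rho> / 2 * V s x"
            and Vz = "\<lambda>s x. - w * (c * exp (\<rho> / 2 * (s - t0)) * sin (w * (x - (y + L / 2))))"
            and Vzz = "\<lambda>s x. - (w\<^sup>2) * V s x"])
        show "has_partials t0 (interior {y..y + L}) V (\<lambda>s x. \<rho> / 2 * V s x)
           (\<lambda>s x. - w * (c * exp (\<rho> / 2 * (s - t0)) * sin (w * (x - (y + L / 2))))) (\<lambda>s x. - (w\<^sup>2) * V s x)"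
          unfolding has_partials_def V_def
          by (auto intro!: derivative_eq_intros simp: power2_eq_square)
        show "continuous_on ({t0..t0 + \<tau>} \<times> {y..y + L}) (\<lambda>(s, x). V s x)"
          unfolding V_def case_prod_beta by (intro continuous_intros)
        show "V s' z \<le> 1" if "s' \<le> t0 + \<tau>" for s' z using Vm[OF that, of z] m by simp
        show "V t0 z \<le> u (t0 - 0) (z + 0)" if "z \<in> {y..y + L}" for z
        proof -
          have "V t0 z \<le> c * 1" unfolding V_def using c by (simp add: mult_left_le)
          then show ?thesis using ini that c by force
        qed
        show "V s' z \<le> 0" if "z \<in> {y..y + L} - interior {y..y + L}" for s' z
        proof -
          have "z = y \<or> z = y + L" using that by (auto simp: interior_atLeastAtMost_real)
          moreover have "w * (L / 2) = pi / 2" using w by (simp add: L_def)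
          ultimately have "cos (w * (z - (y + L / 2))) = 0"
            by (auto simp: algebra_simps cos_minus[of "w * L / 2", symmetric])
          then show ?thesis by (simp add: V_def)
        qed
        show "\<rho> / 2 * V s' z \<le> - (w\<^sup>2) * V s' z +
            0 * (- w * (c * exp (\<rho> / 2 * (s' - t0)) * sin (w * (z - (y + L / 2))))) + f (V s' z)"
          if "s' \<le> t0 + \<tau>" "0 < V s' z" for s' z
        proof -
          have "\<rho> * V s' z \<le> f (V s' z)" using Vm[OF that(1), of z] that(2) by (intro rho(2)) auto
          then show ?thesis unfolding w(2) by simp
        qed
      qed (use t0 tau L in auto)
      moreover have "V (t0 + \<tau>) (y + L / 2) = m" using growth by (simp add: V_def)
      ultimately show ?thesis by simp
    qed
    then show ?thesis using tau by blast
  qed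
  then show ?thesis by blast
qed

text \<open>The upper barrier bounds the superlevel set from above, and the bump places a point in
  it. Both facts are needed before the supremum defining \<open>front\<close> can be estimated at
  all; then they enclose it between positions that differ by a bounded amount.\<close>

lemma front_asymptotics:
  assumes rate: "rate_lower r \<kappa> s0 cB cb cd lam b b' K cr"
    and upper: "eventually (\<lambda>x. u0 x \<le> a2 * x powr (2 * r + 1) * exp (- lam * x)) at_top" "0 < a2"
    and lower: "eventually (\<lambda>x. a1 * x powr (2 * r + 1) * exp (- lam * x) \<le> u0 x) at_top" "0 < a1"
    and m: "0 < m" "m < 1"
  shows "\<exists>C. eventually (\<lambda>t. \<bar>front u m t - 2 * lam * t - ln (b t) / lam\<bar> \<le> C) at_top"
proof -
  interpret rate_lower r \<kappa> s0 cB cb cd lam b b' K cr by (rule rate)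
  obtain x1 where x1: "\<And>x. x1 \<le> x \<Longrightarrow> u0 x \<le> a2 * x powr (2 * r + 1) * exp (- lam * x)"
    using upper(1) unfolding eventually_at_top_linorder by blast
  obtain x2 where x2: "\<And>x. x2 \<le> x \<Longrightarrow> a1 * x powr (2 * r + 1) * exp (- lam * x) \<le> u0 x"
    using lower(1) unfolding eventually_at_top_linorder by blast
  obtain T1 y1 where T1: "s0 \<le> T1"
    and up: "\<forall>m>0. \<exists>Z. \<forall>t\<ge>0. \<forall>z\<ge>Z. u t (z + (2 * lam * t + ln (b (t + T1)) / lam + y1)) < m"
    using front_upper[OF rate_axioms x1 upper(2)] by blast
  obtain T2 y2 where T2: "s0 \<le> T2"
    and lo: "\<forall>L. \<exists>k>0. \<forall>t\<ge>0. \<forall>z\<in>{0..L}. k \<le> u t (z + (2 * lam * t + ln (b (t + T2)) / lam + y2))"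
    using front_lower[OF rate x2 lower(2)] by blast
  obtain Z where Z: "\<forall>t\<ge>0. \<forall>z\<ge>Z. u t (z + (2 * lam * t + ln (b (t + T1)) / lam + y1)) < m"
    using up m(1) by blast
  obtain L where L: "\<forall>k>0. \<exists>\<tau>\<ge>0. \<forall>t0\<ge>0. \<forall>y. (\<forall>x\<in>{y..y + L}. k \<le> u t0 x) \<longrightarrow> m \<le> u (t0 + \<tau>) (y + L / 2)"
    using hair_trigger[OF m] by blast
  obtain k where k: "0 < k" "\<forall>t\<ge>0. \<forall>z\<in>{0..L}. k \<le> u t (z + (2 * lam * t + ln (b (t + T2)) / lam + y2))"
    using spec[OF lo, of L] by blast
  obtain \<tau> where tau: "0 \<le> \<tau>"
    and ht: "\<forall>t0\<ge>0. \<forall>y. (\<forall>x\<in>{y..y + L}. k \<le> u t0 x) \<longrightarrow> m \<le> u (t0 + \<tau>) (y + L / 2)"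
    using L k(1) by blast
  define C where "C = \<bar>Z + y1\<bar> + cb / lam * T1 + \<bar>y2 + L / 2\<bar> + 2 * lam * \<tau> + cb / lam * \<bar>T2 - \<tau>\<bar>"
  have cl: "0 \<le> cb / lam" using cb l_pos by simp
  have "\<bar>front u m t - 2 * lam * t - ln (b t) / lam\<bar> \<le> C" if t: "s0 + \<tau> \<le> t" for t
  proof -
    have t': "0 \<le> t" "s0 \<le> t" "\<tau> \<le> t" "s0 \<le> t + T1" "s0 \<le> t - \<tau> + T2" using t tau s0 T1 T2 by auto
    have above: "x \<le> Z + (2 * lam * t + ln (b (t + T1)) / lam + y1)" if "m \<le> u t x" for x
      using Z[rule_format, OF t'(1), of "x - (2 * lam * t + ln (b (t + T1)) / lam + y1)"] that by force
    \<comment> \<open>The window is taken at time \<open>t - \<tau>\<close>, so that the bump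
      started there reaches \<open>m\<close> exactly at time \<open>t\<close>.\<close>
    define y where "y = 2 * lam * (t - \<tau>) + ln (b (t - \<tau> + T2)) / lam + y2"
    have "k \<le> u (t - \<tau>) x" if "x \<in> {y..y + L}" for x
      using k(2)[rule_format, of "t - \<tau>" "x - y"] that t' by (simp add: y_def)
    then have mem: "m \<le> u t (y + L / 2)" using ht[rule_format, of "t - \<tau>" y] t' by simp
    have bdd: "bdd_above {x. u t x \<ge> m}" using above by (intro bdd_aboveI) auto
    have u1: "front u m t \<le> Z + (2 * lam * t + ln (b (t + T1)) / lam + y1)"
      unfolding front_def by (rule cSup_least) (use mem above in auto)
    have l1: "y + L / 2 \<le> front u m t"
      unfolding front_def by (rule cSup_upper[OF _ bdd]) (use mem in simp)
    have d1: "\<bar>ln (b (t + T1)) / lam - ln (b t) / lam\<bar> \<le> cb / lam * T1"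
      using ln_b_lipschitz[OF t'(4,2)] T1 s0 by simp
    have d2: "\<bar>ln (b (t - \<tau> + T2)) / lam - ln (b t) / lam\<bar> \<le> cb / lam * \<bar>T2 - \<tau>\<bar>"
      using ln_b_lipschitz[OF t'(5,2)] by (simp add: algebra_simps)
    have n: "0 \<le> cb / lam * T1" "0 \<le> cb / lam * \<bar>T2 - \<tau>\<bar>" "0 \<le> 2 * lam * \<tau>"
      using mult_nonneg_nonneg[OF cl] T1 s0 tau lam_pos by auto
    have ye: "y = 2 * lam * t - 2 * lam * \<tau> + ln (b (t - \<tau> + T2)) / lam + y2"
      by (simp add: y_def algebra_simps)
    show ?thesis unfolding C_def using u1 l1 d1 d2 n unfolding ye by linarith
  qed
  then show ?thesis unfolding eventually_at_top_linorder by blast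
qed

end

section \<open>The two rates: a power, and the critical power with a logarithm\<close>

lemma rate_lower_powr:
  fixes r l :: real
  assumes r: "- 3 / 2 < r" and l: "0 < l"
  shows "rate_lower r (r + 3 / 2) 1 1 (\<bar>r\<bar> + 1) (\<bar>r\<bar> + 1) l (\<lambda>s. s powr r) (\<lambda>s. r * s powr (r - 1))
    (if r < 0 then 7 else 1) 1"
proof unfold_locales
  fix s :: real assume s: "1 \<le> s"
  have p: "s powr (r - 1) = s powr r / s" using s by (simp add: powr_diff)
  show "((\<lambda>s. s powr r) has_real_derivative r * s powr (r - 1)) (at s)"
    using s by (intro has_real_derivative_powr) auto
  show "s powr r \<le> 1 * s powr (r + 1 / 8)" using s by (simp add: powr_mono)
  have "\<bar>r\<bar> * (s powr r / s) \<le> (\<bar>r\<bar> + 1) * (s powr r / s)" using s by (intro mult_right_mono) auto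
  then show "\<bar>r * s powr (r - 1)\<bar> \<le> (\<bar>r\<bar> + 1) * s powr r / s"
    using s unfolding p by (simp add: abs_mult)
  show "r * s powr (r - 1) \<le> (\<bar>r\<bar> + 1) * s powr (r - 1)" by (intro mult_right_mono) auto
  \<comment> \<open>This holds with equality, so \<open>\<kappa>\<close> is positive precisely for
    \<open>r > - 3 / 2\<close>.\<close>
  show "(r + 3 / 2) * s powr (r - 1) \<le> r * s powr (r - 1) + 3 / 2 * s powr r / s"
    unfolding p by (simp add: algebra_simps)
  show "\<bar>r * s powr (r - 1)\<bar> \<le> 1 * \<bar>r\<bar> * s powr r / s"
    using s unfolding p by (simp add: abs_mult)
next
  \<comment> \<open>For negative \<open>r\<close> both brackets must be positive, and
    \<open>K = 7\<close> gives \<open>K * (K - 6) = K\<close>. For nonnegative \<open>r\<close> both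
    must be negative, and \<open>K = 1\<close> gives \<open>- 1 - 4 * r\<close> and
    \<open>- 5\<close>.\<close>
  show "r * ((if r < 0 then 7 else 1) - 2 - 4 * r) \<le> - \<bar>r\<bar>"
  proof (cases "r < 0")
    case True
    have "0 \<le> (- r) * (4 - 4 * r)" using True by (intro mult_nonneg_nonneg) auto
    then show ?thesis using True by (simp add: algebra_simps)
  next
    case False
    then show ?thesis using mult_nonneg_nonneg[of r r] by (simp add: algebra_simps)
  qed
qed (use r l in auto)

text \<open>At the exponent \<open>- 3 / 2\<close> the power alone satisfies
  \<open>b' s + 3 / 2 * b s / s = 0\<close>; differentiating the logarithm contributes
  \<open>s powr (- 3 / 2 - 1)\<close>, whence \<open>\<kappa> = 1\<close>. Starting at
  \<open>exp 1\<close> gives \<open>1 \<le> ln s\<close>. The 8 comes from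
  \<open>ln s \<le> 8 * s powr (1 / 8)\<close>, the \<open>5 / 2\<close> from
  \<open>\<bar>1 - 3 / 2 * ln s\<bar> \<le> 5 / 2 * ln s\<close>, and \<open>5 / 3\<close> is
  \<open>5 / 2\<close> divided by the absolute value of the exponent.\<close>

lemma rate_lower_powr_ln:
  fixes l :: real
  assumes l: "0 < l"
  shows "rate_lower (- 3 / 2) 1 (exp 1) 8 (5 / 2) 1 l (\<lambda>s. s powr (- 3 / 2) * ln s)
    (\<lambda>s. (- 3 / 2) * s powr (- 3 / 2 - 1) * ln s + s powr (- 3 / 2 - 1)) 7 (5 / 3)"
proof unfold_locales
  fix s :: real assume s: "exp 1 \<le> s"
  have sp: "0 < s" "1 \<le> s" "1 \<le> ln s"
    using s exp_gt_zero[of "1::real"] one_le_exp_iff[of "1::real"] ln_ge_iff[of s 1] by linarith+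
  define X where "X = s powr (- 3 / 2)"
  have X: "0 < X" using sp by (simp add: X_def)
  have p: "s powr (- 3 / 2 - 1) = X / s" using sp unfolding X_def by (subst powr_diff) simp
  show "((\<lambda>s. s powr (- 3 / 2) * ln s) has_real_derivative
      (- 3 / 2) * s powr (- 3 / 2 - 1) * ln s + s powr (- 3 / 2 - 1)) (at s)"
  proof (rule DERIV_cong[OF DERIV_mult[OF has_real_derivative_powr DERIV_ln_divide]])
    show "(- 3 / 2) * s powr (- 3 / 2 - 1) * ln s + 1 / s * s powr (- 3 / 2) =
       (- 3 / 2) * s powr (- 3 / 2 - 1) * ln s + s powr (- 3 / 2 - 1)"
      unfolding p X_def[symmetric] by simp
  qed (use sp in auto)
  show "s powr (- 3 / 2) \<le> s powr (- 3 / 2) * ln s" using sp by (simp add: mult_le_cancel_left1)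
  have "ln s = 8 * ln (s powr (1 / 8))" using sp by (simp add: ln_powr)
  also have "\<dots> \<le> 8 * s powr (1 / 8)" using ln_le_minus_one[of "s powr (1 / 8)"] sp by simp
  finally have "X * ln s \<le> X * (8 * s powr (1 / 8))" using X by (intro mult_left_mono) auto
  then show "s powr (- 3 / 2) * ln s \<le> 8 * s powr (- 3 / 2 + 1 / 8)"
    unfolding powr_add X_def by (simp add: mult_ac)
  have a: "\<bar>(- 3 / 2) * s powr (- 3 / 2 - 1) * ln s + s powr (- 3 / 2 - 1)\<bar> \<le> 5 / 2 * (X * ln s) / s"
  proof -
    have "(- 3 / 2) * s powr (- 3 / 2 - 1) * ln s + s powr (- 3 / 2 - 1) = X / s * (1 - 3 / 2 * ln s)"
      unfolding p by (simp add: algebra_simps)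
    moreover have "\<bar>1 - 3 / 2 * ln s\<bar> \<le> 5 / 2 * ln s" using sp by simp
    then have "X / s * \<bar>1 - 3 / 2 * ln s\<bar> \<le> X / s * (5 / 2 * ln s)" using X sp by (intro mult_left_mono) auto
    ultimately show ?thesis using X sp by (simp add: abs_mult)
  qed
  then show "\<bar>(- 3 / 2) * s powr (- 3 / 2 - 1) * ln s + s powr (- 3 / 2 - 1)\<bar> \<le> 5 / 2 * (s powr (- 3 / 2) * ln s) / s"
    unfolding X_def .
  show "\<bar>(- 3 / 2) * s powr (- 3 / 2 - 1) * ln s + s powr (- 3 / 2 - 1)\<bar> \<le> 5 / 3 * \<bar>- 3 / 2\<bar> * (s powr (- 3 / 2) * ln s) / s"
    using a unfolding X_def by simp
  show "(- 3 / 2) * s powr (- 3 / 2 - 1) * ln s + s powr (- 3 / 2 - 1) \<le> 1 * s powr (- 3 / 2 - 1)"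
    using sp by simp
  show "1 * s powr (- 3 / 2 - 1) \<le> (- 3 / 2) * s powr (- 3 / 2 - 1) * ln s + s powr (- 3 / 2 - 1) + 3 / 2 * (s powr (- 3 / 2) * ln s) / s"
    unfolding p X_def[symmetric] by simp
next
  have "(- 3 / 2) * s powr (- 3 / 2 - 1) * ln s + s powr (- 3 / 2 - 1) + 3 / 2 * (s powr (- 3 / 2) * ln s) / s = s powr (- 3 / 2 - 1)"
    if "exp 1 \<le> s" for s :: real
  proof -
    have sp: "0 < s" using that exp_gt_zero[of "1::real"] by linarith
    have p: "s powr (- 3 / 2 - 1) = s powr (- 3 / 2) / s" using sp by (subst powr_diff) simp
    show ?thesis unfolding p by simp
  qed
  then show "(\<forall>s\<ge>exp 1 :: real. s powr (- 3 / 2) * ln s = s powr (- 3 / 2)) \<or>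
    (- 3 / 2 :: real) < 0 \<and> (\<forall>s\<ge>exp 1 :: real. s powr (- 3 / 2) * ln s = s powr (- 3 / 2) * ln s \<and>
       (- 3 / 2) * s powr (- 3 / 2 - 1) * ln s + s powr (- 3 / 2 - 1) + 3 / 2 * (s powr (- 3 / 2) * ln s) / s = s powr (- 3 / 2 - 1))"
    by auto
qed (use l in auto)

theorem theorem1p1:
  fixes f f1 f2 u0 :: "real \<Rightarrow> real" and u :: "real \<Rightarrow> real \<Rightarrow> real"
    and k a1 a2 :: real
  assumes f_deriv: "\<forall>x. (f has_real_derivative f1 x) (at x)"
    and f1_deriv: "\<forall>x\<in>{0..1}. (f1 has_real_derivative f2 x) (at x within {0..1})"
    and f2_cont: "continuous_on {0..1} f2"
    and f_left: "\<forall>x<0. f x = f1 0 * x"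
    and f_right: "\<forall>x>1. f x = f1 1 * (x - 1)"
    and f0: "f 0 = 0" and f1z: "f 1 = 0"
    and f_kpp: "\<forall>s\<in>{0<..<1}. 0 < f s \<and> f s \<le> f1 0 * s"
    and u0_cont: "continuous_on UNIV u0"
    and u0_range: "\<forall>x. u0 x \<in> {0..1}"
    and u0_nz: "\<exists>x. u0 x \<noteq> 0"
    and k_ge: "k \<ge> -3"
    and a_pos: "0 < a1" "a1 \<le> a2"
    and u0_tail: "eventually (\<lambda>x. a1 * x powr (k+1) * exp (- sqrt (f1 0) * x) \<le> u0 x \<and>
                                  u0 x \<le> a2 * x powr (k+1) * exp (- sqrt (f1 0) * x)) at_top"
    and u_sol: "classical_solution f u0 u"
  shows "\<forall>m\<in>{0<..<1}.
     (k > -3 \<longrightarrow> (\<exists>C. eventually (\<lambda>t.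
         \<bar>front u m t - 2 * sqrt (f1 0) * t - k / (2 * sqrt (f1 0)) * ln t\<bar> \<le> C) at_top)) \<and>
     (k = -3 \<longrightarrow> (\<exists>C. eventually (\<lambda>t.
         \<bar>front u m t - 2 * sqrt (f1 0) * t + 3 / (2 * sqrt (f1 0)) * ln t
            - 1 / sqrt (f1 0) * ln (ln t)\<bar> \<le> C) at_top))"
proof -
  interpret kpp f f1 f2 u0 u
    by unfold_locales (use f_deriv f1_deriv f2_cont f_left f_right f0 f1z f_kpp u0_range u_sol in auto)
  have tails: "eventually (\<lambda>x. u0 x \<le> a2 * x powr (2 * (k / 2) + 1) * exp (- lam * x)) at_top"
    "eventually (\<lambda>x. a1 * x powr (2 * (k / 2) + 1) * exp (- lam * x) \<le> u0 x) at_top"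
    using u0_tail by (auto simp: lam_def elim!: eventually_mono)
  have a2: "0 < a2" using a_pos by linarith
  show ?thesis
  proof (intro ballI conjI impI)
    fix m :: real assume "m \<in> {0<..<1}" and k: "k > -3"
    then have m: "0 < m" "m < 1" by auto
    have "rate_lower (k / 2) (k / 2 + 3 / 2) 1 1 (\<bar>k / 2\<bar> + 1) (\<bar>k / 2\<bar> + 1) lam (\<lambda>s. s powr (k / 2))
       (\<lambda>s. k / 2 * s powr (k / 2 - 1)) (if k / 2 < 0 then 7 else 1) 1"
      by (rule rate_lower_powr) (use k lam_pos in auto)
    from front_asymptotics[OF this tails(1) a2 tails(2) a_pos(1) m]
    obtain C where C: "eventually (\<lambda>t. \<bar>front u m t - 2 * lam * t - ln (t powr (k / 2)) / lam\<bar> \<le> C) at_top"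
      by blast
    have "eventually (\<lambda>t. \<bar>front u m t - 2 * lam * t - k / (2 * lam) * ln t\<bar> \<le> C) at_top"
      using C eventually_gt_at_top[of 0]
      by eventually_elim (simp add: ln_powr mult.commute)
    then show "\<exists>C. eventually (\<lambda>t. \<bar>front u m t - 2 * sqrt (f1 0) * t - k / (2 * sqrt (f1 0)) * ln t\<bar> \<le> C) at_top"
      unfolding lam_def by blast
  next
    fix m :: real assume "m \<in> {0<..<1}" and k: "k = -3"
    then have m: "0 < m" "m < 1" by auto
    have k2: "k / 2 = - 3 / 2" using k by simp
    from front_asymptotics[OF rate_lower_powr_ln[OF lam_pos] tails(1)[unfolded k2] a2 tails(2)[unfolded k2] a_pos(1) m]
    obtain C where C: "eventually (\<lambda>t. \<bar>front u m t - 2 * lam * t - ln (t powr (- 3 / 2) * ln t) / lam\<bar> \<le> C) at_top"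
      by blast
    have "eventually (\<lambda>t. \<bar>front u m t - 2 * lam * t + 3 / (2 * lam) * ln t - 1 / lam * ln (ln t)\<bar> \<le> C) at_top"
      using C eventually_gt_at_top[of 1]
    proof eventually_elim
      case (elim t)
      have "ln (t powr (- 3 / 2) * ln t) = - 3 / 2 * ln t + ln (ln t)"
        using elim by (simp add: ln_mult ln_powr)
      then have "ln (t powr (- 3 / 2) * ln t) / lam = - (3 / (2 * lam) * ln t) + 1 / lam * ln (ln t)"
        using lam_pos by (simp add: field_simps)
      then show ?case using elim by (simp add: algebra_simps)
    qed
    then show "\<exists>C. eventually (\<lambda>t. \<bar>front u m t - 2 * sqrt (f1 0) * t + 3 / (2 * sqrt (f1 0)) * ln t
            - 1 / sqrt (f1 0) * ln (ln t)\<bar> \<le> C) at_top"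
      unfolding lam_def by blast
  qed
qed

end
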